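(* Let $f(\tau)=\prod_{n\mid N}\eta(n\tau)^{r_n}=\sum_nc_f(n)q^n$ be a weakly admissible eta-quotient of level $N$ and weight $k$, and for $l\in L_f$ let $$c_l=l^{-\frac k2}\sum_{\substack{a\mid l,\ d=l/a\\(a,N)=1}}\Big(\frac a\varpi\Big)a^kc_f\Big(\frac{l x_N}{24a^2}\Big)\sum_{\substack{0\le b<d\\(a,b,d)=1}}\Big(\frac{-Nb}{(a,d)}\Big)^{2k}e\Big(bd\Big(\frac{x_N}{24l}-\frac{x_N}{24}\Big)\Big)\psi_{l,\mathbf r}(a,b)$$ (with $c_f(y)=0$ if $y\notin\frac{x_N}{24}+\mathbb{Z}$). Then $l\mapsto c_l$ is multiplicative on $L_f$: $c_{l_1l_2}=c_{l_1}c_{l_2}$ for all $l_1,l_2\in L_f$ with $\gcd(l_1,l_2)=1$ (gcd in the positive integers).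
   Context: $e(x)=\exp(2\pi ix)$, $q=e(\tau)$, $\eta(\tau)=q^{1/24}\prod(1-q^n)$, $r_n\in\mathbb{Z}$, level $N=\operatorname{lcm}\{n:r_n\ne0\}$, $k=\frac12\sum r_n$, $\mathbf r=(r_n)_{n\mid N}$, $x_N=\sum nr_n$, $\varpi=\prod(N/n)^{|r_n|}$; $f=\sum_{n\in\frac{x_N}{24}+\mathbb{Z}_{\ge0}}c_f(n)q^n$. $\widetilde{\Gamma_0(N)}$: pairs $(\gamma,\varepsilon(c\tau+d)^{1/2})$, $\gamma=\begin{pmatrix}a&b\\c&d\end{pmatrix}\in\Gamma_0(N)$, $\varepsilon=\pm1$, principal root, product $(\gamma_1,\phi_1)(\gamma_2,\phi_2)=(\gamma_1\gamma_2,\phi_1(\gamma_2\tau)\phi_2(\tau))$; $(g|_k(\gamma,\phi))(\tau)=\phi(\tau)^{-2k}g(\gamma\tau)$. Character of $f$: $\chi(\gamma,\varepsilon(c\tau+d)^{1/2})=\varepsilon^{-2k}e(\frac1{24}\sum r_n\Psi\begin{pmatrix}a&bn\\c/n&d\end{pmatrix})$, $\Psi\begin{pmatrix}a&b\\c&d\end{pmatrix}=\frac{a+d}c+12s(-d,c)-3$ ($c>0$), $\frac{a+d}c+12s(d,-c)+3$ ($c<0$), $b$ ($c=0,a>0$), $-b-6$ ($c=0,a<0$), $s$ Dedekind sum. Weakly admissible: $f\in M_k(\Gamma_0(N),\chi)$ and either $\dim M_k(\Gamma_0(N),\chi)=1$ or ($\dim M_k\ge2$, $\dim S_k(\Gamma_0(N),\chi)=1$,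 $f$ a cusp form), where $M_k,S_k$ are the spaces of holomorphic $g$ with $g|_k\gamma=\chi(\gamma)g$ whose expansions at all cusps have only nonnegative (resp. positive) exponents. $m_f=24/\gcd(24,\sum(N/n)r_n,\sum nr_n)$; $L_f=\{l\ge1:l\equiv1\bmod m_f\}$ if $k\in\mathbb{Z}$, additionally perfect squares if $k\in\frac12+\mathbb{Z}$. With $d=l/a$: $\psi_{l,\mathbf r}(a,b)=e(-\frac{k+\delta}4(d-1)+\frac{(k+\delta)(l-1)(N-1)}4)$ if $2\nmid l$; $e(-\frac{k+\delta}4(a-1)-\frac{N(k+\delta)(1+\delta_1)}4b)$ if $2\mid l,2\mid N$; $1$ if $2\mid l,2\nmid N$; $\delta=0$ (resp. $1$) if $\varpi=2^\alpha(4m+1)$ (resp. $2^\alpha(4m+3)$); $\delta_1=1$ if $2\mid l$, $4\mid N$, $k\in\frac12+\mathbb{Z}$, $v_2(\varpi)$ odd, else $0$. $(\frac mn)$: Kronecker–Jacobi symbol with $(\frac m0)=0$ for $m\ne\pm1$, $(\frac{\pm1}0)=1$. *)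

theory Defs
  imports "HOL-Complex_Analysis.Complex_Analysis" "HOL-Number_Theory.Number_Theory"
    "HOL-Computational_Algebra.Formal_Power_Series" "HOL-Library.Function_Algebras"
begin

definition ee :: "real \<Rightarrow> complex" where
  "ee x = exp (2 * of_real pi * \<i> * of_real x)"

definition eC :: "complex \<Rightarrow> complex" where
  "eC z = exp (2 * of_real pi * \<i> * z)"

definition eta :: "complex \<Rightarrow> complex" where
  "eta \<tau> = (if Im \<tau> > 0 then eC (\<tau> / 24) * prodinf (\<lambda>n. 1 - eC (of_nat (Suc n) * \<tau>)) else 0)"

definition eta_quotient :: "nat \<Rightarrow> (nat \<Rightarrow> int) \<Rightarrow> complex \<Rightarrow> complex" where
  "eta_quotient N r \<tau> =
     (if Im \<tau> > 0 then (\<Prod>n | n dvd N. eta (of_nat n * \<tau>) powi r n) else 0)"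

definition twok :: "nat \<Rightarrow> (nat \<Rightarrow> int) \<Rightarrow> int" where
  "twok N r = (\<Sum>n | n dvd N. r n)"

definition wt :: "nat \<Rightarrow> (nat \<Rightarrow> int) \<Rightarrow> real" where
  "wt N r = real_of_int (twok N r) / 2"

definition xN :: "nat \<Rightarrow> (nat \<Rightarrow> int) \<Rightarrow> int" where
  "xN N r = (\<Sum>n | n dvd N. int n * r n)"

definition varpi :: "nat \<Rightarrow> (nat \<Rightarrow> int) \<Rightarrow> nat" where
  "varpi N r = (\<Prod>n | n dvd N. (N div n) ^ nat \<bar>r n\<bar>)"

definition sawtooth :: "real \<Rightarrow> real" where
  "sawtooth x = (if x \<in> \<int> then 0 else x - of_int \<lfloor>x\<rfloor> - 1/2)"

definition dedekind_sum :: "int \<Rightarrow> int \<Rightarrow> real" where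
  "dedekind_sum h c = (\<Sum>i\<in>{1..c-1}. sawtooth (of_int i / of_int c) * sawtooth (of_int (h * i) / of_int c))"

definition Psi :: "int \<Rightarrow> int \<Rightarrow> int \<Rightarrow> int \<Rightarrow> real" where
  "Psi a b c d =
    (if c > 0 then of_int (a + d) / of_int c + 12 * dedekind_sum (- d) c - 3
     else if c < 0 then of_int (a + d) / of_int c + 12 * dedekind_sum d (- c) + 3
     else if a > 0 then of_int b
     else - of_int b - 6)"

text \<open>Character of the eta quotient on the pair (gamma, eps (c tau + d)^(1/2)), eps = +-1.\<close>
definition eta_char :: "nat \<Rightarrow> (nat \<Rightarrow> int) \<Rightarrow> int \<Rightarrow> int \<Rightarrow> int \<Rightarrow> int \<Rightarrow> int \<Rightarrow> complex" where
  "eta_char N r \<epsilon> a b c d =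
     (of_int \<epsilon>) powi (- twok N r) *
     ee ((1/24) * (\<Sum>n | n dvd N. of_int (r n) * Psi a (b * int n) (c div int n) d))"

definition moeb :: "int \<Rightarrow> int \<Rightarrow> int \<Rightarrow> int \<Rightarrow> complex \<Rightarrow> complex" where
  "moeb a b c d \<tau> = (of_int a * \<tau> + of_int b) / (of_int c * \<tau> + of_int d)"

text \<open>Slash operator of weight k = tk/2 for the element (gamma, eps * principal sqrt(c tau + d)).\<close>
definition slash :: "int \<Rightarrow> (complex \<Rightarrow> complex) \<Rightarrow> int \<Rightarrow> int \<Rightarrow> int \<Rightarrow> int \<Rightarrow> int \<Rightarrow> complex \<Rightarrow> complex" where
  "slash tk g \<epsilon> a b c d \<tau> =
     (of_int \<epsilon> * csqrt (of_int c * \<tau> + of_int d)) powi (- tk) * g (moeb a b c d \<tau>)"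

definition in_Gamma0 :: "nat \<Rightarrow> int \<Rightarrow> int \<Rightarrow> int \<Rightarrow> int \<Rightarrow> bool" where
  "in_Gamma0 N a b c d \<longleftrightarrow> a * d - b * c = 1 \<and> int N dvd c"

definition cusp_expansion_ok :: "(complex \<Rightarrow> complex) \<Rightarrow> bool \<Rightarrow> bool" where
  "cusp_expansion_ok G strict \<longleftrightarrow>
     (\<exists>h::real. h > 0 \<and> (\<exists>x::real. \<exists>co::int \<Rightarrow> complex.
        (\<forall>\<tau>. Im \<tau> > 0 \<longrightarrow>
            ((\<lambda>m. co m * eC (of_real (x + of_int m / h) * \<tau>)) has_sum G \<tau>) UNIV) \<and>
        (\<forall>m. co m \<noteq> 0 \<longrightarrow> (if strict then x + of_int m / h > 0 else x + of_int m / h \<ge> 0))))"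

text \<open>M_k(Gamma_0(N), chi) (strict = False) and S_k(Gamma_0(N), chi) (strict = True), where
  k = twok N r / 2 and chi is the character of the eta quotient with exponents r.
  Functions are taken on the upper half plane (normalised to 0 elsewhere).\<close>
definition Mspace :: "nat \<Rightarrow> (nat \<Rightarrow> int) \<Rightarrow> bool \<Rightarrow> (complex \<Rightarrow> complex) set" where
  "Mspace N r strict = {g.
     g holomorphic_on {z. Im z > 0} \<and> (\<forall>\<tau>. Im \<tau> \<le> 0 \<longrightarrow> g \<tau> = 0) \<and>
     (\<forall>a b c d \<epsilon>. in_Gamma0 N a b c d \<and> \<epsilon> \<in> {-1, 1} \<longrightarrow>
        (\<forall>\<tau>. Im \<tau> > 0 \<longrightarrow> slash (twok N r) g \<epsilon> a b c d \<tau> = eta_char N r \<epsilon> a b c d * g \<tau>)) \<and>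
     (\<forall>a b c d. a * d - b * c = 1 \<longrightarrow> cusp_expansion_ok (slash (twok N r) g 1 a b c d) strict)}"

definition fscale :: "complex \<Rightarrow> (complex \<Rightarrow> complex) \<Rightarrow> (complex \<Rightarrow> complex)" where
  "fscale c g = (\<lambda>z. c * g z)"

definition cdim :: "(complex \<Rightarrow> complex) set \<Rightarrow> nat" where
  "cdim V = vector_space.dim fscale V"

definition weakly_admissible :: "nat \<Rightarrow> (nat \<Rightarrow> int) \<Rightarrow> bool" where
  "weakly_admissible N r \<longleftrightarrow>
     eta_quotient N r \<in> Mspace N r False \<and>
     (cdim (Mspace N r False) = 1 \<or>
      (cdim (Mspace N r False) \<ge> 2 \<and> cdim (Mspace N r True) = 1 \<and> eta_quotient N r \<in> Mspace N r True))"

definition fps_powi :: "complex fps \<Rightarrow> int \<Rightarrow> complex fps" where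
  "fps_powi P e = (if e \<ge> 0 then P ^ nat e else inverse P ^ nat (- e))"

text \<open>Truncation of prod_{n | N} prod_{j >= 1} (1 - X^(n j))^(r n); exact up to X^M.\<close>
definition eta_prod_trunc :: "nat \<Rightarrow> (nat \<Rightarrow> int) \<Rightarrow> nat \<Rightarrow> complex fps" where
  "eta_prod_trunc N r M = (\<Prod>n | n dvd N. fps_powi (\<Prod>j\<in>{1..M}. 1 - fps_X ^ (n * j)) (r n))"

text \<open>c_f(y): the coefficient of q^y in f = q^(xN/24) prod prod (1 - q^(nj))^(r n);
  zero unless y is in xN/24 + Z_{>=0}.\<close>
definition cf :: "nat \<Rightarrow> (nat \<Rightarrow> int) \<Rightarrow> real \<Rightarrow> complex" where
  "cf N r y = (if y - of_int (xN N r) / 24 \<in> \<nat>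
       then fps_nth (eta_prod_trunc N r (nat \<lfloor>y - of_int (xN N r) / 24\<rfloor>)) (nat \<lfloor>y - of_int (xN N r) / 24\<rfloor>)
       else 0)"

definition kron_prime :: "int \<Rightarrow> nat \<Rightarrow> int" where
  "kron_prime m p = (if p = 2 then (if even m then 0 else if m mod 8 \<in> {1, 7} then 1 else -1)
                     else Legendre m (int p))"

definition kronecker :: "int \<Rightarrow> int \<Rightarrow> int" where
  "kronecker m n =
     (if n = 0 then (if m = 1 \<or> m = -1 then 1 else 0)
      else (if n < 0 \<and> m < 0 then -1 else 1) *
           (\<Prod>p\<in>prime_factors (nat \<bar>n\<bar>). kron_prime m p ^ multiplicity p (nat \<bar>n\<bar>)))"

definition m_f :: "nat \<Rightarrow> (nat \<Rightarrow> int) \<Rightarrow> int" where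
  "m_f N r = 24 div gcd 24 (gcd (\<Sum>n | n dvd N. int (N div n) * r n) (xN N r))"

definition L_f :: "nat \<Rightarrow> (nat \<Rightarrow> int) \<Rightarrow> nat set" where
  "L_f N r = {l. l \<ge> 1 \<and> [int l = 1] (mod m_f N r) \<and> (odd (twok N r) \<longrightarrow> (\<exists>t. l = t ^ 2))}"

definition odd_part :: "nat \<Rightarrow> nat" where
  "odd_part n = n div 2 ^ multiplicity (2::nat) n"

definition delta :: "nat \<Rightarrow> (nat \<Rightarrow> int) \<Rightarrow> real" where
  "delta N r = (if odd_part (varpi N r) mod 4 = 1 then 0 else 1)"

definition delta1 :: "nat \<Rightarrow> (nat \<Rightarrow> int) \<Rightarrow> nat \<Rightarrow> real" where
  "delta1 N r l = (if even l \<and> 4 dvd N \<and> odd (twok N r) \<and> odd (multiplicity (2::nat) (varpi N r))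
                   then 1 else 0)"

definition psi_lr :: "nat \<Rightarrow> (nat \<Rightarrow> int) \<Rightarrow> nat \<Rightarrow> nat \<Rightarrow> nat \<Rightarrow> complex" where
  "psi_lr N r l a b =
     (let k = wt N r; \<delta> = delta N r; d = l div a in
      if odd l then ee (- (k + \<delta>) / 4 * (real d - 1) + (k + \<delta>) * (real l - 1) * (real N - 1) / 4)
      else if even N then ee (- (k + \<delta>) / 4 * (real a - 1) - real N * (k + \<delta>) * (1 + delta1 N r l) / 4 * real b)
      else 1)"

definition coeff_c :: "nat \<Rightarrow> (nat \<Rightarrow> int) \<Rightarrow> nat \<Rightarrow> complex" where
  "coeff_c N r l =
     of_real (real l powr (- wt N r / 2)) *
     (\<Sum>a | a dvd l \<and> coprime a N.
        of_int (kronecker (int a) (int (varpi N r))) * of_real (real a powr wt N r) *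
        cf N r (real l * of_int (xN N r) / (24 * real a ^ 2)) *
        (\<Sum>b | b < l div a \<and> gcd (gcd a b) (l div a) = 1.
           of_int (kronecker (- int N * int b) (int (gcd a (l div a)))) powi twok N r *
           ee (real b * real (l div a) * (of_int (xN N r) / (24 * real l) - of_int (xN N r) / 24)) *
           psi_lr N r l a b))"

end

theory Submission
  imports Defs "HOL-Computational_Algebra.Nth_Powers"
begin

text \<open>
  Put \<open>\<phi>(\<tau>) = f(\<tau>/l)/f(\<tau>)\<close>. For \<open>l \<in> L_f\<close> the explicit formula for the character \<open>\<chi>\<close> of \<open>f\<close> (Jacobi
  symbols times 24th roots of unity, via Dedekind reciprocity) shows that \<open>\<chi>\<close> is unchanged under
  conjugation by \<open>diag(1,l)\<close>, so \<open>\<phi>\<close> is invariant under the matrices in \<open>\<Gamma>\<^sub>0(N)\<close> with upper right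
  entry divisible by \<open>l\<close>. The trace of \<open>\<phi>\<close> to \<open>\<Gamma>\<^sub>0(N)\<close>, multiplied by \<open>f\<close>, is up to normalisation
  \<open>T\<^sub>l f = \<Sum> w\<^sub>l(a,b) a\<^sup>k f((a\<tau>+b)/d)\<close>, where the weights \<open>w\<^sub>l(a,b)\<close> are precisely those occurring in
  \<open>c\<^sub>l\<close>. Hence \<open>T\<^sub>l f\<close> lies in the same one-dimensional space as \<open>f\<close>, so \<open>T\<^sub>l f = \<lambda>\<^sub>l f\<close>, and
  comparing the coefficients of \<open>q\<close> to the power \<open>x\<^sub>N/24\<close> gives \<open>\<lambda>\<^sub>l = c\<^sub>l\<close>. For coprime \<open>l\<^sub>1, l\<^sub>2\<close> the
  weights are multiplicative along products of the representing matrices, whence \<open>T\<^sub>l\<^sub>1 T\<^sub>l\<^sub>2 f\<close> is the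
  image of \<open>f\<close> under the operator for \<open>l\<^sub>1 l\<^sub>2\<close>.
\<close>

section \<open>Jacobi symbols and reciprocity\<close>

text \<open>The coset sum is kept free of weight and multiplier: an eta quotient has no zeros in the
  upper half plane, so one may divide by f, and \<phi> has weight 0. In the invariance argument
  square roots are then compared in only two places: for \<phi> itself, where both automorphy
  factors are literally equal, and once per representative, where they differ by the positive scalar
  1/a. The character is defined by Dedekind sums of modulus c, whereas c_l involves symbols in a and
  in gcd(a, d). Reciprocity moves everything to the lower right entry, where the value modulo 24 is
  explicit if that entry is prime to 6, and translations reach that case. The conditions in L_f are
  what makes the exponents x_N and sum (N/n) r_n and the symbol (l/d) drop out. The main obstacle is
  the prime 2: \<psi> is given by three formulas, and for even l the divisibility of both exponents
  by 8 has to be converted into information on k + \<delta>, N and \<varpi> before these become one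
  formula that depends on a alone.\<close>

lemma kron_prime_values: "kron_prime m p \<in> {-1, 0, 1}"
  by (auto simp: kron_prime_def Legendre_def)

lemma kron_prime_eq_0_iff:
  assumes "prime p"
  shows "kron_prime m p = 0 \<longleftrightarrow> int p dvd m"
  using assms by (auto simp: kron_prime_def Legendre_def cong_0_iff)

text \<open>For p = 2 the symbol depends on the residue modulo 8 only, which leaves a finite check.
  For odd p, Euler's criterion gives the congruence modulo p, and two numbers that differ by at most
  2 < p are then equal.\<close>

lemma kron_prime_mult:
  assumes "prime p"
  shows "kron_prime (m * m') p = kron_prime m p * kron_prime m' p"
proof (cases "p = 2")
  case True
  define s :: "int \<Rightarrow> int" where "s x = (if even x then 0 else if x mod 8 \<in> {1, 7} then 1 else -1)" for x
  have s_mod: "s (x mod 8) = s x" for x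
    by (simp add: s_def dvd_mod_iff)
  have "\<forall>x\<in>{0,1,2,3,4,5,6,7}. \<forall>y\<in>{0,1,2,3,4,5,6,7}. s (x * y) = s x * s y"
    unfolding s_def by code_simp
  moreover have "m mod 8 \<in> {0,1,2,3,4,5,6,7}" "m' mod 8 \<in> {0,1,2,3,4,5,6,7}" by auto
  ultimately have "s ((m mod 8) * (m' mod 8)) = s (m mod 8) * s (m' mod 8)" by (metis (no_types, lifting))
  moreover have "s ((m mod 8) * (m' mod 8)) = s (m * m')"
    using s_mod[of "(m mod 8) * (m' mod 8)"] s_mod[of "m * m'"] by (simp add: mod_mult_eq)
  moreover have "kron_prime x p = s x" for x using True by (simp add: kron_prime_def s_def)
  ultimately show ?thesis by (simp add: s_mod)
next
  case False
  then have p: "2 < p" using assms prime_ge_2_nat[of p] by simp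
  have "[Legendre (m * m') (int p) = (m * m') ^ ((p - 1) div 2)] (mod int p)"
    using assms p by (rule euler_criterion)
  moreover have "[Legendre m (int p) * Legendre m' (int p) = m ^ ((p - 1) div 2) * m' ^ ((p - 1) div 2)] (mod int p)"
    using assms p by (intro cong_mult euler_criterion)
  ultimately have "[Legendre (m * m') (int p) = Legendre m (int p) * Legendre m' (int p)] (mod int p)"
    by (metis cong_sym cong_trans power_mult_distrib)
  then have dv: "int p dvd Legendre (m * m') (int p) - Legendre m (int p) * Legendre m' (int p)"
    by (simp add: cong_iff_dvd_diff)
  have "\<bar>Legendre (m * m') (int p) - Legendre m (int p) * Legendre m' (int p)\<bar> \<le> 2"
    by (auto simp: Legendre_def)
  with p have "Legendre (m * m') (int p) - Legendre m (int p) * Legendre m' (int p) = 0"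
    using dvd_imp_le_int[OF _ dv] by force
  then show ?thesis using False by (simp add: kron_prime_def)
qed

lemma kron_prime_1 [simp]: "prime p \<Longrightarrow> kron_prime 1 p = 1"
  by (metis kron_prime_mult kron_prime_eq_0_iff mult_cancel_right1 not_prime_unit int_dvd_int_iff
      mult.right_neutral of_nat_1)

lemma kron_prime_cong:
  assumes "prime p" "p \<noteq> 2" "[m = m'] (mod int p)"
  shows "kron_prime m p = kron_prime m' p"
proof -
  have "QuadRes (int p) m \<longleftrightarrow> QuadRes (int p) m'"
    unfolding QuadRes_def using assms(3) cong_sym cong_trans by blast
  moreover have "[m = 0] (mod int p) \<longleftrightarrow> [m' = 0] (mod int p)"
    using assms(3) cong_sym cong_trans by blast
  ultimately show ?thesis using assms(2) by (simp add: kron_prime_def Legendre_def)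
qed

definition jacobi :: "int \<Rightarrow> nat \<Rightarrow> int" where
  "jacobi m n = (\<Prod>p\<in>prime_factors n. kron_prime m p ^ multiplicity p n)"

lemma kronecker_eq_jacobi: "n > 0 \<Longrightarrow> kronecker m (int n) = jacobi m n"
  by (simp add: kronecker_def jacobi_def)

lemma jacobi_conv_mset:
  "jacobi m n = prod_mset (image_mset (kron_prime m) (prime_factorization n))"
  unfolding jacobi_def
  by (subst image_prod_mset_multiplicity) (auto intro!: prod.cong simp: count_prime_factorization_prime in_prime_factors_iff)

lemma jacobi_1_right [simp]: "jacobi m 1 = 1" "jacobi m (Suc 0) = 1"
  by (simp_all add: jacobi_def)

lemma jacobi_mult_right:
  "n > 0 \<Longrightarrow> n' > 0 \<Longrightarrow> jacobi m (n * n') = jacobi m n * jacobi m n'"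
  by (simp add: jacobi_conv_mset prime_factorization_mult)

lemma jacobi_prime [simp]: "prime p \<Longrightarrow> jacobi m p = kron_prime m p"
  by (simp add: jacobi_conv_mset prime_factorization_prime)

lemma jacobi_power_right: "n > 0 \<Longrightarrow> jacobi m (n ^ e) = jacobi m n ^ e"
  by (induction e) (auto simp: jacobi_mult_right)

lemma jacobi_mult_left: "jacobi (m * m') n = jacobi m n * jacobi m' n"
  unfolding jacobi_def prod.distrib[symmetric]
  by (intro prod.cong) (auto simp: kron_prime_mult power_mult_distrib in_prime_factors_iff)

lemma jacobi_1_left [simp]: "jacobi 1 n = 1"
  unfolding jacobi_def by (intro prod.neutral) (auto simp: in_prime_factors_iff)

lemma jacobi_power_left: "jacobi (m ^ e) n = jacobi m n ^ e"
  by (induction e) (auto simp: jacobi_mult_left)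

lemma jacobi_prod_left: "jacobi (\<Prod>i\<in>A. g i) n = (\<Prod>i\<in>A. jacobi (g i) n)"
  by (induction A rule: infinite_finite_induct) (auto simp: jacobi_mult_left)

text \<open>Congruence modulo each prime divisor suffices. The primes of \<open>varpi N r\<close>
  all divide N although \<open>varpi N r\<close> itself need not, so this form lets its symbol be
  compared modulo N.\<close>

lemma jacobi_cong_primes:
  assumes "odd n" "\<And>p. prime p \<Longrightarrow> p dvd n \<Longrightarrow> [m = m'] (mod int p)"
  shows "jacobi m n = jacobi m' n"
  unfolding jacobi_def
proof (intro prod.cong refl)
  fix p assume p: "p \<in> prime_factors n"
  then have "prime p" "p dvd n" by (auto simp: in_prime_factors_iff)
  then have "p \<noteq> 2" using assms(1) by auto
  then show "kron_prime m p ^ multiplicity p n = kron_prime m' p ^ multiplicity p n"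
    using kron_prime_cong \<open>prime p\<close> \<open>p dvd n\<close> assms(2) by metis
qed

lemma jacobi_cong:
  assumes "odd n" "[m = m'] (mod int n)"
  shows "jacobi m n = jacobi m' n"
  using assms by (intro jacobi_cong_primes) (auto intro: cong_dvd_modulus)

lemma jacobi_abs:
  assumes "coprime m (int n)" "n > 0"
  shows "\<bar>jacobi m n\<bar> = 1"
proof -
  have "\<bar>kron_prime m p\<bar> = 1" if "p \<in> prime_factors n" for p
  proof -
    have "prime p" "p dvd n" using that by (auto simp: in_prime_factors_iff)
    then have "\<not> int p dvd m"
      using assms(1) by (metis coprime_common_divisor int_dvd_int_iff not_prime_unit prime_nat_int_transfer)
    then have "kron_prime m p \<noteq> 0" using kron_prime_eq_0_iff \<open>prime p\<close> by blast
    with kron_prime_values[of m p] show ?thesis by auto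
  qed
  then show ?thesis unfolding jacobi_def by (simp add: abs_prod power_abs)
qed

lemma jacobi_pm1:
  assumes "coprime m (int n)" "n > 0"
  shows "jacobi m n = 1 \<or> jacobi m n = -1"
  using jacobi_abs[OF assms] by linarith

lemma jacobi_square:
  assumes "coprime m (int n)" "n > 0"
  shows "jacobi m n * jacobi m n = 1"
  using jacobi_pm1[OF assms] by auto

lemma kron_prime_minus_1:
  assumes "prime p" "odd p"
  shows "kron_prime (-1) p = (if p mod 4 = 1 then 1 else -1)"
proof -
  have p: "2 < p" using assms prime_ge_2_nat[of p] by (cases "p = 2") auto
  have "[Legendre (-1) (int p) = (-1) ^ ((p - 1) div 2)] (mod int p)"
    using assms(1) p by (rule euler_criterion)
  then have dv: "int p dvd Legendre (-1) (int p) - (-1) ^ ((p - 1) div 2)"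
    by (simp add: cong_iff_dvd_diff)
  moreover have "\<bar>Legendre (-1) (int p) - (-1) ^ ((p - 1) div 2)\<bar> \<le> 2"
    by (cases "even ((p - 1) div 2)") (auto simp: Legendre_def)
  ultimately have "Legendre (-1) (int p) - (-1) ^ ((p - 1) div 2) = 0"
    using p dvd_imp_le_int[OF _ dv] by force
  moreover have "even ((p - 1) div 2) \<longleftrightarrow> p mod 4 = 1"
    using assms(2) by presburger
  ultimately show ?thesis using p by (cases "p mod 4 = 1") (auto simp: kron_prime_def)
qed

lemma jacobi_minus_1:
  assumes "odd n"
  shows "jacobi (-1) n = (if n mod 4 = 1 then 1 else -1)"
  using assms
proof (induction n rule: prime_divisors_induct)
  case (factor p x)
  then have o: "odd p" "odd x" by auto
  then have IH: "jacobi (-1) (p * x) = (if p mod 4 = 1 then 1 else -1) * (if x mod 4 = 1 then 1 else -1)"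
    using factor kron_prime_minus_1[of p] by (simp add: jacobi_mult_right prime_gt_0_nat odd_pos)
  have eq: "p * x mod 4 = (p mod 4) * (x mod 4) mod 4" by (simp add: mod_mult_eq)
  from o have "p mod 4 = 1 \<or> p mod 4 = 3" "x mod 4 = 1 \<or> x mod 4 = 3" by presburger+
  then show ?case unfolding IH eq by (elim disjE) simp_all
qed auto

text \<open>For odd arguments this is the reciprocity sign, -1 to the power (m-1)/2 times
  (n-1)/2.\<close>

definition recip_sign :: "nat \<Rightarrow> nat \<Rightarrow> int" where
  "recip_sign m n = (if m mod 4 = 3 \<and> n mod 4 = 3 then -1 else 1)"

lemma recip_sign_mult:
  assumes "odd a" "odd b"
  shows "recip_sign (a * b) n = recip_sign a n * recip_sign b n"
proof -
  have eq: "a * b mod 4 = (a mod 4) * (b mod 4) mod 4" by (simp add: mod_mult_eq)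
  from assms have "a mod 4 = 1 \<or> a mod 4 = 3" "b mod 4 = 1 \<or> b mod 4 = 3" by presburger+
  then show ?thesis unfolding recip_sign_def eq by (elim disjE) simp_all
qed

lemma recip_sign_commute: "recip_sign a b = recip_sign b a"
  by (auto simp: recip_sign_def)

lemma prime_reciprocity:
  assumes "prime p" "prime q" "odd p" "odd q" "p \<noteq> q"
  shows "kron_prime (int p) q = kron_prime (int q) p * recip_sign p q"
proof -
  have p: "2 < p" "2 < q" using assms prime_ge_2_nat[of p] prime_ge_2_nat[of q] by (cases "p = 2"; cases "q = 2"; force)+
  have R: "Legendre p q * Legendre q p = (-1::int) ^ ((p - 1) div 2 * ((q - 1) div 2))"
    using assms p by (intro Quadratic_Reciprocity) auto
  have "even ((p - 1) div 2) \<longleftrightarrow> p mod 4 = 1" "even ((q - 1) div 2) \<longleftrightarrow> q mod 4 = 1"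
    using assms(3,4) by presburger+
  moreover have "p mod 4 = 1 \<or> p mod 4 = 3" "q mod 4 = 1 \<or> q mod 4 = 3" using assms(3,4) by presburger+
  ultimately have "(-1::int) ^ ((p - 1) div 2 * ((q - 1) div 2)) = recip_sign p q"
    unfolding recip_sign_def by (elim disjE) (simp_all add: minus_one_power_iff)
  moreover have "Legendre q p = 1 \<or> Legendre q p = -1 \<or> Legendre q p = 0" "recip_sign p q \<noteq> 0"
    by (simp_all add: Legendre_def recip_sign_def)
  ultimately have "Legendre p q = Legendre q p * recip_sign p q"
    using R by (elim disjE) (simp_all add: mult.commute)
  with p show ?thesis by (simp add: kron_prime_def)
qed

text \<open>Both sides are multiplicative in each argument, so reciprocity follows by induction over
  the prime factors of one argument and then, in \<open>jacobi_reciprocity\<close>, of the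
  other.\<close>

lemma jacobi_reciprocity_prime:
  assumes "prime p" "odd p" "odd n" "coprime p n"
  shows "jacobi (int p) n = jacobi (int n) p * recip_sign p n"
  using assms(3,4)
proof (induction n rule: prime_divisors_induct)
  case (unit x) then show ?case using assms by (auto simp: recip_sign_def)
next
  case (factor q x)
  then have o: "odd q" "odd x" "coprime p x" by auto
  have "p \<noteq> q" using factor assms(1) by auto
  then have "kron_prime (int p) q = kron_prime (int q) p * recip_sign p q"
    using prime_reciprocity assms factor o by blast
  then show ?case
    using factor o assms recip_sign_mult[of q x p]
    by (simp add: jacobi_mult_right jacobi_mult_left prime_gt_0_nat odd_pos recip_sign_commute[of p] kron_prime_mult)
qed auto

theorem jacobi_reciprocity:
  assumes "odd m" "odd n" "coprime m n"
  shows "jacobi (int m) n = jacobi (int n) m * recip_sign m n"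
  using assms(1,3)
proof (induction m rule: prime_divisors_induct)
  case (unit x) then show ?case using assms by (auto simp: recip_sign_def)
next
  case (factor p x)
  then have o: "odd p" "odd x" "coprime p n" "coprime x n" by auto
  then show ?case
    using factor assms(2) jacobi_reciprocity_prime[of p n]
    by (simp add: jacobi_mult_right jacobi_mult_left prime_gt_0_nat odd_pos recip_sign_mult)
qed auto

text \<open>Descent from n to n - 2: modulo n one has -2 = n - 2, reciprocity exchanges n - 2 and n,
  and modulo n - 2 the numerator n is 2 again.\<close>

lemma jacobi_2:
  assumes "odd n"
  shows "jacobi 2 n = (if n mod 8 \<in> {1, 7} then 1 else -1)"
  using assms
proof (induction n rule: less_induct)
  case (less n)
  show ?case
  proof (cases "n = 1")
    case False
    then have n: "n \<ge> 3" using less.prems by (cases n) auto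
    define n' where "n' = n - 2"
    have n': "n = n' + 2" "odd n'" "n' < n" using n less.prems by (auto simp: n'_def)
    have cop: "coprime n' n" 
    proof -
      have "gcd n' (n' + 2) = gcd n' 2" by (rule gcd_add2)
      also have "\<dots> = 1" using n'(2) by (intro coprime_imp_gcd_eq_1) simp
      finally show ?thesis unfolding n'(1) by (rule gcd_eq_1_imp_coprime)
    qed
    have "jacobi 2 n = jacobi (-1) n * jacobi (-2) n"
      using jacobi_mult_left[of "-1" "-2" n] by simp
    also have "jacobi (-2) n = jacobi (int n') n"
    proof (intro jacobi_cong)
      have "- 2 - int n' = - int n" using n'(1) by simp
      then show "[- 2 = int n'] (mod int n)" by (simp add: cong_iff_dvd_diff)
    qed (use less.prems in simp)
    also have "\<dots> = jacobi (int n) n' * recip_sign n' n"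
      using n' less.prems cop by (intro jacobi_reciprocity)
    also have "jacobi (int n) n' = jacobi 2 n'"
      using n' by (intro jacobi_cong) (auto simp: cong_iff_dvd_diff)
    also have "\<dots> = (if n' mod 8 \<in> {1, 7} then 1 else -1)"
      using less.IH n' by blast
    finally have eq: "jacobi 2 n = (if n mod 4 = 1 then 1 else -1) *
        ((if n' mod 8 \<in> {1, 7} then 1 else -1) * recip_sign n' n)"
      unfolding jacobi_minus_1[OF less.prems] .
    have mods: "n mod 8 = (n' mod 8 + 2) mod 8" unfolding n'(1) by (rule mod_add_left_eq[symmetric])
    have mods': "n mod 4 = (n' mod 4 + 2) mod 4" unfolding n'(1) by (rule mod_add_left_eq[symmetric])
    have mods'': "n' mod 4 = n' mod 8 mod 4" by (simp add: mod_mod_cancel)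
    have "n' mod 8 = 1 \<or> n' mod 8 = 3 \<or> n' mod 8 = 5 \<or> n' mod 8 = 7" using n'(2) by presburger
    then show ?thesis unfolding eq recip_sign_def mods mods' mods''
      by (elim disjE) simp_all
  qed auto
qed

section \<open>Dedekind sums modulo 3 and 8\<close>

lemma sum_ints_upto: "c > 0 \<Longrightarrow> 2 * (\<Sum>i\<in>{1..c-1}. i) = c * (c - 1)" for c :: int
proof (induction c rule: int_gr_induct)
  case (step i)
  have "{1..i + 1 - 1} = insert i {1..i-1}" using step by auto
  then show ?case using step by (simp add: algebra_simps)
qed auto

lemma sum_squares_upto: "c > 0 \<Longrightarrow> 6 * (\<Sum>i\<in>{1..c-1}. i^2) = (c - 1) * c * (2 * c - 1)" for c :: int
proof (induction c rule: int_gr_induct)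
  case (step i)
  have "{1..i + 1 - 1} = insert i {1..i-1}" using step by auto
  then show ?case using step by (simp add: algebra_simps power2_eq_square)
qed auto

lemma sum_odds_upto: "c > 0 \<Longrightarrow> (\<Sum>i\<in>{1..c-1}. 2 * i - 1) = (c - 1)^2" for c :: int
proof (induction c rule: int_gr_induct)
  case (step i)
  have "{1..i + 1 - 1} = insert i {1..i-1}" using step by auto
  then show ?case using step by (simp add: algebra_simps power2_eq_square)
qed auto

lemma int_div_less_iff:
  fixes x h c :: int
  assumes "c > 0"
  shows "x div c < h \<longleftrightarrow> x < h * c"
proof
  assume "x div c < h"
  then have "(x div c + 1) * c \<le> h * c" using assms by (intro mult_right_mono) auto
  then show "x < h * c" using div_mult_mod_eq[of x c] pos_mod_bound[OF assms, of x] unfolding distrib_right by linarith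
next
  assume "x < h * c"
  show "x div c < h"
  proof (rule ccontr)
    assume "\<not> x div c < h"
    then have "h * c \<le> (x div c) * c" using assms by (intro mult_right_mono) auto
    then show False using div_mult_mod_eq[of x c] pos_mod_sign[OF assms, of x] \<open>x < h * c\<close> by linarith
  qed
qed

lemma not_dvd_mult_coprime:
  fixes h c i :: int
  assumes "coprime h c" "i \<in> {1..c-1}"
  shows "\<not> c dvd h * i"
  using assms by (auto simp: coprime_dvd_mult_right_iff coprime_commute dest: zdvd_imp_le)

text \<open>Pair i with c - i: the floors of h i / c and h (c - i) / c add up to h - 1, because c
  does not divide h i.\<close>

lemma sum_floor_mult:
  fixes h c :: int
  assumes "coprime h c" "c > 0"
  shows "2 * (\<Sum>i\<in>{1..c-1}. h * i div c) = (h - 1) * (c - 1)"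
proof -
  have pair: "h * i div c + h * (c - i) div c = h - 1" if "i \<in> {1..c-1}" for i
  proof -
    have "h * (c - i) div c = h + (- (h * i)) div c"
      using assms(2) div_mult_self1[of c "-(h * i)" h] by (simp add: algebra_simps)
    also have "(- (h * i)) div c = - (h * i div c) - 1"
      using not_dvd_mult_coprime[OF assms(1) that] assms(2) by (simp add: zdiv_zminus1_eq_if dvd_eq_mod_eq_0)
    finally show ?thesis by simp
  qed
  have "(\<Sum>i\<in>{1..c-1}. h * i div c) = (\<Sum>i\<in>{1..c-1}. h * (c - i) div c)"
    by (rule sum.reindex_bij_witness[where i = "\<lambda>i. c - i" and j = "\<lambda>i. c - i"]) auto
  then have "2 * (\<Sum>i\<in>{1..c-1}. h * i div c) = (\<Sum>i\<in>{1..c-1}. h * i div c + h * (c - i) div c)"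
    by (simp add: sum.distrib)
  also have "\<dots> = (\<Sum>i\<in>{1..c-1}. h - 1)" using pair by (intro sum.cong) auto
  also have "\<dots> = (h - 1) * (c - 1)" using assms(2) by simp
  finally show ?thesis .
qed

text \<open>For coprime arguments this is 12 c s(h, c), obtained by expanding the sawtooth products.
  Being an integer it can be studied modulo 3 and 8.\<close>

definition dedekind12 :: "int \<Rightarrow> int \<Rightarrow> int" where
  "dedekind12 h c = 2 * h * (c - 1) * (2 * c - 1) - 12 * (\<Sum>i\<in>{1..c-1}. i * (h * i div c)) - 3 * c * (c - 1)"

lemma dedekind12_eq:
  assumes "coprime h c" "c > 0"
  shows "of_int (dedekind12 h c) = 12 * of_int c * dedekind_sum h c"
proof -
  have saw1: "sawtooth (of_int i / of_int c) = of_int i / of_int c - 1/2" if "i \<in> {1..c-1}" for i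
  proof -
    have "of_int i / of_int c \<notin> (\<int> :: real set)"
      using not_dvd_mult_coprime[of 1 c i] that assms(2) by (simp add: of_int_div_of_int_in_Ints_iff)
    then show ?thesis using that by (simp add: sawtooth_def floor_divide_of_int_eq)
  qed
  have saw2: "sawtooth (of_int (h * i) / of_int c) = of_int (h * i) / of_int c - of_int (h * i div c) - 1/2"
    if "i \<in> {1..c-1}" for i
  proof -
    have "of_int (h * i) / of_int c \<notin> (\<int> :: real set)"
      using not_dvd_mult_coprime[OF assms(1) that] assms(2) by (subst of_int_div_of_int_in_Ints_iff) auto
    moreover have "\<lfloor>of_int (h * i) / of_int c\<rfloor> = h * i div c"
      by (rule floor_divide_of_int_eq)
    ultimately show ?thesis by (simp add: sawtooth_def)
  qed
  have "12 * of_int c * dedekind_sum h c =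
      (\<Sum>i\<in>{1..c-1}. 12 * real_of_int c * ((of_int i / of_int c - 1/2) * (of_int (h * i) / of_int c - of_int (h * i div c) - 1/2)))"
    unfolding dedekind_sum_def sum_distrib_left using saw1 saw2 by (intro sum.cong) auto
  also have "\<dots> = (\<Sum>i\<in>{1..c-1}. 12 * h / c * of_int (i^2) - 12 * of_int (i * (h * i div c)) - 6 * (1 + h) * of_int i
        + 6 * c * of_int (h * i div c) + 3 * c)"
    using assms(2) by (intro sum.cong) (auto simp: field_simps power2_eq_square)
  also have "\<dots> = 12 * h / c * of_int (\<Sum>i\<in>{1..c-1}. i^2) - 12 * of_int (\<Sum>i\<in>{1..c-1}. i * (h * i div c))
        - of_int (6 * (1 + h) * (\<Sum>i\<in>{1..c-1}. i)) + of_int (6 * c * (\<Sum>i\<in>{1..c-1}. h * i div c)) + of_int (\<Sum>i\<in>{1..c-1}. 3 * c)"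
    unfolding sum.distrib sum_subtractf of_int_sum sum_distrib_left by simp
  also have "real_of_int (\<Sum>i\<in>{1..c-1}. i^2) = (c - 1) * c * (2 * c - 1) / 6"
    using arg_cong[OF sum_squares_upto[OF assms(2)], of real_of_int] by simp
  also have "real_of_int (6 * (1 + h) * (\<Sum>i\<in>{1..c-1}. i)) = 6 * (1 + h) * (c * (c - 1) / 2)"
    using arg_cong[OF sum_ints_upto[OF assms(2)], of real_of_int] by simp
  also have "real_of_int (6 * c * (\<Sum>i\<in>{1..c-1}. h * i div c)) = 6 * c * ((h - 1) * (c - 1) / 2)"
    using arg_cong[OF sum_floor_mult[OF assms], of real_of_int] by simp
  also have "(\<Sum>i\<in>{1..c-1}. 3 * c) = 3 * c * (c - 1)" using assms(2) by simp
  finally have "12 * of_int c * dedekind_sum h c = 12 * h / c * ((c - 1) * c * (2 * c - 1) / 6)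
      - 12 * of_int (\<Sum>i\<in>{1..c-1}. i * (h * i div c)) - 6 * (1 + h) * (c * (c - 1) / 2)
      + 6 * c * ((h - 1) * (c - 1) / 2) + 3 * c * (c - 1)" by simp
  also have "\<dots> = of_int (dedekind12 h c)"
    using assms(2) unfolding dedekind12_def by (simp add: field_simps)
  finally show ?thesis ..
qed

lemma sawtooth_minus: "sawtooth (- x) = - sawtooth x"
proof (cases "x \<in> \<int>")
  case False
  then have "x \<noteq> of_int \<lfloor>x\<rfloor>" by (metis Ints_of_int)
  then have "\<lfloor>-x\<rfloor> = - \<lfloor>x\<rfloor> - 1" by linarith
  with False show ?thesis by (simp add: sawtooth_def)
qed (simp add: sawtooth_def)

lemma sawtooth_add_int: "sawtooth (x + of_int n) = sawtooth x"
  by (simp add: sawtooth_def)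

lemma dedekind_sum_minus: "dedekind_sum (- h) c = - dedekind_sum h c"
  by (simp add: dedekind_sum_def sum_negf sawtooth_minus)

lemma dedekind_sum_cong:
  assumes "[h = h'] (mod c)" "c > 0"
  shows "dedekind_sum h c = dedekind_sum h' c"
proof -
  obtain k where k: "h = h' + c * k"
    using assms(1) by (metis cong_iff_lin cong_sym)
  have "sawtooth (of_int (h * i) / of_int c) = sawtooth (of_int (h' * i) / of_int c)" for i
    using sawtooth_add_int[of "of_int (h' * i) / of_int c" "k * i"] assms(2)
    by (simp add: k field_simps)
  then show ?thesis by (simp add: dedekind_sum_def)
qed

lemma dedekind12_minus:
  assumes "coprime h c" "c > 0"
  shows "dedekind12 (- h) c = - dedekind12 h c"
  using dedekind12_eq[of h c] dedekind12_eq[of "-h" c] assms dedekind_sum_minus[of h c]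
  by (simp flip: of_int_eq_iff[where ?'a = real])

lemma dedekind12_cong:
  assumes "coprime h c" "[h = h'] (mod c)" "c > 0"
  shows "dedekind12 h c = dedekind12 h' c"
proof -
  have "coprime h' c" using assms by (metis cong_imp_coprime)
  then show ?thesis using dedekind12_eq[of h c] dedekind12_eq[of h' c] assms dedekind_sum_cong[of h h' c]
    by (simp flip: of_int_eq_iff[where ?'a = real])
qed

text \<open>Dedekind reciprocity by elementary counting. Let Q be the sum of the squared floors of h
  i / c. Multiplication by h permutes the nonzero residues \<open>i\<close> in
  \<open>{1..c-1}\<close>, which ties Q to the first Dedekind sum; counting lattice points below the
  diagonal of a rectangle ties Q to the second. Eliminating Q gives the law.\<close>

lemma dedekind12_reciprocity:
  fixes h c :: int
  assumes "coprime h c" "h > 0" "c > 0"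
  shows "h * dedekind12 h c + c * dedekind12 c h = h^2 + c^2 + 1 - 3 * h * c"
proof -
  define A where "A = (\<Sum>i\<in>{1..c-1}. i * (h * i div c))"
  define B where "B = (\<Sum>j\<in>{1..h-1}. j * (c * j div h))"
  define S where "S = (\<Sum>i\<in>{1..c-1}. i^2)"
  define Q where "Q = (\<Sum>i\<in>{1..c-1}. (h * i div c)^2)"
  have bij: "bij_betw (\<lambda>i. h * i mod c) {1..c-1} {1..c-1}"
  proof -
    have inj: "inj_on (\<lambda>i. h * i mod c) {1..c-1}"
    proof (rule inj_onI)
      fix x y assume xy: "x \<in> {1..c-1}" "y \<in> {1..c-1}" "h * x mod c = h * y mod c"
      then have "[x = y] (mod c)" using assms(1) by (metis cong_def cong_mult_lcancel)
      then show "x = y" using xy by (simp add: cong_def)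
    qed
    moreover have "h * i mod c \<in> {1..c-1}" if "i \<in> {1..c-1}" for i
    proof -
      have "h * i mod c \<noteq> 0" using not_dvd_mult_coprime[OF assms(1) that] by (simp add: dvd_eq_mod_eq_0)
      then show ?thesis using assms(3) pos_mod_bound[of c "h * i"] pos_mod_sign[of c "h * i"] by (simp; linarith)
    qed
    ultimately have "(\<lambda>i. h * i mod c) ` {1..c-1} = {1..c-1}" by (intro endo_inj_surj) auto
    with inj show ?thesis by (simp add: bij_betw_def)
  qed
  have "S = (\<Sum>i\<in>{1..c-1}. (h * i mod c)^2)"
    unfolding S_def using sum.reindex_bij_betw[OF bij, of "\<lambda>i. i^2"] by simp
  also have "\<dots> = (\<Sum>i\<in>{1..c-1}. h^2 * i^2 - 2 * h * c * (i * (h * i div c)) + c^2 * (h * i div c)^2)"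
  proof (intro sum.cong refl)
    fix i
    have "h * i mod c = h * i - c * (h * i div c)" by (simp add: minus_mult_div_eq_mod)
    then show "(h * i mod c)^2 = h^2 * i^2 - 2 * h * c * (i * (h * i div c)) + c^2 * (h * i div c)^2"
      by (simp only:) (simp add: power2_eq_square algebra_simps)
  qed
  also have "\<dots> = h^2 * S - 2 * h * c * A + c^2 * Q"
    unfolding S_def A_def Q_def sum.distrib sum_subtractf sum_distrib_left ..
  finally have 1: "S = h^2 * S - 2 * h * c * A + c^2 * Q" .
  \<comment> \<open>A square m^2 is the sum of the first m odd numbers. This turns Q into a weighted
    lattice-point count, in which the order of summation can be exchanged.\<close>
  have "Q = (\<Sum>i\<in>{1..c-1}. \<Sum>j\<in>{j\<in>{1..h-1}. j \<le> h * i div c}. 2 * j - 1)"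
    unfolding Q_def
  proof (intro sum.cong refl)
    fix i assume i: "i \<in> {1..c-1}"
    have "h * i < h * c" using i assms by simp
    then have "h * i div c < h" using assms by (simp add: int_div_less_iff)
    moreover have "h * i div c \<ge> 0" using i assms by (simp add: pos_imp_zdiv_nonneg_iff)
    ultimately have "{j\<in>{1..h-1}. j \<le> h * i div c} = {1..(h * i div c + 1) - 1}" "h * i div c + 1 > 0" by auto
    then show "(h * i div c)^2 = (\<Sum>j\<in>{j\<in>{1..h-1}. j \<le> h * i div c}. 2 * j - 1)"
      using sum_odds_upto[of "h * i div c + 1"] by simp
  qed
  also have "\<dots> = (\<Sum>j\<in>{1..h-1}. \<Sum>i\<in>{i\<in>{1..c-1}. j \<le> h * i div c}. 2 * j - 1)"
    by (rule sum.swap_restrict) auto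
  also have "\<dots> = (\<Sum>j\<in>{1..h-1}. (2 * j - 1) * (c - 1) - 2 * (j * (c * j div h)) + c * j div h)"
  proof (intro sum.cong refl)
    fix j assume j: "j \<in> {1..h-1}"
    have nd: "\<not> h dvd c * j" using not_dvd_mult_coprime[of c h j] assms(1) j by (simp add: coprime_commute)
    \<comment> \<open>No lattice point lies on the diagonal, since h does not divide c j; hence the
      strict inequality on the right.\<close>
    have eq: "j \<le> h * i div c \<longleftrightarrow> c * j div h < i" for i
    proof -
      have "j \<le> h * i div c \<longleftrightarrow> c * j \<le> h * i"
        using int_div_less_iff[OF assms(3), of "h * i" j] by (auto simp: mult.commute not_less)
      also have "\<dots> \<longleftrightarrow> c * j < h * i" using nd by (metis dvd_triv_left order_le_less)
      also have "\<dots> \<longleftrightarrow> c * j div h < i"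
        using int_div_less_iff[OF assms(2), of "c * j" i] by (simp add: mult.commute)
      finally show ?thesis .
    qed
    have "c * j div h \<ge> 0" using j assms by (simp add: pos_imp_zdiv_nonneg_iff)
    moreover have "c * j < c * h" using j assms by simp
    then have "c * j div h < c" using assms by (simp add: int_div_less_iff)
    ultimately have "{i\<in>{1..c-1}. j \<le> h * i div c} = {c * j div h + 1..c - 1}" "c * j div h \<le> c - 1" unfolding eq by auto
    then show "(\<Sum>i\<in>{i\<in>{1..c-1}. j \<le> h * i div c}. 2 * j - 1) = (2 * j - 1) * (c - 1) - 2 * (j * (c * j div h)) + c * j div h"
      by (simp add: algebra_simps)
  qed
  also have "\<dots> = (\<Sum>j\<in>{1..h-1}. 2 * j - 1) * (c - 1) - 2 * B + (\<Sum>j\<in>{1..h-1}. c * j div h)"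
    unfolding B_def sum_distrib_left sum_distrib_right sum_subtractf[symmetric] sum.distrib[symmetric] ..
  finally have 2: "2 * Q = 2 * ((h - 1)^2 * (c - 1)) - 4 * B + (c - 1) * (h - 1)"
    unfolding sum_odds_upto[OF assms(2)] using sum_floor_mult[of c h] assms by (simp add: coprime_commute)
  have 3: "6 * S = (c - 1) * c * (2 * c - 1)" unfolding S_def using sum_squares_upto[OF assms(3)] .
  have "12 * h * c * A = (h^2 - 1) * (6 * S) + 3 * c^2 * (2 * Q)" using 1 by (simp add: algebra_simps)
  then have "c * (12 * h * A) = c * ((h^2 - 1) * ((c - 1) * (2 * c - 1)) + 3 * c * (2 * Q))"
    unfolding 3 by (simp add: power2_eq_square algebra_simps)
  then have 4: "12 * h * A = (h^2 - 1) * ((c - 1) * (2 * c - 1)) + 3 * c * (2 * Q)"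
    using assms by simp
  have "h * dedekind12 h c = 2 * h^2 * (c - 1) * (2 * c - 1) - 12 * h * A - 3 * h * c * (c - 1)"
    unfolding dedekind12_def A_def[symmetric] by (simp add: power2_eq_square algebra_simps)
  moreover have "c * dedekind12 c h = 2 * c^2 * (h - 1) * (2 * h - 1) - 12 * c * B - 3 * h * c * (h - 1)"
    unfolding dedekind12_def B_def[symmetric] by (simp add: power2_eq_square algebra_simps)
  ultimately show ?thesis unfolding 4 2 by (simp add: power2_eq_square algebra_simps)
qed

text \<open>Modulo 3 only the first term survives, and there 2 c - 1 is 2 (c + 1), so the factor (c
  - 1)(2 c - 1) vanishes for c prime to 3.\<close>

lemma three_dvd_dedekind12:
  assumes "\<not> 3 dvd c"
  shows "3 dvd dedekind12 h c"
proof -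
  have "3 dvd (c - 1) * (2 * c - 1)"
  proof -
    have "3 dvd c - 1 \<or> 3 dvd 2 * c - 1" using assms by presburger
    then show ?thesis by auto
  qed
  then have "3 dvd 2 * h * ((c - 1) * (2 * c - 1))" by (rule dvd_mult)
  moreover have "3 dvd 12 * (\<Sum>i\<in>{1..c-1}. i * (h * i div c))" "3 dvd 3 * c * (c - 1)"
    by (auto intro: dvd_mult2)
  ultimately show ?thesis unfolding dedekind12_def by (auto simp: mult.assoc intro: dvd_diff)
qed

text \<open>The inductive step of \<open>dedekind12_mod_8\<close>: X and Y stand for the two sides
  of reciprocity, u and v for the symbols (c/h) and (h/c). Since h^2 is 1 modulo 8, multiplication
  by h solves for X, and the rest depends on residues modulo 8 only, a finite check.\<close>

lemma dedekind12_mod_8_step: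
  fixes h c X u v :: int
  assumes "odd h" "odd c" "h * X + c * Y = h^2 + c^2 + 1 - 3 * h * c"
    and "[Y = h + 1 - 2 * u] (mod 8)" "u = 1 \<or> u = -1"
    and "v = u * (if h mod 4 = 3 \<and> c mod 4 = 3 then -1 else 1)"
  shows "[X = c + 1 - 2 * v] (mod 8)"
proof -
  define P where "P a b w = a * (a * a + b * b + 1 - 3 * a * b - b * (a + 1 - 2 * w))" for a b w :: int
  have h: "h mod 8 = 1 \<or> h mod 8 = 3 \<or> h mod 8 = 5 \<or> h mod 8 = 7" using assms(1) by presburger
  have c: "c mod 8 = 1 \<or> c mod 8 = 3 \<or> c mod 8 = 5 \<or> c mod 8 = 7" using assms(2) by presburger
  have hh: "[h * h = 1] (mod 8)"
  proof -
    have "h * h mod 8 = (h mod 8) * (h mod 8) mod 8" by (rule mod_mult_eq[symmetric])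
    then show ?thesis unfolding cong_def using h by (elim disjE) simp_all
  qed
  have "[X = h * (h * X)] (mod 8)"
    using cong_mult[OF cong_sym[OF hh] cong_refl[of X]] by (simp add: mult.assoc)
  also have "h * X = h * h + c * c + 1 - 3 * h * c - c * Y" using assms(3) by (simp add: power2_eq_square)
  also have "[h * (h * h + c * c + 1 - 3 * h * c - c * Y) = P h c u] (mod 8)"
    unfolding P_def by (intro cong_mult cong_diff cong_refl assms(4))
  also have "[P h c u = P (h mod 8) (c mod 8) u] (mod 8)"
    unfolding P_def by (intro cong_mult cong_diff cong_add cong_refl; simp add: cong_def)
  also have "[P (h mod 8) (c mod 8) u = c mod 8 + 1 - 2 * v] (mod 8)"
  proof -
    have mod4: "h mod 4 = h mod 8 mod 4" "c mod 4 = c mod 8 mod 4" by (simp_all add: mod_mod_cancel)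
    have "[P a b u = b + 1 - 2 * (u * (if a mod 4 = 3 \<and> b mod 4 = 3 then -1 else 1))] (mod 8)"
      if "a = 1 \<or> a = 3 \<or> a = 5 \<or> a = 7" "b = 1 \<or> b = 3 \<or> b = 5 \<or> b = 7" for a b
      using that assms(5) unfolding P_def cong_def by (elim disjE) simp_all
    from this[OF h c] show ?thesis unfolding assms(6) mod4 .
  qed
  also have "[c mod 8 + 1 - 2 * v = c + 1 - 2 * v] (mod 8)"
    by (intro cong_diff cong_add cong_refl) (simp add: cong_def)
  finally show ?thesis .
qed

text \<open>Both sides obey the Euclidean algorithm: reduction of h modulo c, change of sign, and
  reciprocity. The induction on c follows it, with h kept odd so that the symbol (c/h) is again
  covered by the induction hypothesis.\<close>

lemma dedekind12_mod_8:
  assumes "odd c" "coprime h (int c)"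
  shows "[dedekind12 h (int c) = int c + 1 - 2 * jacobi h c] (mod 8)"
  using assms
proof (induction c arbitrary: h rule: less_induct)
  case (less c)
  have odd_case: "[dedekind12 (int h) (int c) = int c + 1 - 2 * jacobi (int h) c] (mod 8)"
    if h: "odd h" "h < c" "coprime h c" for h
  proof -
    have 1: "[dedekind12 (int c) (int h) = int h + 1 - 2 * jacobi (int c) h] (mod 8)"
      using less.IH[of h "int c"] h by (simp add: coprime_commute)
    have 2: "int h * dedekind12 (int h) (int c) + int c * dedekind12 (int c) (int h) = (int h)^2 + (int c)^2 + 1 - 3 * int h * int c"
      using h less.prems by (intro dedekind12_reciprocity) (auto simp: odd_pos)
    have 3: "jacobi (int c) h = 1 \<or> jacobi (int c) h = -1"
      using h by (intro jacobi_pm1) (auto simp: coprime_commute odd_pos)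
    have m4: "int n mod 4 = 3 \<longleftrightarrow> n mod 4 = 3" for n
      by (metis of_nat_eq_iff of_nat_numeral zmod_int)
    have 4: "jacobi (int h) c = jacobi (int c) h * (if int h mod 4 = 3 \<and> int c mod 4 = 3 then -1 else 1)"
      unfolding jacobi_reciprocity[OF h(1) less.prems(1) h(3)] recip_sign_def m4 ..
    from h(1) less.prems(1) have "odd (int h)" "odd (int c)" by simp_all
    from dedekind12_mod_8_step[OF this 2 1 3 4] show ?thesis .
  qed
  show ?case
  proof (cases "c = 1")
    case True
    then show ?thesis by (simp add: dedekind12_def)
  next
    case False
    with less.prems have c: "c > 1" by (cases c) auto
    define k where "k = nat (h mod int c)"
    have k: "int k = h mod int c" using c by (simp add: k_def)
    have kc: "k < c" using c k pos_mod_bound[of "int c" h] by linarith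
    have hk: "[h = int k] (mod int c)" unfolding k by (simp add: cong_def)
    have cop: "coprime (int k) (int c)" using hk less.prems(2) by (metis cong_imp_coprime)
    have D: "dedekind12 h (int c) = dedekind12 (int k) (int c)" "jacobi h c = jacobi (int k) c"
      using hk less.prems c by (auto intro!: dedekind12_cong jacobi_cong)
    show ?thesis
    proof (cases "odd k")
      case True
      then show ?thesis unfolding D using odd_case[of k] kc cop by simp
    next
      case False
      \<comment> \<open>An even residue k is replaced by -k, represented by the odd number c - k;
        the Dedekind sum changes sign and the symbol changes by (-1/c).\<close>
      define h' where "h' = c - k"
      have h': "odd h'" "h' < c" "int h' = int c - int k"
        using False kc less.prems cop c by (cases "k = 0"; simp add: h'_def)+
      have cong: "[int k = - int h'] (mod int c)" unfolding h' by (simp add: cong_iff_dvd_diff)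
      have cop': "coprime (int h') (int c)" 
        using cong cop by (metis cong_imp_coprime coprime_minus_left_iff)
      have pm: "jacobi (int h') c = 1 \<or> jacobi (int h') c = -1" using cop' c by (intro jacobi_pm1) auto
      have j: "jacobi (int k) c = (if c mod 4 = 1 then 1 else -1) * jacobi (int h') c"
        using jacobi_cong[OF less.prems(1) cong] jacobi_mult_left[of "-1" "int h'" c] jacobi_minus_1[OF less.prems(1)] by simp
      have "dedekind12 (int k) (int c) = - dedekind12 (int h') (int c)"
        using dedekind12_cong[OF cop cong] dedekind12_minus[OF cop'] c by simp
      also have "[\<dots> = - (int c + 1 - 2 * jacobi (int h') c)] (mod 8)"
        using odd_case[of h'] h'(1,2) cop' by (intro cong_minus_minus_iff[THEN iffD2]) (metis coprime_int_iff)
      also have "[- (int c + 1 - 2 * jacobi (int h') c) = int c + 1 - 2 * jacobi (int k) c] (mod 8)"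
      proof -
        define t where "t = c div 4"
        have "c mod 4 = 1 \<or> c mod 4 = 3" using less.prems by presburger
        then have "c = 4 * t + 1 \<and> c mod 4 = 1 \<or> c = 4 * t + 3 \<and> c mod 4 = 3"
          using mult_div_mod_eq[of 4 c] unfolding t_def by (elim disjE) simp_all
        then have "- (int c + 1 - 2 * jacobi (int h') c) - (int c + 1 - 2 * jacobi (int k) c) \<in> {8 * (- int t), 8 * (- int t - 1)}"
          unfolding j using pm by (elim disjE conjE) simp_all
        then have "8 dvd - (int c + 1 - 2 * jacobi (int h') c) - (int c + 1 - 2 * jacobi (int k) c)"
          by (auto simp only: insert_iff empty_iff intro!: dvd_triv_left)
        then show ?thesis by (simp add: cong_iff_dvd_diff)
      qed
      finally show ?thesis unfolding D .
    qed
  qed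
qed

section \<open>The character of an eta quotient\<close>

lemma ee_add: "ee (x + y) = ee x * ee y"
  by (simp add: ee_def exp_add[symmetric] algebra_simps)

lemma ee_0 [simp]: "ee 0 = 1"
  by (simp add: ee_def)

lemma ee_minus: "ee (- x) = inverse (ee x)"
  by (simp add: ee_def exp_minus)

lemma ee_diff: "ee (x - y) = ee x / ee y"
  using ee_add[of x "-y"] by (simp add: ee_minus field_simps)

lemma ee_of_int [simp]: "ee (of_int n) = 1"
  using exp_integer_2pi[of "of_int n"] by (simp add: ee_def mult_ac)

lemma ee_nonzero [simp]: "ee x \<noteq> 0"
  by (simp add: ee_def)

lemma ee_half: "ee (1 / 2) = -1"
  using exp_pi_i by (simp add: ee_def mult_ac)

lemma ee_sum: "finite A \<Longrightarrow> ee (\<Sum>i\<in>A. f i) = (\<Prod>i\<in>A. ee (f i))"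
  by (induction A rule: finite_induct) (auto simp: ee_add)

lemma ee_eqI:
  assumes "x - y = of_int n"
  shows "ee x = ee y"
  using ee_add[of y "of_int n"] assms by (simp add: algebra_simps)

lemma ee_cong24:
  assumes "[m = n] (mod 24)"
  shows "ee (of_int m / 24) = ee (of_int n / 24)"
proof -
  obtain k where "m = n + 24 * k" using assms by (metis cong_iff_lin cong_sym)
  then show ?thesis by (intro ee_eqI[of _ _ k]) (simp add: field_simps)
qed

lemma ee_int_half: "ee (of_int n / 2) = (if even n then 1 else -1)"
proof (cases "even n")
  case True
  then obtain k where "n = 2 * k" by blast
  then show ?thesis using ee_of_int[of k] by simp
next
  case False
  then obtain k where "n = 2 * k + 1" by (elim oddE)
  then have "ee (of_int n / 2) = ee (of_int k + 1 / 2)" by (simp add: field_simps)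
  then show ?thesis using False by (simp add: ee_add ee_half)
qed

lemma sign_power_parity:
  fixes u :: int
  assumes "u = 1 \<or> u = -1" "even m \<longleftrightarrow> even n"
  shows "u ^ m = u ^ n"
  using assms by (auto simp: minus_one_power_iff)

text \<open>Divided by 24 this is the order of the eta quotient at the cusp 0, as
  \<open>xN N r\<close> divided by 24 is the order at infinity.\<close>

definition xN_dual :: "nat \<Rightarrow> (nat \<Rightarrow> int) \<Rightarrow> int" where
  "xN_dual N r = (\<Sum>n | n dvd N. int (N div n) * r n)"

text \<open>Reciprocity yields d Psi = b - c + 12 d s(c, d), so Psi is controlled by a Dedekind sum
  of modulus d: modulo 8 by \<open>dedekind12_mod_8\<close> for odd d, modulo 3 by
  \<open>three_dvd_dedekind12\<close>. As c and d are coprime, one of the two clauses modulo 3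
  always applies.\<close>

lemma Psi_congruences:
  fixes a b c d :: int
  assumes det: "a * d - b * c = 1" and pos: "c > 0" "d > 0"
  shows "\<exists>P. Psi a b c d = of_int P \<and>
    (odd d \<longrightarrow> [P = d * (b - c) + 3 * (d - 1) + 6 * (1 - jacobi c (nat d))] (mod 8)) \<and>
    (\<not> 3 dvd d \<longrightarrow> [P = d * (b - c)] (mod 3)) \<and>
    (\<not> 3 dvd c \<longrightarrow> [P = (a + d) * c] (mod 3))"
proof -
  have cop: "coprime c d"
  proof (rule coprimeI)
    fix k assume "k dvd c" "k dvd d"
    then have "k dvd a * d - b * c" by auto
    then show "is_unit k" using det by simp
  qed
  define X where "X = dedekind12 c d"
  define Y where "Y = dedekind12 d c"
  \<comment> \<open>U is c Psi. Reciprocity shows that c divides d U, and coprimality of c and d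
    then makes Psi an integer.\<close>
  define U where "U = a + d - Y - 3 * c"
  have rec: "c * X + d * Y = c^2 + d^2 + 1 - 3 * c * d"
    unfolding X_def Y_def using cop pos by (rule dedekind12_reciprocity)
  have "real_of_int Y = 12 * of_int c * dedekind_sum d c"
    unfolding Y_def using cop pos by (intro dedekind12_eq) (auto simp: coprime_commute)
  then have Psi: "of_int c * Psi a b c d = of_int U"
    using pos unfolding Psi_def U_def by (simp add: dedekind_sum_minus field_simps)
  have dU: "d * U = c * (b - c + X)"
    using rec det unfolding U_def by (simp add: algebra_simps power2_eq_square)
  then have "c dvd d * U" by simp
  then have "c dvd U" using cop by (simp add: coprime_dvd_mult_right_iff)
  then obtain P where P: "U = c * P" by blast
  have 1: "Psi a b c d = of_int P" using Psi P pos by simp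
  have "c * (d * P) = c * (b - c + X)" using dU unfolding P by (simp only: mult.left_commute)
  then have 2: "d * P = b - c + X" using pos by (simp only: mult_cancel_left) simp
  have "[P = d * (b - c) + 3 * (d - 1) + 6 * (1 - jacobi c (nat d))] (mod 8)" if od: "odd d"
  proof -
    define j where "j = jacobi c (nat d)"
    have pm: "j = 1 \<or> j = -1" unfolding j_def using cop pos by (intro jacobi_pm1) auto
    have "[X = d + 1 - 2 * j] (mod 8)"
      using dedekind12_mod_8[of "nat d" c] that cop pos unfolding X_def j_def by (simp add: even_nat_iff)
    then obtain k where k: "X = d + 1 - 2 * j + 8 * k" by (metis cong_iff_lin cong_sym)
    obtain m where m: "d = 2 * m + 1" using od by (elim oddE)
    have "even (m * (m + 1))" by simp
    then obtain t where t: "m * (m + 1) = 2 * t" by blast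
    have d2: "d * d = 8 * t + 1" using t unfolding m by (simp add: algebra_simps)
    \<comment> \<open>E is multiplied by d because the relation at hand is one for d P; the factor
      is cancelled at the end, d being odd.\<close>
    define E where "E = P - (d * (b - c) + 3 * (d - 1) + 6 * (1 - j))"
    have "d * E = d * P - d * d * (b - c) - 3 * (d * d) + 3 * d - 6 * d * (1 - j)"
      unfolding E_def by (simp add: algebra_simps)
    also have "\<dots> = b - c + (d + 1 - 2 * j + 8 * k) - (8 * t + 1) * (b - c) - 3 * (8 * t + 1) + 3 * d - 6 * d * (1 - j)"
      unfolding 2 d2 k ..
    also have "\<dots> = 8 * (k - t * (b - c) - 3 * t) + ((6 * d - 2) * j - 2 - 2 * d)"
      by (simp add: algebra_simps)
    also have "8 dvd \<dots>"
    proof -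
      have "(6 * d - 2) * j - 2 - 2 * d \<in> {8 * m, 8 * (- d)}" using pm unfolding m by auto
      then have "8 dvd (6 * d - 2) * j - 2 - 2 * d" by (auto simp only: insert_iff empty_iff intro!: dvd_triv_left)
      then show ?thesis by (rule dvd_add[OF dvd_triv_left])
    qed
    finally have "8 dvd d * E" .
    moreover have "coprime 8 d" using that coprime_power_left_iff[of 2 3 d] by simp
    ultimately have "8 dvd E" by (simp add: coprime_dvd_mult_right_iff)
    then show ?thesis unfolding E_def j_def by (simp add: cong_iff_dvd_diff)
  qed
  moreover have "[P = d * (b - c)] (mod 3)" if "\<not> 3 dvd d"
  proof -
    have "3 dvd X" unfolding X_def using that by (rule three_dvd_dedekind12)
    then have "3 dvd d * P - (b - c)" unfolding 2 by simp
    moreover have "3 dvd d * d - 1"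
    proof -
      have "3 dvd d - 1 \<or> 3 dvd d + 1" using that by presburger
      then have "3 dvd (d - 1) * (d + 1)" by auto
      then show ?thesis by (simp add: algebra_simps)
    qed
    ultimately have "3 dvd d * (d * P - (b - c)) - P * (d * d - 1)"
      by (rule dvd_diff[OF dvd_mult dvd_mult])
    also have "d * (d * P - (b - c)) - P * (d * d - 1) = P - d * (b - c)" by (simp add: algebra_simps)
    finally show ?thesis by (simp add: cong_iff_dvd_diff)
  qed
  moreover have "[P = (a + d) * c] (mod 3)" if "\<not> 3 dvd c"
  proof -
    have "3 dvd Y" unfolding Y_def using that by (rule three_dvd_dedekind12)
    then have "3 dvd - Y - 3 * c" by simp
    also have "- Y - 3 * c = c * P - (a + d)" unfolding P[symmetric] U_def by simp
    finally have "3 dvd c * P - (a + d)" .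
    moreover have "3 dvd c * c - 1"
    proof -
      have "3 dvd c - 1 \<or> 3 dvd c + 1" using that by presburger
      then have "3 dvd (c - 1) * (c + 1)" by auto
      then show ?thesis by (simp add: algebra_simps)
    qed
    ultimately have "3 dvd c * (c * P - (a + d)) - P * (c * c - 1)"
      by (rule dvd_diff[OF dvd_mult dvd_mult])
    also have "c * (c * P - (a + d)) - P * (c * c - 1) = P - (a + d) * c" by (simp add: algebra_simps)
    finally show ?thesis by (simp add: cong_iff_dvd_diff)
  qed
  ultimately show ?thesis using 1 by blast
qed

lemma Psi_translate:
  assumes "c > 0"
  shows "Psi a (b + j * a) c (d + j * c) = Psi a b c d + of_int j"
proof -
  have "dedekind_sum (- (d + j * c)) c = dedekind_sum (- d) c"
    using assms by (intro dedekind_sum_cong) (auto simp: cong_iff_dvd_diff)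
  then show ?thesis using assms by (simp add: Psi_def field_simps)
qed

text \<open>The matrix on the left is the one on the right followed by the translation by j. This
  serves to make an even lower right entry odd.\<close>

lemma eta_char_translate:
  assumes "N > 0" "c > 0" "int N dvd c"
  shows "eta_char N r 1 a (b + j * a) c (d + j * c) = eta_char N r 1 a b c d * ee (of_int (j * xN N r) / 24)"
proof -
  have "of_int (r n) * Psi a ((b + j * a) * int n) (c div int n) (d + j * c) =
        of_int (r n) * Psi a (b * int n) (c div int n) d + of_int (j * (int n * r n))" if "n dvd N" for n
  proof -
    have dv: "int n dvd c" using that assms(3) by (meson dvd_trans int_dvd_int_iff)
    have "n > 0" using that assms(1) by (auto intro!: Nat.gr0I)
    then have "c div int n > 0" using dv assms(2) by (simp add: pos_imp_zdiv_pos_iff zdvd_imp_le)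
    from Psi_translate[OF this, of a "b * int n" "j * int n" d] dv
    have "Psi a ((b + j * a) * int n) (c div int n) (d + j * c) = Psi a (b * int n) (c div int n) d + of_int (j * int n)"
      by (simp add: algebra_simps)
    then show ?thesis by (simp add: algebra_simps)
  qed
  then have "(\<Sum>n | n dvd N. of_int (r n) * Psi a ((b + j * a) * int n) (c div int n) (d + j * c)) =
      (\<Sum>n | n dvd N. of_int (r n) * Psi a (b * int n) (c div int n) d + of_int (j * (int n * r n)))"
    by (intro sum.cong) auto
  also have "\<dots> = (\<Sum>n | n dvd N. of_int (r n) * Psi a (b * int n) (c div int n) d) + of_int (j * xN N r)"
    by (simp add: sum.distrib xN_def sum_distrib_left)
  finally show ?thesis unfolding eta_char_def by (simp add: ee_add[symmetric] field_simps)
qed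

section \<open>Prime factors of \<open>varpi\<close>\<close>

lemma varpi_pos: "N > 0 \<Longrightarrow> varpi N r > 0"
  unfolding varpi_def by (intro prod_pos) (auto simp: dvd_div_eq_0_iff elim!: dvdE)

lemma prime_dvd_varpi:
  assumes "prime p" "p dvd varpi N r" "N > 0"
  shows "p dvd N"
proof -
  from assms obtain n where "n dvd N" "p dvd (N div n) ^ nat \<bar>r n\<bar>"
    unfolding varpi_def by (subst (asm) prime_dvd_prod_iff) auto
  then have "p dvd N div n" using assms(1) prime_dvd_power by blast
  then show ?thesis using \<open>n dvd N\<close> by (metis dvd_div_mult_self dvd_mult2)
qed

lemma coprime_varpi:
  assumes "coprime a N" "N > 0"
  shows "coprime a (varpi N r)"
  unfolding varpi_def
proof (rule prod_coprime_right)
  fix n assume "n \<in> {n. n dvd N}"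
  then have "N div n dvd N" by (metis dvd_div_mult_self dvd_triv_left mem_Collect_eq)
  then have "coprime a (N div n)" using assms(1) coprime_divisors dvd_refl by blast
  then show "coprime a ((N div n) ^ nat \<bar>r n\<bar>)" by simp
qed

lemma even_sum_abs_iff: "finite A \<Longrightarrow> even (\<Sum>n\<in>A. nat \<bar>r n :: int\<bar>) \<longleftrightarrow> even (\<Sum>n\<in>A. r n)"
  by (induction A rule: finite_induct) (auto simp: even_nat_iff)

text \<open>The values of Psi modulo 24 are assembled from those modulo 8 and 3. For each n the term
  6 r_n (1 - j), with j a sign, contributes i^(r_n (1 - j)) = j^|r_n|, and these signs multiply up
  to (c/d)^(2k) (\<varpi>/d).\<close>

theorem eta_char_odd:
  fixes a b c :: int and d :: nat
  assumes N: "N > 0" and det: "a * int d - b * (int N * c) = 1" and c: "c > 0" and d: "odd d"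
    and three: "\<not> 3 dvd int d \<or> 3 dvd xN N r \<and> 3 dvd xN_dual N r"
  shows "eta_char N r 1 a b (int N * c) (int d) =
    of_int (jacobi c d ^ nat \<bar>twok N r\<bar> * jacobi (int (varpi N r)) d) *
    ee (of_int (int d * (b * xN N r - c * xN_dual N r) + 3 * twok N r * (int d - 1)) / 24)"
proof -
  define D where "D = {n. n dvd N}"
  have fin: "finite D" using N by (simp add: D_def)
  define e where "e n = int (N div n)" for n
  define j where "j n = jacobi (c * e n) d" for n
  have dpos: "int d > 0" using d by (simp add: odd_pos)
  have en: "int N * c div int n = c * e n" "e n > 0" "int n * e n = int N" if "n \<in> D" for n
  proof -
    have "n dvd N" using that by (simp add: D_def)
    then obtain m where m: "N = n * m" by blast
    with N show "int N * c div int n = c * e n" "e n > 0" "int n * e n = int N" by (auto simp: e_def)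
  qed
  have cop: "coprime (c * e n) (int d)" if "n \<in> D" for n
  proof (rule coprimeI)
    fix k assume "k dvd c * e n" "k dvd int d"
    then have "k dvd a * int d - b * int n * (c * e n)" by auto
    also have "b * int n * (c * e n) = b * (int N * c)" using en(3)[OF that] by (simp add: algebra_simps flip: en(3)[OF that])
    finally show "is_unit k" using det by simp
  qed
  have jpm: "j n = 1 \<or> j n = -1" if "n \<in> D" for n
    unfolding j_def using cop[OF that] d by (intro jacobi_pm1) (auto simp: odd_pos)
  have "\<forall>n\<in>D. \<exists>P. Psi a (b * int n) (int N * c div int n) (int d) = of_int P \<and>
    [P = int d * (b * int n - c * e n) + 3 * (int d - 1) + 6 * (1 - j n)] (mod 8) \<and>
    (\<not> 3 dvd int d \<longrightarrow> [P = int d * (b * int n - c * e n)] (mod 3)) \<and>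
    (\<not> 3 dvd c * e n \<longrightarrow> [P = (a + int d) * (c * e n)] (mod 3))"
  proof
    fix n assume n: "n \<in> D"
    have "a * int d - b * int n * (c * e n) = 1"
      using det by (simp add: algebra_simps flip: en(3)[OF n])
    moreover have "c * e n > 0" using c en(2)[OF n] by simp
    ultimately show "\<exists>P. Psi a (b * int n) (int N * c div int n) (int d) = of_int P \<and>
    [P = int d * (b * int n - c * e n) + 3 * (int d - 1) + 6 * (1 - j n)] (mod 8) \<and>
    (\<not> 3 dvd int d \<longrightarrow> [P = int d * (b * int n - c * e n)] (mod 3)) \<and>
    (\<not> 3 dvd c * e n \<longrightarrow> [P = (a + int d) * (c * e n)] (mod 3))"
      using Psi_congruences[of a "int d" "b * int n" "c * e n"] d dpos unfolding en(1)[OF n] j_def by auto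
  qed
  then obtain P where P: "\<And>n. n \<in> D \<Longrightarrow> Psi a (b * int n) (int N * c div int n) (int d) = of_int (P n)"
    and P8: "\<And>n. n \<in> D \<Longrightarrow> [P n = int d * (b * int n - c * e n) + 3 * (int d - 1) + 6 * (1 - j n)] (mod 8)"
    and P3: "\<And>n. n \<in> D \<Longrightarrow> \<not> 3 dvd int d \<Longrightarrow> [P n = int d * (b * int n - c * e n)] (mod 3)"
    and P3': "\<And>n. n \<in> D \<Longrightarrow> \<not> 3 dvd c * e n \<Longrightarrow> [P n = (a + int d) * (c * e n)] (mod 3)"
    by metis
  define M where "M = int d * (b * xN N r - c * xN_dual N r) + 3 * twok N r * (int d - 1)"
  define J where "J = (\<Sum>n\<in>D. r n * (1 - j n))"
  have x: "xN N r = (\<Sum>n\<in>D. r n * int n)" "xN_dual N r = (\<Sum>n\<in>D. r n * e n)" "twok N r = (\<Sum>n\<in>D. r n)"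
    by (simp_all add: xN_def xN_dual_def twok_def D_def e_def mult_ac)
  have main: "(\<Sum>n\<in>D. r n * (int d * (b * int n - c * e n) + 3 * (int d - 1) + 6 * (1 - j n))) = M + 6 * J"
    unfolding M_def J_def x by (simp add: sum_distrib_left sum_distrib_right sum.distrib sum_subtractf algebra_simps)
  have main3: "(\<Sum>n\<in>D. r n * (int d * (b * int n - c * e n))) = int d * (b * xN N r - c * xN_dual N r)"
    unfolding x by (simp add: sum_distrib_left sum_distrib_right sum.distrib sum_subtractf algebra_simps)
  have c8: "[(\<Sum>n\<in>D. r n * P n) = M + 6 * J] (mod 8)"
    unfolding main[symmetric] by (intro cong_sum cong_mult cong_refl P8)
  have c3: "[(\<Sum>n\<in>D. r n * P n) = M + 6 * J] (mod 3)"
  proof (cases "3 dvd int d")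
    case False
    have "[(\<Sum>n\<in>D. r n * P n) = (\<Sum>n\<in>D. r n * (int d * (b * int n - c * e n)))] (mod 3)"
      using False by (intro cong_sum cong_mult cong_refl P3)
    also have "[(\<Sum>n\<in>D. r n * (int d * (b * int n - c * e n))) = M + 6 * J] (mod 3)"
      unfolding main3 M_def by (auto simp: cong_iff_dvd_diff mult.assoc intro!: dvd_diff dvd_add)
    finally show ?thesis .
  next
    case True
    \<comment> \<open>If 3 divides d, then c N/n is prime to 3 for every n, so the clause for c in
      \<open>Psi_congruences\<close> applies. Its total is a multiple of \<open>xN_dual N r\<close>,
      which vanishes modulo 3 by \<open>three\<close>.\<close>
    have "\<not> 3 dvd c * e n" if "n \<in> D" for n
    proof
      assume "3 dvd c * e n"
      then have "is_unit (3::int)" using cop[OF that] True coprime_common_divisor by blast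
      then show False by simp
    qed
    then have "[(\<Sum>n\<in>D. r n * P n) = (\<Sum>n\<in>D. r n * ((a + int d) * (c * e n)))] (mod 3)"
      by (intro cong_sum cong_mult cong_refl P3')
    also have "(\<Sum>n\<in>D. r n * ((a + int d) * (c * e n))) = (a + int d) * c * xN_dual N r"
      unfolding x by (simp add: sum_distrib_left algebra_simps)
    also have "[(a + int d) * c * xN_dual N r = M + 6 * J] (mod 3)"
      using True three unfolding M_def by (auto simp: cong_iff_dvd_diff mult.assoc intro!: dvd_diff dvd_add)
    finally show ?thesis .
  qed
  have c24: "[(\<Sum>n\<in>D. r n * P n) = M + 6 * J] (mod 24)"
  proof -
    have "coprime (8::int) 3" by code_simp
    from coprime_cong_mult[OF c8 c3 this] show ?thesis by simp
  qed
  have "eta_char N r 1 a b (int N * c) (int d) = ee (of_int (\<Sum>n\<in>D. r n * P n) / 24)"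
    unfolding eta_char_def D_def[symmetric] using P by (simp add: cong: sum.cong)
  also have "\<dots> = ee (of_int (M + 6 * J) / 24)" by (rule ee_cong24[OF c24])
  also have "\<dots> = ee (of_int M / 24) * ee (of_int J / 4)" by (simp add: ee_add[symmetric] field_simps)
  also have "ee (of_int J / 4) = (\<Prod>n\<in>D. ee (of_int (r n * (1 - j n)) / 4))"
    unfolding J_def by (simp add: ee_sum[OF fin, symmetric] sum_divide_distrib)
  also have "\<dots> = (\<Prod>n\<in>D. of_int (j n ^ nat \<bar>r n\<bar>))"
  proof (intro prod.cong refl)
    fix n assume "n \<in> D"
    from jpm[OF this] show "ee (of_int (r n * (1 - j n)) / 4) = of_int (j n ^ nat \<bar>r n\<bar>)"
    proof
      assume "j n = -1"
      then show ?thesis using ee_int_half[of "r n"] by (simp add: minus_one_power_iff even_nat_iff)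
    qed simp
  qed
  also have "\<dots> = of_int (\<Prod>n\<in>D. jacobi c d ^ nat \<bar>r n\<bar> * jacobi (int ((N div n) ^ nat \<bar>r n\<bar>)) d)"
    unfolding j_def e_def by (simp add: jacobi_mult_left power_mult_distrib jacobi_power_left)
  also have "(\<Prod>n\<in>D. jacobi c d ^ nat \<bar>r n\<bar> * jacobi (int ((N div n) ^ nat \<bar>r n\<bar>)) d) =
      jacobi c d ^ (\<Sum>n\<in>D. nat \<bar>r n\<bar>) * jacobi (int (varpi N r)) d"
    unfolding varpi_def D_def[symmetric] by (simp add: prod.distrib power_sum jacobi_prod_left)
  also have "jacobi c d ^ (\<Sum>n\<in>D. nat \<bar>r n\<bar>) = jacobi c d ^ nat \<bar>twok N r\<bar>"
  proof (rule sign_power_parity)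
    show "jacobi c d = 1 \<or> jacobi c d = -1"
    proof (rule jacobi_pm1)
      have "N \<in> D" by (simp add: D_def)
      from cop[OF this] show "coprime c (int d)" using N by (simp add: e_def)
    qed (use d in \<open>simp add: odd_pos\<close>)
    show "even (\<Sum>n\<in>D. nat \<bar>r n\<bar>) = even (nat \<bar>twok N r\<bar>)"
      using even_sum_abs_iff[OF fin] unfolding x by (simp add: even_nat_iff)
  qed
  finally show ?thesis unfolding M_def by (simp add: mult_ac)
qed

text \<open>An odd e is s = 1 or s = -1 modulo 4, and s r = r + s^|r| - 1 modulo 4. Moreover V W - 1
  = (V - 1) + (W - 1) modulo 4 for odd V and W, so the corrections accumulate into the product. With
  e = N/n this relates the order at the cusp 0, the weight and \<varpi>.\<close>

lemma weighted_sum_mod_4: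
  assumes "finite A" "\<And>n. n \<in> A \<Longrightarrow> odd (e n :: nat)"
  shows "[(\<Sum>n\<in>A. int (e n) * r n) = (\<Sum>n\<in>A. r n) + int (\<Prod>n\<in>A. e n ^ nat \<bar>r n\<bar>) - 1] (mod 4)"
  using assms
proof (induction A rule: finite_induct)
  case (insert m A)
  define V where "V = int (\<Prod>n\<in>A. e n ^ nat \<bar>r n\<bar>)"
  define W where "W = int (e m ^ nat \<bar>r m\<bar>)"
  have oV: "odd V" unfolding V_def using insert.prems insert.hyps by (simp add: even_prod_iff)
  have oe: "odd (e m)" using insert.prems by simp
  have W: "[int (e m) * r m = r m + W - 1] (mod 4)"
  proof -
    have "[int (e m) = 1] (mod 4) \<or> [int (e m) = -1] (mod 4)"
    proof -
      have "e m mod 4 = 1 \<or> e m mod 4 = 3" using oe by presburger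
      then have "4 dvd int (e m) - 1 \<or> 4 dvd int (e m) + 1" by presburger
      then show ?thesis by (simp add: cong_iff_dvd_diff)
    qed
    then obtain s where s: "[int (e m) = s] (mod 4)" "s = 1 \<or> s = -1" by blast
    have "[W = s ^ nat \<bar>r m\<bar>] (mod 4)" unfolding W_def by (simp add: cong_pow s(1))
    then have "[r m + W - 1 = r m + s ^ nat \<bar>r m\<bar> - 1] (mod 4)"
      by (intro cong_add cong_diff cong_refl)
    moreover have "[r m + s ^ nat \<bar>r m\<bar> - 1 = s * r m] (mod 4)"
    proof -
      have "4 dvd r m + s ^ nat \<bar>r m\<bar> - 1 - s * r m"
        using s(2) by (elim disjE) (auto simp: minus_one_power_iff even_nat_iff elim!: oddE evenE)
      then show ?thesis by (simp add: cong_iff_dvd_diff)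
    qed
    moreover have "[s * r m = int (e m) * r m] (mod 4)"
      using s(1) by (intro cong_mult cong_refl) (rule cong_sym)
    ultimately show ?thesis by (meson cong_sym cong_trans)
  qed
  have oW: "odd W" unfolding W_def using oe by simp
  obtain v w where "V = 2 * v + 1" "W = 2 * w + 1" using oV oW by (elim oddE)
  then have VW: "V * W - 1 - ((V - 1) + (W - 1)) = 4 * (v * w)" by (simp add: algebra_simps)
  have "[V * W - 1 = (V - 1) + (W - 1)] (mod 4)" unfolding cong_iff_dvd_diff VW by simp
  note VW' = this
  have "[int (e m) * r m + (\<Sum>n\<in>A. int (e n) * r n) = (r m + W - 1) + ((\<Sum>n\<in>A. r n) + V - 1)] (mod 4)"
    unfolding V_def using insert by (intro cong_add W) auto
  also have "(r m + W - 1) + ((\<Sum>n\<in>A. r n) + V - 1) = r m + (\<Sum>n\<in>A. r n) + ((V - 1) + (W - 1))" by simp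
  also have "[r m + (\<Sum>n\<in>A. r n) + ((V - 1) + (W - 1)) = r m + (\<Sum>n\<in>A. r n) + (V * W - 1)] (mod 4)"
    using VW' by (intro cong_add cong_refl) (rule cong_sym)
  finally have "[int (e m) * r m + (\<Sum>n\<in>A. int (e n) * r n) = r m + (\<Sum>n\<in>A. r n) + (V * W - 1)] (mod 4)" .
  then show ?case using insert.hyps unfolding V_def W_def by (simp add: mult.commute add_diff_eq)
qed simp

lemma varpi_mod_4:
  assumes "N > 0" "odd N" "4 dvd xN_dual N r"
  shows "[twok N r = 1 - int (varpi N r)] (mod 4)"
proof -
  have "[xN_dual N r = twok N r + int (varpi N r) - 1] (mod 4)"
    unfolding xN_dual_def twok_def varpi_def using assms
    by (intro weighted_sum_mod_4) (auto elim!: dvdE)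
  with assms(3) have "4 dvd twok N r + int (varpi N r) - 1"
    by (metis cong_dvd_iff)
  then show ?thesis by (simp add: cong_iff_dvd_diff algebra_simps)
qed

lemma odd_varpi: "N > 0 \<Longrightarrow> odd N \<Longrightarrow> odd (varpi N r)"
  unfolding varpi_def by (auto simp: even_prod_iff elim!: dvdE)

lemma even_iff_mod_4_neq_3:
  fixes k :: int and v :: nat
  shows "4 dvd 2 * k - 1 + int v \<Longrightarrow> odd v \<Longrightarrow> even k \<longleftrightarrow> v mod 4 \<noteq> 3"
  by presburger

lemma even_half_iff_mod_4:
  fixes d :: nat
  assumes "int d = 2 * m + 1"
  shows "even m \<longleftrightarrow> d mod 4 \<noteq> 3"
proof -
  have "even m \<longleftrightarrow> (2 * m + 1) mod 4 \<noteq> 3" by presburger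
  then show ?thesis unfolding assms[symmetric] by (metis of_nat_eq_iff of_nat_numeral zmod_int)
qed

text \<open>Here the 2-part of the character is trivial, and reciprocity turns (\<varpi>/d) into
  (d/\<varpi>), which also makes sense for even d. Even d is reduced to odd d by a
  translation.\<close>

theorem eta_char_trivial_2_part:
  fixes a b c :: int and d :: nat
  assumes N: "N > 0" "odd N" and det: "a * int d - b * (int N * c) = 1" and c: "c > 0" and d: "d > 0"
    and eight: "8 dvd xN N r" "8 dvd xN_dual N r"
    and three: "\<not> 3 dvd int d \<or> 3 dvd xN N r \<and> 3 dvd xN_dual N r"
  shows "eta_char N r 1 a b (int N * c) (int d) =
    of_int (jacobi (int d) (varpi N r)) * ee (of_int (int d * (b * xN N r - c * xN_dual N r)) / 24)"
proof -
  have "4 dvd xN_dual N r" using eight(2) by (rule dvd_trans[rotated]) simp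
  then have vK: "[twok N r = 1 - int (varpi N r)] (mod 4)" using varpi_mod_4 N by blast
  have vodd: "odd (varpi N r)" using odd_varpi N by blast
  have evK: "even (twok N r)"
  proof -
    have "4 dvd twok N r - (1 - int (varpi N r))" using vK by (simp add: cong_iff_dvd_diff)
    then have "even (twok N r - (1 - int (varpi N r)))" by (rule dvd_trans[rotated]) simp
    then show ?thesis using vodd by simp
  qed
  have odd_case: "eta_char N r 1 a b (int N * c) (int d) =
    of_int (jacobi (int d) (varpi N r)) * ee (of_int (int d * (b * xN N r - c * xN_dual N r)) / 24)"
    if det: "a * int d - b * (int N * c) = 1" and d: "odd d"
      and three: "\<not> 3 dvd int d \<or> 3 dvd xN N r \<and> 3 dvd xN_dual N r" for b d
  proof -
    have copN: "coprime (int d) (int N)" and copc: "coprime c (int d)"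
    proof -
      have un: "is_unit k" if "k dvd int d" "k dvd int N \<or> k dvd c" for k
      proof -
        from that have "k dvd a * int d - b * (int N * c)" by auto
        then show ?thesis using det by simp
      qed
      show "coprime (int d) (int N)" "coprime c (int d)" by (rule coprimeI; rule un; simp)+
    qed
    have jc: "jacobi c d ^ nat \<bar>twok N r\<bar> = 1"
      using sign_power_parity[of "jacobi c d" "nat \<bar>twok N r\<bar>" 0] jacobi_pm1[OF copc] evK d
      by (simp add: odd_pos even_nat_iff)
    have copv: "coprime d (varpi N r)" using copN N coprime_varpi by (simp add: coprime_commute)
    have rec: "jacobi (int (varpi N r)) d = jacobi (int d) (varpi N r) * recip_sign (varpi N r) d"
      using jacobi_reciprocity[OF vodd d] copv by (simp add: coprime_commute)
    \<comment> \<open>The reciprocity sign cancels the factor e(2k (d - 1)/8), because 2k = 1 -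
      \<varpi> modulo 4.\<close>
    have sgn: "of_int (recip_sign (varpi N r) d) * ee (of_int (3 * twok N r * (int d - 1)) / 24) = 1"
    proof -
      obtain k where k: "twok N r = 2 * k" using evK by blast
      obtain m where m: "int d = 2 * m + 1" using d by (metis odd_two_times_div_two_succ even_of_nat)
      have eq: "3 * twok N r * (int d - 1) = 12 * (k * m)" using k m by (simp add: algebra_simps)
      have "ee (of_int (3 * twok N r * (int d - 1)) / 24) = ee (of_int (k * m) / 2)"
        unfolding eq by (intro arg_cong[where f = ee]) simp
      also have "\<dots> = (if even k \<or> even m then 1 else -1)" unfolding ee_int_half by simp
      also have "even k \<longleftrightarrow> varpi N r mod 4 \<noteq> 3"
      proof -
        have "4 dvd 2 * k - 1 + int (varpi N r)" using vK k by (simp add: cong_iff_dvd_diff algebra_simps)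
        then show ?thesis using vodd by (rule even_iff_mod_4_neq_3)
      qed
      also have "even m \<longleftrightarrow> d mod 4 \<noteq> 3" using m by (rule even_half_iff_mod_4)
      finally show ?thesis unfolding recip_sign_def by auto
    qed
    have "ee (of_int (int d * (b * xN N r - c * xN_dual N r) + 3 * twok N r * (int d - 1)) / 24) =
        ee (of_int (int d * (b * xN N r - c * xN_dual N r)) / 24) * ee (of_int (3 * twok N r * (int d - 1)) / 24)"
      by (simp add: ee_add[symmetric] add_divide_distrib)
    then show ?thesis using eta_char_odd[OF N(1) det c d three] jc rec sgn by simp
  qed
  show ?thesis
  proof (cases "odd d")
    case True
    then show ?thesis using odd_case det three by blast
  next
    case False
    have oc: "odd c"
    proof
      assume "even c"
      then have "even (a * int d - b * (int N * c))" using False by auto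
      then show False using det by simp
    qed
    \<comment> \<open>As N and c are odd, three unit translations make d odd. The number three keeps
      d fixed modulo 3, and together with the divisibility by 8 it keeps the compared exponents
      equal modulo 24.\<close>
    define d' where "d' = d + 3 * N * nat c"
    have d': "int d' = int d + 3 * (int N * c)" using c by (simp add: d'_def)
    have od': "odd d'" using False oc N c by (simp add: d'_def even_nat_iff)
    have det': "a * int d' - (b + 3 * a) * (int N * c) = 1"
      using det unfolding d' by (simp add: algebra_simps)
    have three': "\<not> 3 dvd int d' \<or> 3 dvd xN N r \<and> 3 dvd xN_dual N r"
      using three unfolding d' by (auto simp: dvd_add_left_iff)
    have "eta_char N r 1 a (b + 3 * a) (int N * c) (int d + 3 * (int N * c)) =
        eta_char N r 1 a b (int N * c) (int d) * ee (of_int (3 * xN N r) / 24)"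
      using N c by (intro eta_char_translate) auto
    then have "eta_char N r 1 a b (int N * c) (int d) = 
      eta_char N r 1 a (b + 3 * a) (int N * c) (int d') / ee (of_int (3 * xN N r) / 24)"
      unfolding d' by (simp add: field_simps)
    also have "eta_char N r 1 a (b + 3 * a) (int N * c) (int d') =
      of_int (jacobi (int d') (varpi N r)) * ee (of_int (int d' * ((b + 3 * a) * xN N r - c * xN_dual N r)) / 24)"
      using odd_case[OF det' od' three'] .
    also have "jacobi (int d') (varpi N r) = jacobi (int d) (varpi N r)"
    proof (rule jacobi_cong_primes[OF vodd])
      fix p assume "prime p" "p dvd varpi N r"
      then have "p dvd N" using prime_dvd_varpi N(1) by blast
      then have "int p dvd 3 * (int N * c)" by auto
      then show "[int d' = int d] (mod int p)" unfolding d' by (simp add: cong_iff_dvd_diff)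
    qed
    also have "of_int (jacobi (int d) (varpi N r)) * ee (of_int (int d' * ((b + 3 * a) * xN N r - c * xN_dual N r)) / 24) / ee (of_int (3 * xN N r) / 24) =
      of_int (jacobi (int d) (varpi N r)) * ee (of_int (int d' * ((b + 3 * a) * xN N r - c * xN_dual N r) - 3 * xN N r) / 24)"
      by (simp add: ee_diff diff_divide_distrib)
    also have "ee (of_int (int d' * ((b + 3 * a) * xN N r - c * xN_dual N r) - 3 * xN N r) / 24) =
      ee (of_int (int d * (b * xN N r - c * xN_dual N r)) / 24)"
    proof (rule ee_cong24)
      obtain x y where xy: "xN N r = 8 * x" "xN_dual N r = 8 * y" using eight by blast
      have "int d' * ((b + 3 * a) * xN N r - c * xN_dual N r) - 3 * xN N r - int d * (b * xN N r - c * xN_dual N r) =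
        24 * (int d * a * x + int N * c * ((b + 3 * a) * x - c * y) - x)"
        unfolding d' xy by (simp add: algebra_simps)
      then show "[int d' * ((b + 3 * a) * xN N r - c * xN_dual N r) - 3 * xN N r =
          int d * (b * xN N r - c * xN_dual N r)] (mod 24)"
        by (simp add: cong_iff_dvd_diff)
    qed
    finally show ?thesis .
  qed
qed

section \<open>The Hecke weights\<close>

lemma odd_mod_4: "odd (n::nat) \<Longrightarrow> n mod 4 = 1 \<or> n mod 4 = 3"
  by presburger

section \<open>The modulus \<open>m_f\<close> and the set \<open>L_f\<close>\<close>

lemma m_f_eq: "m_f N r * gcd 24 (gcd (xN_dual N r) (xN N r)) = 24"
  unfolding m_f_def xN_dual_def[symmetric] by (simp add: dvd_div_mult_self)

lemma m_f_dvd_24: "m_f N r dvd 24"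
  using m_f_eq by (metis dvd_triv_left)

text \<open>The purpose of \<open>m_f\<close>: with u = l - 1, replacing b by l b or c by l c leaves
  the exponents of the character unchanged modulo 24.\<close>

lemma m_f_dvd_imp:
  assumes "m_f N r dvd u"
  shows "24 dvd u * xN N r" "24 dvd u * xN_dual N r"
proof -
  define g where "g = gcd 24 (gcd (xN_dual N r) (xN N r))"
  have "g dvd xN N r" "g dvd xN_dual N r" unfolding g_def by (meson dvd_trans gcd_dvd1 gcd_dvd2)+
  then have "m_f N r * g dvd u * xN N r" "m_f N r * g dvd u * xN_dual N r"
    using assms mult_dvd_mono by blast+
  then show "24 dvd u * xN N r" "24 dvd u * xN_dual N r"
    unfolding g_def m_f_eq .
qed

text \<open>By \<open>m_f_eq\<close> the part of 24 prime to \<open>m_f\<close> sits entirely in the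
  complementary gcd. Every divisor of an l in \<open>L_f\<close> is prime to \<open>m_f\<close>; so
  an even l forces 8, and an l divisible by 3 forces 3, to divide both exponents.\<close>

lemma dvd_of_coprime_m_f:
  assumes "coprime q (m_f N r)" "q dvd 24"
  shows "q dvd xN N r" "q dvd xN_dual N r"
proof -
  have "q dvd m_f N r * gcd 24 (gcd (xN_dual N r) (xN N r))" using assms(2) unfolding m_f_eq .
  then have "q dvd gcd 24 (gcd (xN_dual N r) (xN N r))"
    using assms(1) by (simp only: coprime_dvd_mult_right_iff)
  then show "q dvd xN N r" "q dvd xN_dual N r" by auto
qed

lemma L_f_dvd: "l \<in> L_f N r \<Longrightarrow> m_f N r dvd int l - 1"
  by (simp add: L_f_def cong_iff_dvd_diff)

lemma L_f_coprime:
  assumes "l \<in> L_f N r" "q dvd int l"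
  shows "coprime q (m_f N r)"
proof (rule coprimeI)
  fix k assume "k dvd q" "k dvd m_f N r"
  then have "k dvd int l" "k dvd int l - 1" using assms L_f_dvd by (meson dvd_trans)+
  then have "k dvd int l - (int l - 1)" by (rule dvd_diff)
  then show "is_unit k" by simp
qed

text \<open>The unit group modulo 24, hence modulo each divisor of 24, has exponent 2.\<close>

lemma coprime_dvd_24_square:
  fixes u m :: int
  assumes "coprime u m" "m dvd 24"
  shows "m dvd u^2 - 1"
proof -
  obtain s t where st: "m = s * t" "s dvd 8" "t dvd 3"
    using assms(2) division_decomp[of m 8 3] by auto
  have st': "coprime u s" "coprime u t" using assms(1) unfolding st by auto
  have eq: "u^2 - 1 = (u - 1) * (u + 1)" by (simp add: power2_eq_square algebra_simps)
  have "s dvd u^2 - 1"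
  proof (cases "even u")
    case True
    then have "coprime 2 s" using st'(1) by (meson coprime_divisors dvd_refl)
    then have "coprime (2^3) s" by (simp only: coprime_power_left_iff) simp
    then have "coprime 8 s" by simp
    then have "is_unit s" using st(2) by (meson coprime_common_divisor dvd_refl)
    then show ?thesis by (meson dvd_trans one_dvd)
  next
    case False
    then obtain k where k: "u = 2 * k + 1" by (elim oddE)
    have "even (k * (k + 1))" by simp
    then obtain j where "k * (k + 1) = 2 * j" by blast
    then have "u^2 - 1 = 8 * j" unfolding k by (simp add: power2_eq_square algebra_simps)
    then show ?thesis using st(2) by (metis dvd_mult2)
  qed
  moreover have "t dvd u^2 - 1"
  proof (cases "3 dvd u")
    case True
    then have "coprime 3 t" using st'(2) by (meson coprime_divisors dvd_refl)
    then have "is_unit t" using st(3) by (meson coprime_common_divisor dvd_refl)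
    then show ?thesis by (meson dvd_trans one_dvd)
  next
    case False
    then have "3 dvd u - 1 \<or> 3 dvd u + 1" by presburger
    then have "3 dvd u^2 - 1" unfolding eq by auto
    then show ?thesis using st(3) by (rule dvd_trans[rotated])
  qed
  moreover have "coprime s t"
  proof -
    have "coprime (8::int) 3" by code_simp
    then show ?thesis using st by (meson coprime_divisors)
  qed
  ultimately show ?thesis unfolding st(1) by (rule divides_mult)
qed

definition delta_int :: "nat \<Rightarrow> (nat \<Rightarrow> int) \<Rightarrow> int" where
  "delta_int N r = (if odd_part (varpi N r) mod 4 = 1 then 0 else 1)"

lemma delta_eq: "delta N r = of_int (delta_int N r)"
  by (simp add: delta_def delta_int_def)

section \<open>Odd parts and the parity of the weight\<close>

lemma odd_part_props:
  assumes "n > 0"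
  shows "n = 2 ^ multiplicity 2 n * odd_part n" "odd (odd_part n)" "odd_part n > 0"
proof -
  show 1: "n = 2 ^ multiplicity 2 n * odd_part n"
    unfolding odd_part_def by (simp add: multiplicity_dvd)
  show "odd (odd_part n)"
    unfolding odd_part_def using multiplicity_decompose[of n 2] assms by simp
  show "odd_part n > 0" using 1 assms by (cases "odd_part n = 0") auto
qed

lemma odd_part_mult: "m > 0 \<Longrightarrow> n > 0 \<Longrightarrow> odd_part (m * n) = odd_part m * odd_part n"
proof -
  assume mn: "m > 0" "n > 0"
  have "2 ^ multiplicity 2 (m * n) * odd_part (m * n) = m * n"
    using odd_part_props(1)[of "m * n"] mn by simp
  also have "\<dots> = (2 ^ multiplicity 2 m * odd_part m) * (2 ^ multiplicity 2 n * odd_part n)"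
    using odd_part_props(1)[OF mn(1)] odd_part_props(1)[OF mn(2)] by simp
  also have "\<dots> = 2 ^ multiplicity 2 (m * n) * (odd_part m * odd_part n)"
    using mn by (simp add: prime_elem_multiplicity_mult_distrib power_add)
  finally show ?thesis by simp
qed

lemma odd_part_1 [simp]: "odd_part 1 = 1" "odd_part (Suc 0) = 1"
  by (simp_all add: odd_part_def)

lemma odd_part_power: "n > 0 \<Longrightarrow> odd_part (n ^ e) = odd_part n ^ e"
  by (induction e) (auto simp: odd_part_mult)

lemma odd_part_prod:
  "(\<And>i. i \<in> A \<Longrightarrow> g i > 0) \<Longrightarrow> odd_part (\<Prod>i\<in>A. g i) = (\<Prod>i\<in>A. odd_part (g i))"
  by (induction A rule: infinite_finite_induct) (auto simp: odd_part_mult prod_pos)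

lemma odd_part_odd: "odd n \<Longrightarrow> odd_part n = n"
  by (simp add: odd_part_def not_dvd_imp_multiplicity_0)

lemma odd_part_double: "n > 0 \<Longrightarrow> odd_part (2 * n) = odd_part n"
proof -
  assume "n > 0"
  then have "odd_part (2 * n) = odd_part 2 * odd_part n" by (intro odd_part_mult) auto
  moreover have "odd_part 2 = 1" by (simp add: odd_part_def)
  ultimately show ?thesis by simp
qed

lemma div_divisor_pos: "N > 0 \<Longrightarrow> n dvd N \<Longrightarrow> N div n > (0::nat)"
  by (auto simp: dvd_div_eq_0_iff intro!: Nat.gr0I)

text \<open>Only the odd part of \<varpi> causes a reciprocity sign, since (2/a) = (a/2) for odd a;
  whether that odd part is 3 modulo 4 is what \<delta> records.\<close>

lemma jacobi_varpi_swap: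
  assumes N: "N > 0" and a: "odd a" "coprime a N"
  shows "jacobi (int (varpi N r)) a =
    jacobi (int a) (varpi N r) * (if delta_int N r = 1 \<and> a mod 4 = 3 then -1 else 1)"
proof -
  define v where "v = multiplicity 2 (varpi N r)"
  define m where "m = odd_part (varpi N r)"
  have V: "varpi N r = 2 ^ v * m" and m: "odd m" "m > 0"
    using odd_part_props[OF varpi_pos[OF N]] unfolding v_def m_def by auto
  have "coprime a (varpi N r)" using coprime_varpi N a by blast
  then have cop: "coprime m a" unfolding V by (simp add: coprime_commute)
  have j2: "jacobi (int a) 2 = jacobi 2 a"
  proof -
    have "int a mod 8 = int (a mod 8)" by (simp add: zmod_int)
    then show ?thesis using a jacobi_2[OF a(1)] by (auto simp: kron_prime_def)
  qed
  have "jacobi (int (varpi N r)) a = jacobi 2 a ^ v * jacobi (int m) a"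
    unfolding V by (simp add: jacobi_mult_left jacobi_power_left)
  also have "jacobi (int m) a = jacobi (int a) m * recip_sign m a"
    using m a cop by (intro jacobi_reciprocity) auto
  also have "jacobi 2 a ^ v * (jacobi (int a) m * recip_sign m a) = jacobi (int a) (varpi N r) * recip_sign m a"
    unfolding V using m by (simp add: jacobi_mult_right jacobi_power_right j2)
  also have "recip_sign m a = (if delta_int N r = 1 \<and> a mod 4 = 3 then -1 else 1)"
  proof -
    have "m mod 4 = 1 \<or> m mod 4 = 3" using m(1) by presburger
    then show ?thesis unfolding recip_sign_def delta_int_def m_def[symmetric] by auto
  qed
  finally show ?thesis .
qed

text \<open>The odd part of \<varpi> is 1 + 2 \<delta> modulo 4, so
  \<open>weighted_sum_mod_4\<close> for the odd parts of N/n applies. The second conclusion says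
  that k + \<delta> is even, which is what trivialises \<psi>.\<close>

lemma twok_mod_4:
  assumes N: "N > 0" and "4 dvd (\<Sum>n | n dvd N. int (odd_part (N div n)) * r n)"
  shows "even (twok N r)" "4 dvd twok N r + 2 * delta_int N r"
proof -
  define V where "V = odd_part (varpi N r)"
  have "[(\<Sum>n | n dvd N. int (odd_part (N div n)) * r n) = twok N r + int (\<Prod>n | n dvd N. odd_part (N div n) ^ nat \<bar>r n\<bar>) - 1] (mod 4)"
    unfolding twok_def using N odd_part_props(2)[OF div_divisor_pos[OF N]]
    by (intro weighted_sum_mod_4) auto
  also have "(\<Prod>n | n dvd N. odd_part (N div n) ^ nat \<bar>r n\<bar>) = V"
    unfolding V_def varpi_def using div_divisor_pos[OF N] by (subst odd_part_prod) (auto simp: odd_part_power intro!: prod.cong)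
  finally have 4: "4 dvd twok N r + int V - 1" using assms(2) by (metis cong_dvd_iff)
  have "V mod 4 = 1 \<or> V mod 4 = 3"
    using odd_part_props(2)[OF varpi_pos[OF N]] unfolding V_def by (rule odd_mod_4)
  then have "V mod 4 = 1 \<and> delta_int N r = 0 \<or> V mod 4 = 3 \<and> delta_int N r = 1"
    unfolding delta_int_def V_def[symmetric] by auto
  then have "even (twok N r) \<and> 4 dvd twok N r + 2 * delta_int N r"
    using 4 by (elim disjE conjE; simp only:; presburger)
  then show "even (twok N r)" "4 dvd twok N r + 2 * delta_int N r" by auto
qed

lemma L_f_even:
  assumes "l \<in> L_f N r" "even l"
  shows "8 dvd xN N r" "8 dvd xN_dual N r"
proof -
  have "coprime 2 (m_f N r)" using assms by (intro L_f_coprime) auto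
  then have "coprime (2^3) (m_f N r)" by (simp only: coprime_power_left_iff) simp
  then have "coprime 8 (m_f N r)" by simp
  then show "8 dvd xN N r" "8 dvd xN_dual N r" by (intro dvd_of_coprime_m_f; simp)+
qed

lemma L_f_three:
  assumes "l \<in> L_f N r" "3 dvd int l"
  shows "3 dvd xN N r" "3 dvd xN_dual N r"
  using L_f_coprime[OF assms] by (intro dvd_of_coprime_m_f; simp)+

lemma twok_mod_4_odd_level:
  assumes "N > 0" "odd N" "4 dvd xN_dual N r"
  shows "even (twok N r)" "4 dvd twok N r + 2 * delta_int N r"
proof -
  have "odd_part (N div n) = N div n" if "n dvd N" for n
    using assms(2) that by (intro odd_part_odd) (metis dvd_mult_div_cancel even_mult_iff)
  then have "(\<Sum>n | n dvd N. int (odd_part (N div n)) * r n) = xN_dual N r"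
    unfolding xN_dual_def by (intro sum.cong) auto
  then show "even (twok N r)" "4 dvd twok N r + 2 * delta_int N r"
    using twok_mod_4[OF assms(1), of r] assms(3) by auto
qed

text \<open>Split the divisors n of N = 2 M by parity. With u and w the odd parts of n and N/n one
  has u w = M, and u^2 = 1 modulo 8 gives w = M u. Hence both exponents are expressed by the same
  two sums A and B, namely A + 2 B and, up to the unit M, 2 A + B.\<close>

lemma twok_mod_4_twice_odd_level:
  assumes N: "N = 2 * M" "odd M" and x: "8 dvd xN N r" "8 dvd xN_dual N r"
  shows "4 dvd twok N r + 2 * delta_int N r"
proof -
  have Npos: "N > 0" using N by (auto intro!: Nat.gr0I)
  define D where "D = {n. n dvd N}"
  define u where "u n = int (odd_part n)" for n
  define w where "w n = int (odd_part (N div n))" for n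
  have key: "int n = (if odd n then u n else 2 * u n)" "int (N div n) = (if odd n then 2 * w n else w n)"
    "u n * w n = int M" if nD: "n \<in> D" for n
  proof -
    obtain m where m: "N = n * m" using nD by (auto simp: D_def)
    have pos: "n > 0" "m > 0" using m Npos by auto
    have dm: "N div n = m" using m pos by simp
    have "odd_part n * odd_part m = odd_part (2 * M)" using odd_part_mult[OF pos] m N by simp
    also have "\<dots> = M" using N Npos odd_part_odd[OF N(2)] by (simp add: odd_part_double)
    finally show um: "u n * w n = int M" unfolding u_def w_def dm by (metis of_nat_mult)
    show "int n = (if odd n then u n else 2 * u n)"
    proof (cases "odd n")
      case True then show ?thesis by (simp add: u_def odd_part_odd)
    next
      case False
      then obtain n' where n': "n = 2 * n'" by blast
      then have "M = n' * m" using m N by simp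
      then have "odd n'" using N by auto
      then show ?thesis using n' pos by (simp add: u_def odd_part_double odd_part_odd)
    qed
    show "int (N div n) = (if odd n then 2 * w n else w n)"
    proof (cases "odd n")
      case False
      then obtain n' where n': "n = 2 * n'" by blast
      then have "M = n' * m" using m N by simp
      then have "odd m" using N by auto
      then show ?thesis using False unfolding dm w_def by (simp add: odd_part_odd)
    next
      case True
      then have "even m" using m N by (metis dvd_triv_left even_mult_iff)
      then obtain m' where m': "m = 2 * m'" by blast
      then have "M = n * m'" using m N by simp
      then have "odd m'" using N by auto
      then show ?thesis using True m' pos unfolding dm w_def by (simp add: odd_part_double odd_part_odd)
    qed
  qed
  define A where "A = (\<Sum>n\<in>D. if odd n then u n * r n else 0)"
  define B where "B = (\<Sum>n\<in>D. if odd n then 0 else u n * r n)"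
  define A' where "A' = (\<Sum>n\<in>D. if odd n then w n * r n else 0)"
  define B' where "B' = (\<Sum>n\<in>D. if odd n then 0 else w n * r n)"
  have 1: "xN N r = A + 2 * B"
    unfolding xN_def A_def B_def D_def[symmetric] sum_distrib_left sum.distrib[symmetric]
    by (intro sum.cong refl) (auto simp: key(1))
  have 2: "xN_dual N r = 2 * A' + B'"
    unfolding xN_dual_def A'_def B'_def D_def[symmetric] sum_distrib_left sum.distrib[symmetric]
    by (intro sum.cong refl) (auto simp: key(2))
  have w: "[w n = int M * u n] (mod 8)" if "n \<in> D" for n
  proof -
    have "odd (u n)" unfolding u_def using that Npos by (auto simp: D_def intro!: odd_part_props(2) Nat.gr0I)
    then have "8 dvd (u n)^2 - 1" by (intro coprime_dvd_24_square) (use coprime_power_right_iff[of "u n" 2 3] in simp_all)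
    moreover have "int M * u n - w n = ((u n)^2 - 1) * w n"
      unfolding key(3)[OF that, symmetric] by (simp add: power2_eq_square algebra_simps)
    ultimately show ?thesis by (metis cong_iff_dvd_diff cong_sym dvd_mult2)
  qed
  have 3: "[A' = int M * A] (mod 8)" "[B' = int M * B] (mod 8)"
    unfolding A_def A'_def B_def B'_def sum_distrib_left
    by (intro cong_sum; auto simp: mult.assoc[symmetric] intro!: cong_mult w)+
  have "[2 * A' + B' = 2 * (int M * A) + int M * B] (mod 8)"
    by (intro cong_add cong_mult cong_refl 3)
  then have "8 dvd 2 * (int M * A) + int M * B" using x(2) unfolding 2 by (metis cong_dvd_iff)
  also have "2 * (int M * A) + int M * B = int M * (2 * A + B)" by (simp add: algebra_simps)
  finally have "8 dvd int M * (2 * A + B)" .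
  moreover have "coprime 8 (int M)" using N(2) coprime_power_left_iff[of 2 3 "int M"] by simp
  ultimately have "8 dvd 2 * A + B" by (simp add: coprime_dvd_mult_right_iff)
  moreover have "8 dvd A + 2 * B" using x(1) unfolding 1 .
  \<comment> \<open>The two multiples of 8 add up to 3 (A + B).\<close>
  ultimately have "4 dvd A + B" by presburger
  moreover have "[A' + B' = int M * A + int M * B] (mod 8)" by (intro cong_add 3)
  then have "[A' + B' = int M * A + int M * B] (mod 4)" by (rule cong_dvd_modulus) simp
  moreover have "int M * A + int M * B = int M * (A + B)" by (simp add: algebra_simps)
  ultimately have "4 dvd A' + B'" by (metis cong_dvd_iff dvd_mult)
  also have "A' + B' = (\<Sum>n | n dvd N. int (odd_part (N div n)) * r n)"
    unfolding A'_def B'_def D_def[symmetric] sum.distrib[symmetric] w_def by (intro sum.cong) auto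
  finally show ?thesis using twok_mod_4(2)[OF Npos] by blast
qed

lemma multiplicity_varpi:
  assumes "N > 0"
  shows "multiplicity 2 (varpi N r) = (\<Sum>n | n dvd N. nat \<bar>r n\<bar> * multiplicity 2 (N div n))"
  unfolding varpi_def using assms div_divisor_pos[OF assms]
  by (subst prime_elem_multiplicity_prod_distrib)
     (auto simp: prime_elem_multiplicity_power_distrib intro!: sum.cong)

text \<open>A parity count over the divisors. If N is odd, or if exactly one of n and N/n is always
  odd, then 2k has the parity of x_N or of the sum of both exponents, hence is even. If 4 exactly
  divides N, the pair n, N/n misses the n with both members even, and there v_2(N/n) = 1; these are
  counted by v_2(\<varpi>).\<close>

lemma odd_twok_even_l:
  assumes N: "N > 0" and x: "even (xN N r)" "even (xN_dual N r)" and K: "odd (twok N r)"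
  shows "4 dvd N" "\<not> 8 dvd N \<Longrightarrow> odd (multiplicity 2 (varpi N r))"
proof -
  have fin: "finite {n. n dvd N}" using N by simp
  \<comment> \<open>\<open>h\<close> is the defect between r_n and its contribution to the two
    exponents, modulo 2.\<close>
  have par: "even (twok N r) \<longleftrightarrow> even (xN N r + xN_dual N r + (\<Sum>n | n dvd N. h n))"
    if "\<And>n. n dvd N \<Longrightarrow> even (r n - (int n * r n + int (N div n) * r n + h n))" for h
  proof -
    have "even (\<Sum>n | n dvd N. r n - (int n * r n + int (N div n) * r n + h n))"
      using that by (intro dvd_sum) auto
    then have "even (twok N r - (xN N r + xN_dual N r + (\<Sum>n | n dvd N. h n)))"
      unfolding twok_def xN_def xN_dual_def by (simp add: sum_subtractf sum.distrib)
    then show ?thesis by simp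
  qed
  have prod: "n * (N div n) = N" if "n dvd N" for n using that by simp
  show "4 dvd N"
  proof (rule ccontr)
    assume n4: "\<not> 4 dvd N"
    show False
    proof (cases "odd N")
      case True
      have "even (\<Sum>n | n dvd N. r n - int n * r n)"
      proof (rule dvd_sum)
        fix n assume "n \<in> {n. n dvd N}"
        then have "odd n" using True by auto
        then show "even (r n - int n * r n)" by simp
      qed
      then have "even (twok N r - xN N r)" unfolding twok_def xN_def by (simp add: sum_subtractf)
      then show False using x K by simp
    next
      case False
      have "even (r n - (int n * r n + int (N div n) * r n + 0))" if "n dvd N" for n
      proof -
        have "even n \<longleftrightarrow> odd (N div n)"
        proof
          assume "even n"
          show "odd (N div n)"
          proof
            assume "even (N div n)"
            then have "2 * 2 dvd n * (N div n)" using \<open>even n\<close> by (intro mult_dvd_mono)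
            then show False using n4 prod[OF that] by simp
          qed
        next
          assume "odd (N div n)"
          then show "even n" using prod[OF that] False by (metis even_mult_iff)
        qed
        then show ?thesis by auto
      qed
      from par[OF this] x K show False by simp
    qed
  qed
  show "odd (multiplicity 2 (varpi N r))" if n8: "\<not> 8 dvd N"
  proof -
    define h where "h n = int (nat \<bar>r n\<bar> * multiplicity 2 (N div n))" for n
    have "even (r n - (int n * r n + int (N div n) * r n + h n))" if "n dvd N" for n
    proof -
      have pos: "n > 0" "N div n > 0" using that N div_divisor_pos by (auto intro!: Nat.gr0I)
      have "multiplicity 2 n + multiplicity 2 (N div n) = multiplicity 2 N"
        using prod[OF that] pos by (metis prime_elem_multiplicity_mult_distrib not_gr0 prime_elem_nat_iff two_is_prime_nat)
      also have "multiplicity 2 N = 2"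
        using \<open>4 dvd N\<close> n8 by (intro multiplicity_eqI) auto
      finally have s: "multiplicity 2 n + multiplicity 2 (N div n) = 2" .
      have z: "even m \<longleftrightarrow> multiplicity 2 m > 0" if "m > 0" for m :: nat
        using that by (simp add: prime_multiplicity_gt_zero_iff)
      have "multiplicity 2 (N div n) = 0 \<or> multiplicity 2 (N div n) = 1 \<or> multiplicity 2 (N div n) = 2" using s by auto
      then show ?thesis
        using z[OF pos(1)] z[OF pos(2)] s unfolding h_def by (elim disjE) (auto simp: even_nat_iff)
    qed
    from par[OF this] x K have "odd (\<Sum>n | n dvd N. h n)" by simp
    moreover have "(\<Sum>n | n dvd N. h n) = int (multiplicity 2 (varpi N r))"
      unfolding multiplicity_varpi[OF N] h_def by simp
    ultimately show ?thesis by simp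
  qed
qed

lemma L_f_even_odd_twok:
  assumes N: "N > 0" and l: "l \<in> L_f N r" "even l" and K: "odd (twok N r)"
  shows "4 dvd N" "\<not> 8 dvd N \<Longrightarrow> delta1 N r l = 1"
proof -
  have "even (xN N r)" "even (xN_dual N r)"
    using L_f_even[OF l] by (auto elim!: dvd_trans[rotated])
  from odd_twok_even_l[OF N this K] show "4 dvd N" "\<not> 8 dvd N \<Longrightarrow> delta1 N r l = 1"
    using l K by (auto simp: delta1_def)
qed

lemma L_f_even_odd_level:
  assumes "N > 0" "odd N" "l \<in> L_f N r" "even l"
  shows "even (twok N r)" "4 dvd twok N r + 2 * delta_int N r"
proof -
  have "4 dvd xN_dual N r" using L_f_even(2)[OF assms(3,4)] by (rule dvd_trans[rotated]) simp
  from twok_mod_4_odd_level[OF assms(1,2) this]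
  show "even (twok N r)" "4 dvd twok N r + 2 * delta_int N r" by auto
qed

section \<open>Closed forms of \<psi> and of the weights\<close>

lemma four_dvd_of_eight_dvd_mult:
  fixes m g :: int
  assumes "8 dvd m * g" "\<not> 4 dvd m"
  shows "4 dvd g"
proof (cases "even m")
  case True
  then obtain m' where m': "m = 2 * m'" by blast
  then have "odd m'" using assms(2) by auto
  then have "coprime (2^2) m'" by (simp only: coprime_power_left_iff) simp
  moreover have "2 * 4 dvd 2 * (m' * g)" using assms(1) unfolding m' by (simp add: mult.assoc)
  then have "4 dvd m' * g" by (simp only: dvd_mult_cancel_left) simp
  ultimately show ?thesis by (simp add: coprime_dvd_mult_right_iff)
next
  case False
  then have "coprime (2^3) m" by (simp only: coprime_power_left_iff) simp
  then have "8 dvd g" using assms(1) by (simp add: coprime_dvd_mult_right_iff)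
  then show ?thesis by presburger
qed

text \<open>For integral k and odd a the three formulas for \<psi> all become the sign with exponent
  (k + \<delta>)(a - 1)/2: every other term of the exponent carries an even factor, or k + \<delta>
  is even.\<close>

lemma psi_lr_even_twok:
  assumes N: "N > 0" and l: "l \<in> L_f N r" "l = a * d" and a: "odd a" "coprime a N" and K: "twok N r = 2 * k"
    and A: "int a = 2 * A + 1"
  shows "psi_lr N r l a b = ee (of_int ((k + delta_int N r) * A) / 2)"
proof -
  define \<kappa> where "\<kappa> = k + delta_int N r"
  have k2: "2 * \<kappa> = twok N r + 2 * delta_int N r" by (simp add: \<kappa>_def K)
  have apos: "a > 0" using a by (simp add: odd_pos)
  have ld: "l div a = d" using l(2) apos by simp
  have wt: "wt N r + delta N r = of_int \<kappa>" by (simp add: wt_def K delta_eq \<kappa>_def)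
  have ra: "real a = 2 * of_int A + 1" using arg_cong[OF A, of real_of_int] by simp
  show ?thesis
  proof (cases "odd l")
    case ol: True
    then have "odd d" using l(2) by simp
    then obtain D where D: "int d = 2 * D + 1" by (metis even_of_nat oddE)
    define L where "L = 2 * A * D + A + D"
    have L: "int l = 2 * L + 1" unfolding l(2) L_def using A D by (simp add: algebra_simps)
    have rd: "real d = 2 * of_int D + 1" "real l = 2 * of_int L + 1"
      using arg_cong[OF D, of real_of_int] arg_cong[OF L, of real_of_int] by simp_all
    have "psi_lr N r l a b = ee (- (wt N r + delta N r) / 4 * (real d - 1) + (wt N r + delta N r) * (real l - 1) * (real N - 1) / 4)"
      unfolding psi_lr_def Let_def ld using ol by simp
    also have "\<dots> = ee (of_int (\<kappa> * (L * (int N - 1) - D)) / 2)"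
      unfolding wt rd by (intro arg_cong[where f = ee]) (simp add: field_simps)
    also have "\<dots> = ee (of_int (\<kappa> * A) / 2)"
    proof -
      have "even (\<kappa> * (L * (int N - 1) - D)) \<longleftrightarrow> even (\<kappa> * A)"
      proof (cases "even N \<or> even L")
        case True
        then show ?thesis unfolding L_def by auto
      next
        case False
        \<comment> \<open>Here N and L are odd, so l = 2 L + 1 is 3 modulo 4. Thus 4 does not divide
          \<open>m_f\<close>, which forces 4 into \<open>xN_dual N r\<close> and makes \<kappa>
          even.\<close>
        have "\<not> 4 dvd m_f N r"
        proof
          assume "4 dvd m_f N r"
          then have "4 dvd int l - 1" using L_f_dvd[OF l(1)] by (rule dvd_trans)
          then show False using False unfolding L by presburger
        qed
        have "4 dvd xN_dual N r"
        proof -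
          define g where "g = gcd 24 (gcd (xN_dual N r) (xN N r))"
          have "8 dvd m_f N r * g" unfolding g_def m_f_eq by simp
          then have "4 dvd g" using \<open>\<not> 4 dvd m_f N r\<close> by (rule four_dvd_of_eight_dvd_mult)
          then show ?thesis unfolding g_def by auto
        qed
        then have "4 dvd 2 * \<kappa>" using twok_mod_4_odd_level(2)[OF N] False unfolding k2 by blast
        then have "even \<kappa>" by presburger
        then show ?thesis by simp
      qed
      then show ?thesis unfolding ee_int_half by simp
    qed
    finally show ?thesis unfolding \<kappa>_def .
  next
    case el: False
    show ?thesis
    proof (cases "even N")
      case False
      then have "4 dvd 2 * \<kappa>" using L_f_even_odd_level(2)[OF N _ l(1)] el unfolding k2 by blast
      then have "even (\<kappa> * A)" by (simp, presburger)
      then have "ee (of_int (\<kappa> * A) / 2) = 1" unfolding ee_int_half by simp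
      then show ?thesis using False el unfolding psi_lr_def Let_def \<kappa>_def by simp
    next
      case eN: True
      then obtain M where M: "N = 2 * M" by blast
      have d1: "delta1 N r l = 0" using K by (simp add: delta1_def)
      have "psi_lr N r l a b = ee (- (wt N r + delta N r) / 4 * (real a - 1) - real N * (wt N r + delta N r) * (1 + delta1 N r l) / 4 * real b)"
        unfolding psi_lr_def Let_def using eN el by simp
      also have "\<dots> = ee (of_int (- (\<kappa> * A + \<kappa> * int M * int b)) / 2)"
        unfolding wt ra d1 using M by (intro arg_cong[where f = ee]) (simp add: field_simps)
      also have "\<dots> = ee (of_int (\<kappa> * A) / 2)"
      proof -
        \<comment> \<open>The coefficient of b: either 4 divides N, or N is twice an odd number and
          \<kappa> is even.\<close>
        have "even (\<kappa> * int M)"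
        proof (cases "even M")
          case False
          then have "4 dvd 2 * \<kappa>" using twok_mod_4_twice_odd_level[OF M False L_f_even[OF l(1)]] el unfolding k2 by blast
          then have "even \<kappa>" by presburger
          then show ?thesis by simp
        qed simp
        then have "even (- (\<kappa> * A + \<kappa> * int M * int b)) \<longleftrightarrow> even (\<kappa> * A)" by auto
        then show ?thesis unfolding ee_int_half by simp
      qed
      finally show ?thesis unfolding \<kappa>_def .
    qed
  qed
qed

lemma odd_square_mod_8: "odd (n::int) \<Longrightarrow> 8 dvd n^2 - 1"
  using coprime_dvd_24_square[of n 8] coprime_power_right_iff[of n 2 3] by simp

text \<open>For half-integral k the formula involves d and b, but l is a square. If l is odd this
  gives a = d modulo 8; if l is even, 4 divides N and \<open>delta1\<close> removes b.\<close>

lemma psi_lr_odd_twok: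
  assumes N: "N > 0" and l: "l \<in> L_f N r" "l = a * d" and a: "coprime a N" and K: "odd (twok N r)"
  shows "odd a" "psi_lr N r l a b = ee (of_int ((int a - 1) * (twok N r + 2 * delta_int N r + 2)) / 8)"
proof -
  define \<kappa> where "\<kappa> = twok N r + 2 * delta_int N r"
  have eN: "even N" if "even l"
    using L_f_even_odd_twok(1)[OF N l(1) that K] by (meson dvd_trans even_numeral)
  show oa: "odd a"
  proof
    assume "even a"
    then have "even N" using eN l(2) by simp
    then show False using \<open>even a\<close> a by (meson coprime_common_divisor_nat odd_one coprime_common_divisor)
  qed
  then obtain A where A: "int a = 2 * A + 1" by (metis even_of_nat oddE)
  have apos: "a > 0" using oa by (simp add: odd_pos)
  have ld: "l div a = d" using l(2) apos by simp
  have wt: "wt N r + delta N r = of_int \<kappa> / 2" by (simp add: wt_def delta_eq \<kappa>_def field_simps)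
  have ra: "real a = 2 * of_int A + 1" using arg_cong[OF A, of real_of_int] by simp
  obtain h where h: "\<kappa> + 1 = 2 * h" unfolding \<kappa>_def using K by (metis add.commute dvd_triv_left evenE even_add even_plus_one_iff)
  have rh: "real_of_int \<kappa> = 2 * of_int h - 1" using arg_cong[OF h, of real_of_int] by simp
  have "psi_lr N r l a b = ee (of_int (- (\<kappa> * (int a - 1))) / 8)"
  proof (cases "odd l")
    case ol: True
    then have od: "odd d" using l(2) by simp
    obtain t where t: "l = t^2" using l(1) K unfolding L_f_def by blast
    then have "8 dvd int l - 1" using odd_square_mod_8[of "int t"] ol by (simp add: even_power)
    then obtain L where L: "int l = 8 * L + 1" by (metis add.commute diff_add_cancel dvdE)
    have "8 dvd (int a)^2 - 1" using oa by (intro odd_square_mod_8) simp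
    \<comment> \<open>Modulo 8 both l and a^2 are 1, so d = d a^2 = a l = a.\<close>
    then have "8 dvd int d * ((int a)^2 - 1) - int a * (int l - 1)"
      using \<open>8 dvd int l - 1\<close> by (rule dvd_diff[OF dvd_mult dvd_mult])
    also have "int d * ((int a)^2 - 1) - int a * (int l - 1) = int a - int d"
      unfolding l(2) by (simp add: power2_eq_square algebra_simps)
    finally obtain D where D: "int a - int d = 8 * D" by blast
    have rd: "real d = real a - 8 * of_int D" "real l = 8 * of_int L + 1"
      using arg_cong[OF D, of real_of_int] arg_cong[OF L, of real_of_int] by simp_all
    have "psi_lr N r l a b = ee (- (wt N r + delta N r) / 4 * (real d - 1) + (wt N r + delta N r) * (real l - 1) * (real N - 1) / 4)"
      unfolding psi_lr_def Let_def ld using ol by simp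
    also have "\<dots> = ee (of_int (- (\<kappa> * (int a - 1))) / 8)"
      unfolding wt rd by (intro ee_eqI[of _ _ "\<kappa> * D + \<kappa> * L * (int N - 1)"]) (simp add: field_simps)
    finally show ?thesis .
  next
    case el: False
    then have eN: "even N" using eN by simp
    \<comment> \<open>The role of \<open>delta1\<close>: it supplies the missing factor 2 when 4 but
      not 8 divides N, so that \<psi> does not depend on b.\<close>
    have "\<exists>M. real N * (1 + delta1 N r l) = 8 * of_int M"
    proof (cases "8 dvd N")
      case True
      then obtain M where "N = 8 * M" by blast
      then show ?thesis unfolding delta1_def by (intro exI[of _ "int M * (1 + (if even l \<and> 4 dvd N \<and> odd (twok N r) \<and> odd (multiplicity 2 (varpi N r)) then 1 else 0))"]) auto
    next
      case False
      moreover obtain M where "N = 4 * M" using L_f_even_odd_twok(1)[OF N l(1) _ K] el by blast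
      ultimately show ?thesis using L_f_even_odd_twok(2)[OF N l(1) _ K] el by (intro exI[of _ "int M"]) auto
    qed
    then obtain M where M: "real N * (1 + delta1 N r l) = 8 * of_int M" by blast
    have "psi_lr N r l a b = ee (- (wt N r + delta N r) / 4 * (real a - 1) - real N * (wt N r + delta N r) * (1 + delta1 N r l) / 4 * real b)"
      unfolding psi_lr_def Let_def using eN el by simp
    also have "- (wt N r + delta N r) / 4 * (real a - 1) - real N * (wt N r + delta N r) * (1 + delta1 N r l) / 4 * real b =
        - (wt N r + delta N r) / 4 * (real a - 1) - (real N * (1 + delta1 N r l)) * (wt N r + delta N r) / 4 * real b" by simp
    also have "ee \<dots> = ee (of_int (- (\<kappa> * (int a - 1))) / 8)"
      unfolding wt M by (intro ee_eqI[of _ _ "- (M * \<kappa> * int b)"]) (simp add: field_simps)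
    finally show ?thesis .
  qed
  \<comment> \<open>Since \<kappa> is odd, (a - 1)(2 \<kappa> + 2) is divisible by 8. The new form
    is the one that the characters produce: 2k from the weight, 2 \<delta> from
    \<open>jacobi_varpi_swap\<close>, and 2 from (-1/g) with g = gcd(a, d).\<close>
  also have "\<dots> = ee (of_int ((int a - 1) * (\<kappa> + 2)) / 8)"
    by (intro ee_eqI[of _ _ "- (A * h)"]) (simp add: A ra rh field_simps)
  finally show "psi_lr N r l a b = ee (of_int ((int a - 1) * (twok N r + 2 * delta_int N r + 2)) / 8)"
    unfolding \<kappa>_def .
qed

lemma pm1_powi:
  assumes "u = 1 \<or> u = (-1::int)"
  shows "(of_int u :: complex) powi K = of_int (if even K then 1 else u)"
  using assms by (auto simp: power_int_def minus_one_power_iff even_nat_iff)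

text \<open>The root of unity attached to (a, b) in c_l, with only the part e(-b d x_N/24) of the
  exponential; the other part e(b d x_N/(24 l)) comes from expanding f((a \<tau> + b)/d).\<close>

definition hecke_weight :: "nat \<Rightarrow> (nat \<Rightarrow> int) \<Rightarrow> nat \<Rightarrow> nat \<Rightarrow> nat \<Rightarrow> complex" where
  "hecke_weight N r l a b =
    of_int (kronecker (int a) (int (varpi N r))) *
    of_int (kronecker (- int N * int b) (int (gcd a (l div a)))) powi twok N r *
    ee (- of_int (int b * int (l div a) * xN N r) / 24) * psi_lr N r l a b"

lemma coprime_gcd_entries:
  fixes a b d N :: nat
  assumes "coprime a N" "gcd (gcd a b) d = 1"
  shows "coprime (- int N * int b) (int (gcd a d))"
proof -
  have "coprime (gcd a d) N" using assms(1) by (meson coprime_divisors dvd_refl gcd_dvd1)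
  moreover have "gcd (gcd a d) b = gcd (gcd a b) d" by (simp only: gcd.assoc gcd.commute[of d b])
  then have "coprime (gcd a d) b" using assms(2) by (intro gcd_eq_1_imp_coprime) simp
  ultimately show ?thesis by (simp add: coprime_commute flip: of_nat_mult)
qed

lemma hecke_weight_even_twok:
  assumes N: "N > 0" and l: "l \<in> L_f N r" "l = a * d" and a: "coprime a N" "gcd (gcd a b) d = 1"
    and K: "twok N r = 2 * k"
  shows "hecke_weight N r l a b = of_int (jacobi (int a) (varpi N r)) * ee (- of_int (int b * int d * xN N r) / 24) *
    (if odd a then ee (of_int ((k + delta_int N r) * ((int a - 1) div 2)) / 2) else 1)"
proof -
  have "l > 0" using l(1) by (auto simp: L_f_def)
  then have pos: "a > 0" "d > 0" using l(2) by auto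
  then have ld: "l div a = d" using l(2) by simp
  have "of_int (kronecker (- int N * int b) (int (gcd a d))) powi twok N r = (1::complex)"
    using pos pm1_powi[OF jacobi_pm1[OF coprime_gcd_entries[OF a]], of "twok N r"] K
    by (simp add: kronecker_eq_jacobi)
  moreover have "psi_lr N r l a b = (if odd a then ee (of_int ((k + delta_int N r) * ((int a - 1) div 2)) / 2) else 1)"
  proof (cases "odd a")
    case True
    then have "int a = 2 * ((int a - 1) div 2) + 1" by simp
    from psi_lr_even_twok[OF N l True a(1) K this] True show ?thesis by simp
  next
    case False
    then have "odd N" "even l" using coprime_common_divisor[OF a(1), of 2] l(2) by auto
    then show ?thesis using False by (simp add: psi_lr_def Let_def)
  qed
  ultimately show ?thesis unfolding hecke_weight_def ld
    using varpi_pos[OF N] by (simp add: kronecker_eq_jacobi)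
qed

lemma hecke_weight_odd_twok:
  assumes N: "N > 0" and l: "l \<in> L_f N r" "l = a * d" and a: "coprime a N" "gcd (gcd a b) d = 1"
    and K: "odd (twok N r)"
  shows "hecke_weight N r l a b = of_int (jacobi (int a) (varpi N r) * jacobi (- int N * int b) (gcd a d)) *
    ee (- of_int (int b * int d * xN N r) / 24) * ee (of_int ((int a - 1) * (twok N r + 2 * delta_int N r + 2)) / 8)"
proof -
  have "l > 0" using l(1) by (auto simp: L_f_def)
  then have pos: "a > 0" "d > 0" using l(2) by auto
  then have ld: "l div a = d" using l(2) by simp
  have "of_int (kronecker (- int N * int b) (int (gcd a d))) powi twok N r = (of_int (jacobi (- int N * int b) (gcd a d)) :: complex)"
    using pos pm1_powi[OF jacobi_pm1[OF coprime_gcd_entries[OF a]], of "twok N r"] K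
    by (simp add: kronecker_eq_jacobi)
  then show ?thesis unfolding hecke_weight_def ld psi_lr_odd_twok(2)[OF N l a(1) K]
    using varpi_pos[OF N] by (simp add: kronecker_eq_jacobi)
qed

lemma L_f_square_dvd:
  assumes "l \<in> L_f N r" "int d dvd int l"
  shows "24 dvd (int d ^ 2 - 1) * xN N r" "24 dvd (int d ^ 2 - 1) * xN_dual N r"
  using m_f_dvd_imp[OF coprime_dvd_24_square[OF L_f_coprime[OF assms] m_f_dvd_24]] by auto

text \<open>Modulo \<open>m_f\<close> both a^2 and a d are 1, hence d = d a^2 = a.\<close>

lemma L_f_diff_dvd:
  assumes "l \<in> L_f N r" "l = a * d"
  shows "m_f N r dvd int a - int d"
proof -
  have "m_f N r dvd int a ^ 2 - 1"
    using assms by (intro coprime_dvd_24_square L_f_coprime m_f_dvd_24) auto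
  moreover have "m_f N r dvd int l - 1" using L_f_dvd assms by blast
  ultimately have "m_f N r dvd int d * (int a ^ 2 - 1) - int a * (int l - 1)"
    by (rule dvd_diff[OF dvd_mult dvd_mult])
  also have "int d * (int a ^ 2 - 1) - int a * (int l - 1) = int a - int d"
    unfolding assms(2) by (simp add: power2_eq_square algebra_simps)
  finally show ?thesis .
qed

text \<open>The factor is inverse to that of f under \<tau> to \<tau> + j, so weight times f((a
  \<tau> + b)/d) depends on b modulo d only.\<close>

lemma hecke_weight_translate:
  assumes N: "N > 0" and l: "l \<in> L_f N r" "l = a * d" and a: "coprime a N" "gcd (gcd a b) d = 1"
  shows "hecke_weight N r l a (b + j * d) = hecke_weight N r l a b * ee (- of_int (int j * xN N r) / 24)"
proof -
  have a': "gcd (gcd a (b + j * d)) d = 1"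
  proof -
    have "gcd (gcd a (b + j * d)) d = gcd a (gcd (b + j * d) d)" by (simp add: gcd.assoc)
    also have "gcd (b + j * d) d = gcd b d" by (metis gcd.commute gcd_add_mult mult.commute add.commute)
    finally show ?thesis using a(2) by (simp add: gcd.assoc)
  qed
  have e: "ee (- of_int (int (b + j * d) * int d * xN N r) / 24) =
      ee (- of_int (int b * int d * xN N r) / 24) * ee (- of_int (int j * xN N r) / 24)"
  proof -
    have "24 dvd (int d ^ 2 - 1) * xN N r" using L_f_square_dvd(1)[OF l(1), of d] l(2) by simp
    then have "24 dvd (- int j) * ((int d ^ 2 - 1) * xN N r)" by (rule dvd_mult)
    then have "[- (int (b + j * d) * int d * xN N r) = - (int b * int d * xN N r + int j * xN N r)] (mod 24)"
      by (simp add: cong_iff_dvd_diff power2_eq_square algebra_simps)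
    from ee_cong24[OF this] show ?thesis by (simp add: ee_add[symmetric] field_simps)
  qed
  show ?thesis
  proof (cases "even (twok N r)")
    case True
    then obtain k where k: "twok N r = 2 * k" by blast
    show ?thesis unfolding hecke_weight_even_twok[OF N l a k] hecke_weight_even_twok[OF N l a(1) a' k] e by simp
  next
    case False
    have "odd (gcd a d)" using psi_lr_odd_twok(1)[OF N l a(1) False] by (meson dvd_trans gcd_dvd1)
    then have "jacobi (- int N * int (b + j * d)) (gcd a d) = jacobi (- int N * int b) (gcd a d)"
    proof (rule jacobi_cong)
      have "int (gcd a d) dvd int d" by simp
      then have "int (gcd a d) dvd - int N * int j * int d" by (rule dvd_mult)
      then show "[- int N * int (b + j * d) = - int N * int b] (mod int (gcd a d))"
        by (simp add: cong_iff_dvd_diff algebra_simps)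
    qed
    then show ?thesis
      unfolding hecke_weight_odd_twok[OF N l a False] hecke_weight_odd_twok[OF N l a(1) a' False] e by simp
  qed
qed

text \<open>The quotients by g = gcd(a, d) are coprime with square product, so each is a square.
  Hence in half-integral weight symbols in a or d reduce to symbols in g.\<close>

lemma square_mult_decomp:
  fixes a d t :: nat
  assumes "a * d = t^2" "a > 0" "d > 0"
  obtains x y where "a = gcd a d * x^2" "d = gcd a d * y^2" "coprime x y"
proof -
  define g where "g = gcd a d"
  obtain u v where uv: "a = u * g" "d = v * g" "coprime u v"
    using gcd_coprime_exists[of a d] assms unfolding g_def by auto
  have g: "g > 0" using assms by (simp add: g_def)
  have "u * v * g^2 = t^2" using assms(1) uv by (simp add: power2_eq_square algebra_simps)
  then have "g^2 dvd t^2" by (metis dvd_triv_right)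
  then have "g dvd t" by simp
  then obtain w where "t = g * w" by blast
  then have "u * v = w^2" using \<open>u * v * g^2 = t^2\<close> g by (simp add: power_mult_distrib)
  then have "is_nth_power 2 (u * v)" by simp
  moreover have "u > 0" "v > 0" using uv assms by (auto intro!: Nat.gr0I)
  ultimately have "is_nth_power 2 u" "is_nth_power 2 v"
    using uv(3) is_nth_power_mult_coprime_natD by blast+
  then obtain x y where xy: "u = x^2" "v = y^2" by (auto simp: is_nth_power_def)
  then have "coprime x y" using uv(3) by simp
  moreover have "a = gcd a d * x^2" "d = gcd a d * y^2" using uv xy unfolding g_def by (simp_all add: mult.commute)
  ultimately show ?thesis using that by blast
qed

section \<open>Multiplicativity of the weights\<close>

lemma L_f_mult:
  assumes "l1 \<in> L_f N r" "l2 \<in> L_f N r"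
  shows "l1 * l2 \<in> L_f N r"
proof -
  have "[int l1 * int l2 = 1 * 1] (mod m_f N r)"
    using assms by (intro cong_mult) (auto simp: L_f_def)
  moreover have "\<exists>t. l1 * l2 = t^2" if "odd (twok N r)"
    using assms that unfolding L_f_def by (auto simp flip: power_mult_distrib)
  ultimately show ?thesis using assms by (auto simp: L_f_def)
qed

lemma odd_part_of_square_quotient_mod_8:
  fixes a g x :: nat
  assumes "odd a" "a = g * x^2"
  shows "int a mod 8 = int g mod 8"
proof -
  have "odd x" using assms by auto
  then have "8 dvd (int x)^2 - 1" by (intro odd_square_mod_8) simp
  then have "8 dvd int g * ((int x)^2 - 1)" by (rule dvd_mult)
  also have "int g * ((int x)^2 - 1) = int a - int g" unfolding assms(2) by (simp add: algebra_simps)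
  finally show ?thesis by (simp add: mod_eq_dvd_iff)
qed

lemma mod_8_imp_mod_4:
  fixes a b :: nat
  assumes "int a mod 8 = int b mod 8"
  shows "a mod 4 = b mod 4"
proof -
  have "a mod 8 = b mod 8" using assms by (metis of_nat_eq_iff of_nat_numeral zmod_int)
  then have "a mod 8 mod 4 = b mod 8 mod 4" by simp
  then show ?thesis by (simp add: mod_mod_cancel)
qed

lemma recip_sign_eq_ee:
  assumes "int m = 2 * A + 1" "int n = 2 * B + 1"
  shows "of_int (recip_sign m n) = ee (of_int (A * B) / 2)"
  using even_half_iff_mod_4[OF assms(1)] even_half_iff_mod_4[OF assms(2)]
  unfolding ee_int_half recip_sign_def by auto

text \<open>The entries on the left are those of the product of (a2, b2; 0, d2) and (a1, b1; 0, d1).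
  In half-integral weight neither the symbol modulo gcd(a, d) nor the exponential in a is
  multiplicative; their defects are the same reciprocity sign and cancel.\<close>

lemma hecke_weight_mult:
  assumes N: "N > 0" and l: "l1 \<in> L_f N r" "l2 \<in> L_f N r" "coprime l1 l2"
    and ad: "l1 = a1 * d1" "l2 = a2 * d2"
    and 1: "coprime a1 N" "gcd (gcd a1 b1) d1 = 1" and 2: "coprime a2 N" "gcd (gcd a2 b2) d2 = 1"
    and 3: "gcd (gcd (a1 * a2) (a2 * b1 + b2 * d1)) (d1 * d2) = 1"
  shows "hecke_weight N r (l1 * l2) (a1 * a2) (a2 * b1 + b2 * d1) = hecke_weight N r l1 a1 b1 * hecke_weight N r l2 a2 b2"
proof -
  define b where "b = a2 * b1 + b2 * d1"
  have l12: "l1 * l2 \<in> L_f N r" "l1 * l2 = (a1 * a2) * (d1 * d2)" using L_f_mult l ad by auto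
  have c3: "coprime (a1 * a2) N" "gcd (gcd (a1 * a2) b) (d1 * d2) = 1" using 1 2 3 by (auto simp: b_def)
  have "l1 > 0" "l2 > 0" using l by (auto simp: L_f_def)
  then have pos: "a1 > 0" "d1 > 0" "a2 > 0" "d2 > 0" using ad by auto
  have cop: "coprime a1 a2" "coprime a1 d2" "coprime d1 a2" "coprime d1 d2"
    using l(3) unfolding ad by auto
  \<comment> \<open>Uses d1^2 = 1 in the term with b2 and l2 = a2 d2 = 1 in the term with b1, both
    modulo \<open>m_f\<close>.\<close>
  have e: "ee (- of_int (int b * int (d1 * d2) * xN N r) / 24) =
      ee (- of_int (int b1 * int d1 * xN N r) / 24) * ee (- of_int (int b2 * int d2 * xN N r) / 24)"
  proof -
    have "24 dvd (int d1 ^ 2 - 1) * xN N r" using L_f_square_dvd(1)[OF l(1), of d1] ad by simp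
    then have "24 dvd (- int b2 * int d2) * ((int d1 ^ 2 - 1) * xN N r)" by (rule dvd_mult)
    moreover have "24 dvd (int l2 - 1) * xN N r" using m_f_dvd_imp(1)[OF L_f_dvd[OF l(2)]] .
    then have "24 dvd (- int b1 * int d1) * ((int l2 - 1) * xN N r)" by (rule dvd_mult)
    ultimately have "24 dvd (- int b2 * int d2) * ((int d1 ^ 2 - 1) * xN N r) + (- int b1 * int d1) * ((int l2 - 1) * xN N r)"
      by (rule dvd_add)
    also have "\<dots> = - (int b * int (d1 * d2) * xN N r) - (- (int b1 * int d1 * xN N r + int b2 * int d2 * xN N r))"
      unfolding b_def ad by (simp add: power2_eq_square algebra_simps)
    finally have "[- (int b * int (d1 * d2) * xN N r) = - (int b1 * int d1 * xN N r + int b2 * int d2 * xN N r)] (mod 24)"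
      by (simp only: cong_iff_dvd_diff)
    from ee_cong24[OF this] show ?thesis by (simp add: ee_add[symmetric] field_simps)
  qed
  have j: "jacobi (int (a1 * a2)) (varpi N r) = jacobi (int a1) (varpi N r) * jacobi (int a2) (varpi N r)"
    by (simp add: jacobi_mult_left)
  show ?thesis
  proof (cases "even (twok N r)")
    case True
    then obtain k where k: "twok N r = 2 * k" by blast
    define \<kappa> where "\<kappa> = k + delta_int N r"
    define sg where "sg a = (if odd a then ee (of_int (\<kappa> * ((int a - 1) div 2)) / 2) else 1)" for a
    have "sg (a1 * a2) = sg a1 * sg a2"
    proof (cases "odd a1 \<and> odd a2")
      case True
      then obtain A1 A2 where A: "int a1 = 2 * A1 + 1" "int a2 = 2 * A2 + 1" by (metis even_of_nat oddE)
      have h: "(int a1 - 1) div 2 = A1" "(int a2 - 1) div 2 = A2" "(int (a1 * a2) - 1) div 2 = 2 * A1 * A2 + A1 + A2"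
        using A by (simp_all add: algebra_simps)
      have "sg (a1 * a2) = ee (of_int (\<kappa> * (2 * A1 * A2 + A1 + A2)) / 2)" unfolding sg_def h using True by simp
      also have "\<dots> = ee (of_int (\<kappa> * A1) / 2 + of_int (\<kappa> * A2) / 2)"
        by (rule ee_eqI[of _ _ "\<kappa> * A1 * A2"]) (simp add: field_simps)
      also have "\<dots> = sg a1 * sg a2" unfolding sg_def h ee_add using True by simp
      finally show ?thesis .
    next
      case False
      \<comment> \<open>One of a1, a2 is even, so l1 l2 is even and N is odd; then k + \<delta> is
        even and no sign occurs.\<close>
      then have ev: "even (l1 * l2)" unfolding ad by auto
      have oN: "odd N"
        using False coprime_common_divisor[OF 1(1), of 2] coprime_common_divisor[OF 2(1), of 2] by auto
      have "4 dvd 2 * \<kappa>" using L_f_even_odd_level(2)[OF N oN l12(1) ev] unfolding k \<kappa>_def by (simp add: distrib_left)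
      then have "even \<kappa>" by presburger
      then have "sg a = 1" for a unfolding sg_def ee_int_half by simp
      then show ?thesis by simp
    qed
    then show ?thesis
      unfolding b_def[symmetric] hecke_weight_even_twok[OF N l12 c3 k] hecke_weight_even_twok[OF N l(1) ad(1) 1 k]
        hecke_weight_even_twok[OF N l(2) ad(2) 2 k] e j \<kappa>_def[symmetric] sg_def[symmetric]
      by simp
  next
    case False
    define g1 g2 where "g1 = gcd a1 d1" and "g2 = gcd a2 d2"
    have odds: "odd a1" "odd a2" using psi_lr_odd_twok(1)[OF N _ _ _ False] l ad 1 2 by blast+
    then have og: "odd g1" "odd g2" unfolding g1_def g2_def by (meson dvd_trans gcd_dvd1)+
    obtain t1 t2 where t: "a1 * d1 = t1^2" "a2 * d2 = t2^2" using l False unfolding L_f_def ad by blast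
    obtain x1 y1 where xy1: "a1 = g1 * x1^2" "d1 = g1 * y1^2" "coprime x1 y1"
      using square_mult_decomp[OF t(1) pos(1,2)] unfolding g1_def by blast
    obtain x2 y2 where xy2: "a2 = g2 * x2^2" "d2 = g2 * y2^2" "coprime x2 y2"
      using square_mult_decomp[OF t(2) pos(3,4)] unfolding g2_def by blast
    have gpos: "g1 > 0" "g2 > 0" using pos unfolding g1_def g2_def by auto
    have g12: "gcd (a1 * a2) (d1 * d2) = g1 * g2"
    proof -
      have "coprime x1 y2" "coprime x2 y1"
        using cop unfolding xy1(1,2) xy2(1,2) by (auto simp: coprime_commute)
      then have "coprime ((x1 * x2)^2) ((y1 * y2)^2)" using xy1(3) xy2(3) by simp
      then have "gcd ((x1 * x2)^2) ((y1 * y2)^2) = 1" by simp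
      moreover have "gcd (a1 * a2) (d1 * d2) = gcd (g1 * g2 * (x1 * x2)^2) (g1 * g2 * (y1 * y2)^2)"
        unfolding xy1(1,2) xy2(1,2) by (simp only: power_mult_distrib mult_ac)
      ultimately show ?thesis unfolding gcd_mult_distrib_nat[symmetric] by simp
    qed
    have cg: "coprime (int x2) (int g1)" "coprime (int y1) (int g2)" "coprime g1 g2"
      using cop pos unfolding xy1(1,2) xy2(1,2) by (auto simp: coprime_commute power_0_left)
    \<comment> \<open>Modulo g1, which divides d1, the entry b is a2 b1, and a2 is g2 times a
      square.\<close>
    have 4: "jacobi (- int N * int b) g1 = jacobi (- int N * int b1) g1 * jacobi (int g2) g1"
    proof -
      have "int g1 dvd int d1" unfolding g1_def by simp
      then have "int g1 dvd (- int N * int b2) * int d1" by (rule dvd_mult)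
      then have "[- int N * int b = (- int N * int b1) * int a2] (mod int g1)"
        unfolding b_def by (simp add: cong_iff_dvd_diff algebra_simps)
      from jacobi_cong[OF og(1) this]
      have "jacobi (- int N * int b) g1 = jacobi (- int N * int b1) g1 * jacobi (int a2) g1"
        by (simp only: jacobi_mult_left[of "- int N * int b1"])
      also have "jacobi (int a2) g1 = jacobi (int g2) g1"
        unfolding xy2(1) using jacobi_square[OF cg(1) gpos(1)]
        by (simp add: jacobi_mult_left power2_eq_square)
      finally show ?thesis .
    qed
    have 5: "jacobi (- int N * int b) g2 = jacobi (- int N * int b2) g2 * jacobi (int g1) g2"
    proof -
      have "int g2 dvd int a2" unfolding g2_def by simp
      then have "int g2 dvd (- int N * int b1) * int a2" by (rule dvd_mult)
      then have "[- int N * int b = (- int N * int b2) * int d1] (mod int g2)"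
        unfolding b_def by (simp add: cong_iff_dvd_diff algebra_simps)
      from jacobi_cong[OF og(2) this]
      have "jacobi (- int N * int b) g2 = jacobi (- int N * int b2) g2 * jacobi (int d1) g2"
        by (simp only: jacobi_mult_left[of "- int N * int b2"])
      also have "jacobi (int d1) g2 = jacobi (int g1) g2"
        unfolding xy1(2) using jacobi_square[OF cg(2) gpos(2)]
        by (simp add: jacobi_mult_left power2_eq_square)
      finally show ?thesis .
    qed
    \<comment> \<open>The cross terms give the reciprocity sign of g1 and g2, and the odd a_i agrees
      with g_i modulo 8, the quotient being an odd square.\<close>
    have 6: "jacobi (int g2) g1 * jacobi (int g1) g2 = recip_sign a1 a2"
    proof -
      have "jacobi (int g1) g2 = jacobi (int g2) g1 * recip_sign g1 g2"
        using og cg(3) by (intro jacobi_reciprocity)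
      moreover have "jacobi (int g2) g1 * jacobi (int g2) g1 = 1"
        using cg(3) gpos by (intro jacobi_square) (auto simp: coprime_commute)
      ultimately have "jacobi (int g2) g1 * jacobi (int g1) g2 = recip_sign g1 g2" by (simp add: mult.assoc[symmetric])
      also have "\<dots> = recip_sign a1 a2"
        unfolding recip_sign_def using odd_part_of_square_quotient_mod_8[OF odds(1) xy1(1)]
          odd_part_of_square_quotient_mod_8[OF odds(2) xy2(1)] by (metis mod_8_imp_mod_4)
      finally show ?thesis .
    qed
    have j2: "jacobi (- int N * int b) (g1 * g2) = jacobi (- int N * int b1) g1 * jacobi (- int N * int b2) g2 * recip_sign a1 a2"
      using jacobi_mult_right[OF gpos, of "- int N * int b"] unfolding 4 5 6[symmetric] by (simp only: mult_ac)
    define \<kappa> where "\<kappa> = twok N r + 2 * delta_int N r + 2"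
    obtain h where h: "\<kappa> = 2 * h + 1" unfolding \<kappa>_def 
    proof -
      have "odd (twok N r + 2 * delta_int N r + 2)" using False by simp
      then show ?thesis using that unfolding \<kappa>_def by (elim oddE)
    qed
    obtain A1 A2 where A: "int a1 = 2 * A1 + 1" "int a2 = 2 * A2 + 1" using odds by (metis even_of_nat oddE)
    \<comment> \<open>The exponential is multiplicative in a only up to the reciprocity sign, as (a1
      - 1)(a2 - 1) \<kappa>/8 is a half-integer in general.\<close>
    have e2: "ee (of_int ((int (a1 * a2) - 1) * \<kappa>) / 8) * of_int (recip_sign a1 a2) =
        ee (of_int ((int a1 - 1) * \<kappa>) / 8) * ee (of_int ((int a2 - 1) * \<kappa>) / 8)"
      unfolding recip_sign_eq_ee[OF A] ee_add[symmetric] of_nat_mult A h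
      by (rule ee_eqI[of _ _ "A1 * A2 * (h + 1)"]) (simp add: field_simps)
    have "hecke_weight N r (l1 * l2) (a1 * a2) b = of_int (jacobi (int a1) (varpi N r) * jacobi (int a2) (varpi N r) * 
        (jacobi (- int N * int b1) g1 * jacobi (- int N * int b2) g2)) *
        (ee (- of_int (int b1 * int d1 * xN N r) / 24) * ee (- of_int (int b2 * int d2 * xN N r) / 24)) *
        (ee (of_int ((int (a1 * a2) - 1) * \<kappa>) / 8) * of_int (recip_sign a1 a2))"
      unfolding hecke_weight_odd_twok[OF N l12 c3 False] g12 j2 e j \<kappa>_def[symmetric] by simp
    also have "\<dots> = hecke_weight N r l1 a1 b1 * hecke_weight N r l2 a2 b2"
      unfolding hecke_weight_odd_twok[OF N l(1) ad(1) 1 False] hecke_weight_odd_twok[OF N l(2) ad(2) 2 False]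
        e2 g1_def[symmetric] g2_def[symmetric] \<kappa>_def[symmetric] by simp
    finally show ?thesis unfolding b_def .
  qed
qed

text \<open>The reason for restricting \<open>L_f\<close> to squares when 2k is odd: the symbol of
  l, raised to the power 2k, has to disappear.\<close>

lemma jacobi_power_twok_cancel:
  assumes "l \<in> L_f N r" "coprime l m" "m > 0"
  shows "jacobi (int l) m ^ nat \<bar>twok N r\<bar> = 1"
proof (cases "even (twok N r)")
  case True
  then show ?thesis
    using sign_power_parity[OF jacobi_pm1[of "int l" m], of "nat \<bar>twok N r\<bar>" 0] assms by (simp add: even_nat_iff)
next
  case False
  then obtain t where t: "l = t^2" using assms(1) unfolding L_f_def by blast
  then have "coprime (int t) (int m)" using assms(2) by simp
  then have "jacobi (int l) m = 1" unfolding t using jacobi_square assms(3) by (simp add: jacobi_mult_left power2_eq_square)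
  then show ?thesis by simp
qed

text \<open>Invariance of the character under conjugation by \<open>diag(1,l)\<close>; the restriction on \<open>d\<close> makes
  \<open>eta_char_odd\<close> applicable and is removed in \<open>phi_invariant\<close> by translations.\<close>

lemma eta_char_conj:
  fixes a b c :: int and d :: nat
  assumes N: "N > 0" and l: "l \<in> L_f N r" and det: "a * int d - (int l * b) * (int N * c) = 1"
    and c: "c > 0" and d: "odd d" "\<not> 3 dvd int d"
  shows "eta_char N r 1 a b (int N * (int l * c)) (int d) = eta_char N r 1 a (int l * b) (int N * c) (int d)"
proof -
  define x x' K where "x = xN N r" and "x' = xN_dual N r" and "K = twok N r"
  have l0: "l > 0" using l by (auto simp: L_f_def)
  have d0: "d > 0" using d by (simp add: odd_pos)
  have cop: "coprime l d"
  proof -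
    have "coprime (int l) (int d)"
    proof (rule coprimeI)
      fix k assume "k dvd int l" "k dvd int d"
      then have "k dvd a * int d - (int l * b) * (int N * c)" by auto
      then show "is_unit k" using det by simp
    qed
    then show ?thesis by simp
  qed
  have det': "a * int d - b * (int N * (int l * c)) = 1" using det by (simp add: algebra_simps)
  have "eta_char N r 1 a b (int N * (int l * c)) (int d) =
      of_int (jacobi (int l * c) d ^ nat \<bar>K\<bar> * jacobi (int (varpi N r)) d) * ee (of_int (int d * (b * x - (int l * c) * x') + 3 * K * (int d - 1)) / 24)"
    unfolding x_def x'_def K_def using eta_char_odd[OF N det' _ d(1)] d(2) l0 c by simp
  also have "jacobi (int l * c) d ^ nat \<bar>K\<bar> = jacobi c d ^ nat \<bar>K\<bar>"
    using jacobi_power_twok_cancel[OF l cop d0] by (simp add: jacobi_mult_left power_mult_distrib K_def)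
  also have "ee (of_int (int d * (b * x - (int l * c) * x') + 3 * K * (int d - 1)) / 24) = 
      ee (of_int (int d * ((int l * b) * x - c * x') + 3 * K * (int d - 1)) / 24)"
  proof (rule ee_cong24)
    have "24 dvd (int l - 1) * x" "24 dvd (int l - 1) * x'"
      unfolding x_def x'_def using m_f_dvd_imp[OF L_f_dvd[OF l]] by auto
    then have "24 dvd (- int d * b) * ((int l - 1) * x) - (int d * c) * ((int l - 1) * x')"
      by (rule dvd_diff[OF dvd_mult dvd_mult])
    also have "\<dots> = (int d * (b * x - (int l * c) * x') + 3 * K * (int d - 1)) - (int d * ((int l * b) * x - c * x') + 3 * K * (int d - 1))"
      by (simp add: algebra_simps)
    finally show "[int d * (b * x - (int l * c) * x') + 3 * K * (int d - 1) = int d * ((int l * b) * x - c * x') + 3 * K * (int d - 1)] (mod 24)"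
      by (simp only: cong_iff_dvd_diff)
  qed
  also have "of_int (jacobi c d ^ nat \<bar>K\<bar> * jacobi (int (varpi N r)) d) * ee (of_int (int d * ((int l * b) * x - c * x') + 3 * K * (int d - 1)) / 24) =
      eta_char N r 1 a (int l * b) (int N * c) (int d)"
    unfolding x_def x'_def K_def using eta_char_odd[OF N det c d(1)] d(2) by simp
  finally show ?thesis .
qed

text \<open>In terms of \<open>\<gamma>\<^sub>1 = (e, t; Nd, s)\<close> and \<open>g = (p, dt - bs; N, as)\<close> in \<open>\<Gamma>\<^sub>0(N)\<close>, which satisfy
  \<open>\<gamma>\<^sub>1 diag(1,l) = (a, b; 0, d) g\<close>, the weight is \<open>\<chi>(g)/\<chi>(\<gamma>\<^sub>1)\<close>.\<close>

theorem eta_char_hecke_weight: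
  fixes N l a b d s :: nat and p t e :: int
  assumes N: "N > 0" and l: "l \<in> L_f N r" "l = a * d" and a: "coprime a N" "gcd (gcd a b) d = 1"
    and s: "odd s" "\<not> 3 dvd s" and e: "e = p * int a + int b * int N" and det: "int s * e - int d * t * int N = 1"
  shows "eta_char N r 1 p (int d * t - int b * int s) (int N) (int (a * s)) =
    hecke_weight N r l a b * eta_char N r 1 e t (int N * int d) (int s)"
proof -
  define x x' K where "x = xN N r" and "x' = xN_dual N r" and "K = twok N r"
  define q where "q = int d * t - int b * int s"
  have "l > 0" using l(1) by (auto simp: L_f_def)
  then have pos: "a > 0" "d > 0" using l(2) by auto
  have s0: "s > 0" using s by (simp add: odd_pos)
  have det1: "p * int (a * s) - q * (int N * 1) = 1"
    using det unfolding e q_def by (simp add: algebra_simps)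
  have det2: "e * int s - t * (int N * int d) = 1"
    using det by (simp add: algebra_simps)
  have s24: "24 dvd int s ^ 2 - 1"
  proof (rule coprime_dvd_24_square)
    have "coprime (int s) (2 ^ 3)" using s(1) by (simp only: coprime_power_right_iff) simp
    moreover have "coprime (int s) 3"
      using s(2) prime_imp_coprime[of "3::nat" s] by (simp add: coprime_commute flip: coprime_int_iff)
    ultimately have "coprime (int s) (8 * 3)" by (simp only: coprime_mult_right_iff) simp
    then show "coprime (int s) 24" by simp
  qed simp
  have l24: "24 dvd (int l - 1) * x" unfolding x_def using m_f_dvd_imp[OF L_f_dvd[OF l(1)]] by auto
  have ad24: "24 dvd (int a - int d) * x" "24 dvd (int a - int d) * x'"
    unfolding x_def x'_def using m_f_dvd_imp[OF L_f_diff_dvd[OF l]] by auto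
  \<comment> \<open>With q = d t - b s inserted, the difference is a combination of multiples of l -
    1, a - d and s^2 - 1. The first two are killed modulo 24 by x or x', the last is itself
    divisible by 24.\<close>
  have expo: "[int (a * s) * (q * x - x') - int s * (t * x - int d * x') = - (int b * int d * x)] (mod 24)"
  proof -
    have "24 dvd (int s * t) * ((int l - 1) * x)" using l24 by (rule dvd_mult)
    moreover have "24 dvd (- int b) * ((int a - int d) * x)" using ad24(1) by (rule dvd_mult)
    moreover have "24 dvd (- int a * int b * x) * (int s ^ 2 - 1)" using s24 by (rule dvd_mult)
    moreover have "24 dvd (- int s) * ((int a - int d) * x')" using ad24(2) by (rule dvd_mult)
    ultimately have "24 dvd (int s * t) * ((int l - 1) * x) + ((- int b) * ((int a - int d) * x) +
        ((- int a * int b * x) * (int s ^ 2 - 1) + (- int s) * ((int a - int d) * x')))"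
      by (intro dvd_add)
    also have "\<dots> = (int (a * s) * (q * x - x') - int s * (t * x - int d * x')) - (- (int b * int d * x))"
      unfolding q_def l(2) by (simp add: power2_eq_square algebra_simps)
    finally show ?thesis by (simp only: cong_iff_dvd_diff)
  qed
  have three: "\<not> 3 dvd int (a * s) \<or> 3 dvd xN N r \<and> 3 dvd xN_dual N r"
  proof (cases "3 dvd int (a * s)")
    case True
    then have "3 dvd a * s" by presburger
    then have "3 dvd a" using s(2) prime_dvd_mult_iff[of "3::nat" a s] by simp
    then have "3 dvd int l" unfolding l(2) by (metis dvd_mult2 int_dvd_int_iff of_nat_numeral)
    then show ?thesis using L_f_three[OF l(1)] by simp
  qed simp
  have three': "\<not> 3 dvd int s \<or> 3 dvd xN N r \<and> 3 dvd xN_dual N r"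
    using s(2) by (metis int_dvd_int_iff of_nat_numeral)
  have V: "varpi N r > 0" using varpi_pos N by blast
  show ?thesis
  proof (cases "odd a")
    case oa: True
    have las: "odd (a * s)" using oa s by simp
    have L: "eta_char N r 1 p q (int N) (int (a * s)) = of_int (jacobi (int (varpi N r)) a * jacobi (int (varpi N r)) s) *
        ee (of_int (int (a * s) * (q * x - x') + 3 * K * (int (a * s) - 1)) / 24)"
      using eta_char_odd[OF N det1 _ las three] pos s0 unfolding x_def x'_def K_def by (simp add: jacobi_mult_right)
    have R: "eta_char N r 1 e t (int N * int d) (int s) = of_int (jacobi (int d) s ^ nat \<bar>K\<bar> * jacobi (int (varpi N r)) s) *
        ee (of_int (int s * (t * x - int d * x') + 3 * K * (int s - 1)) / 24)"
      using eta_char_odd[OF N det2 _ s(1) three'] pos unfolding x_def x'_def K_def by simp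
    have E: "ee (of_int (int (a * s) * (q * x - x') + 3 * K * (int (a * s) - 1)) / 24) =
      ee (of_int (int s * (t * x - int d * x') + 3 * K * (int s - 1)) / 24) *
      (ee (- of_int (int b * int d * x) / 24) * ee (of_int (K * int s * (int a - 1)) / 8))"
    proof -
      have "[(int (a * s) * (q * x - x') - int s * (t * x - int d * x')) + (int s * (t * x - int d * x') + 3 * K * (int (a * s) - 1))
         = - (int b * int d * x) + (int s * (t * x - int d * x') + 3 * K * (int (a * s) - 1))] (mod 24)"
        by (intro cong_add expo cong_refl)
      then have "ee (of_int (int (a * s) * (q * x - x') + 3 * K * (int (a * s) - 1)) / 24) =
          ee (of_int (- (int b * int d * x) + (int s * (t * x - int d * x') + 3 * K * (int (a * s) - 1))) / 24)"
        by (intro ee_cong24) simp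
      also have "\<dots> = ee (of_int (int s * (t * x - int d * x') + 3 * K * (int s - 1)) / 24 +
         (- of_int (int b * int d * x) / 24 + of_int (K * int s * (int a - 1)) / 8))"
        by (intro arg_cong[where f = ee]) (simp add: field_simps)
      finally show ?thesis unfolding ee_add .
    qed
    obtain A where A: "int a = 2 * A + 1" using oa by (metis even_of_nat oddE)
    obtain \<sigma> where \<sigma>: "int s = 2 * \<sigma> + 1" using s by (metis even_of_nat oddE)
    define \<delta> where "\<delta> = delta_int N r"
    have swap: "of_int (jacobi (int (varpi N r)) a) = of_int (jacobi (int a) (varpi N r)) * ee (of_int (\<delta> * A) / 2)"
      using jacobi_varpi_swap[OF N oa a(1), of r] even_half_iff_mod_4[OF A] unfolding ee_int_half \<delta>_def
      by (auto simp: delta_int_def)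
    \<comment> \<open>What remains after the factors common to both characters are removed.\<close>
    have main: "of_int (jacobi (int (varpi N r)) a) * (ee (- of_int (int b * int d * x) / 24) * ee (of_int (K * int s * (int a - 1)) / 8)) =
      hecke_weight N r l a b * of_int (jacobi (int d) s ^ nat \<bar>K\<bar>)"
    proof (cases "even K")
      case True
      then obtain k where k: "K = 2 * k" by blast
      have "jacobi (int d) s ^ nat \<bar>K\<bar> = 1"
      proof -
        have "coprime (int d) (int s)"
        proof (rule coprimeI)
          fix c assume "c dvd int d" "c dvd int s"
          then have "c dvd int s * e - int d * t * int N" by auto
          then show "is_unit c" using det by simp
        qed
        from sign_power_parity[OF jacobi_pm1[OF this s0], of "nat \<bar>K\<bar>" 0] True
        show ?thesis by (simp add: even_nat_iff)
      qed
      moreover have "ee (of_int (K * int s * (int a - 1)) / 8) * ee (of_int (\<delta> * A) / 2) = ee (of_int ((k + \<delta>) * A) / 2)"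
        unfolding ee_add[symmetric] A k \<sigma> by (rule ee_eqI[of _ _ "k * \<sigma> * A"]) (simp add: field_simps)
      moreover have "(int a - 1) div 2 = A" using A by simp
      ultimately show ?thesis
        using oa unfolding hecke_weight_even_twok[OF N l a k[unfolded K_def]] swap x_def \<delta>_def by (simp add: mult_ac)
    next
      case False
      define g where "g = gcd a d"
      obtain w where w: "a * d = w^2" using l(1) False unfolding L_f_def K_def l(2)[symmetric] by blast
      obtain u v where uv: "a = g * u^2" "d = g * v^2" "coprime u v"
        using square_mult_decomp[OF w pos] unfolding g_def by blast
      have g: "g > 0" "odd g" using pos oa unfolding g_def by (auto dest: dvd_trans)
      have cds: "coprime (int d) (int s)"
      proof (rule coprimeI)
        fix c assume "c dvd int d" "c dvd int s"
        then have "c dvd int s * e - int d * t * int N" by auto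
        then show "is_unit c" using det by simp
      qed
      then have cgs: "coprime (int v) (int s)" "coprime g s" using pos unfolding uv(2) by (auto simp: power_0_left)
      have "jacobi (int d) s ^ nat \<bar>K\<bar> = jacobi (int d) s"
        using sign_power_parity[OF jacobi_pm1[OF cds s0], of "nat \<bar>K\<bar>" 1] False by (simp add: even_nat_iff)
      also have "\<dots> = jacobi (int g) s"
        unfolding uv(2) using jacobi_square[OF cgs(1) s0] by (simp add: jacobi_mult_left power2_eq_square)
      also have "\<dots> = jacobi (int s) g * recip_sign g s"
        using g s cgs by (intro jacobi_reciprocity) auto
      \<comment> \<open>The determinant relation reads s N b = 1 modulo g, since g divides a and d.
        This is the origin of the symbol of -N b modulo gcd(a, d) in c_l.\<close>
      also have "jacobi (int s) g = jacobi (-1) g * jacobi (- int N * int b) g"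
      proof -
        have "int g dvd int a" "int g dvd int d" unfolding g_def by auto
        then have "int g dvd (- int s * p) * int a + (t * int N) * int d" by (intro dvd_add dvd_mult)
        also have "\<dots> = int s * (int N * int b) - 1" using det unfolding e by (simp add: algebra_simps)
        finally have "[int s * (int N * int b) = 1] (mod int g)" by (simp add: cong_iff_dvd_diff)
        from jacobi_cong[OF g(2) this] have 1: "jacobi (int s) g * jacobi (int N * int b) g = 1"
          by (simp only: jacobi_mult_left jacobi_1_left)
        have 2: "jacobi (int N * int b) g = jacobi (-1) g * jacobi (- int N * int b) g"
          using jacobi_mult_left[of "-1" "- int N * int b" g] by simp
        have "jacobi (int s) g = jacobi (int s) g * (jacobi (int s) g * jacobi (int N * int b) g)" using 1 by simp
        also have "\<dots> = jacobi (int N * int b) g"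
          using jacobi_square[of "int s" g] cgs(2) g by (simp add: coprime_commute mult.assoc[symmetric])
        finally show ?thesis unfolding 2 .
      qed
      finally have jd: "jacobi (int d) s ^ nat \<bar>K\<bar> = jacobi (-1) g * jacobi (- int N * int b) g * recip_sign g s" .
      have ga: "a mod 4 = g mod 4"
        using odd_part_of_square_quotient_mod_8[OF oa uv(1)] by (rule mod_8_imp_mod_4)
      have rs: "of_int (recip_sign g s) = ee (of_int (A * \<sigma>) / 2)"
        using recip_sign_eq_ee[OF A \<sigma>] ga by (simp add: recip_sign_def)
      have j1: "of_int (jacobi (-1) g) = ee (of_int A / 2)"
      proof -
        have "g mod 4 = 1 \<or> g mod 4 = 3" using g(2) by (rule odd_mod_4)
        then show ?thesis using even_half_iff_mod_4[OF A] ga unfolding ee_int_half jacobi_minus_1[OF g(2)] by auto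
      qed
      have "ee (of_int (\<delta> * A) / 2) * ee (of_int (K * int s * (int a - 1)) / 8) =
          ee (of_int ((int a - 1) * (K + 2 * \<delta> + 2)) / 8) * (ee (of_int A / 2) * ee (of_int (A * \<sigma>) / 2))"
      proof -
        obtain h where h: "K = 2 * h + 1" using False by (elim oddE)
        show ?thesis unfolding ee_add[symmetric] A \<sigma> h
          by (rule ee_eqI[of _ _ "A * \<sigma> * h - A"]) (simp add: field_simps)
      qed
      note exps = this
      define J where "J = jacobi (- int N * int b) g"
      have sq: "of_int (J * J) = (1 :: complex)"
        using jacobi_square[OF coprime_gcd_entries[OF a]] g(1) unfolding J_def g_def by simp
      have "hecke_weight N r l a b * of_int (jacobi (int d) s ^ nat \<bar>K\<bar>) =
          of_int (jacobi (int a) (varpi N r)) * ee (- of_int (int b * int d * x) / 24) *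
          (ee (of_int ((int a - 1) * (K + 2 * \<delta> + 2)) / 8) * (of_int (jacobi (-1) g) * of_int (recip_sign g s))) * of_int (J * J)"
        unfolding hecke_weight_odd_twok[OF N l a False[unfolded K_def]] jd g_def[symmetric] x_def[symmetric]
          K_def[symmetric] \<delta>_def[symmetric] J_def[symmetric] by (simp only: of_int_mult mult_ac)
      also have "\<dots> = of_int (jacobi (int (varpi N r)) a) *
          (ee (- of_int (int b * int d * x) / 24) * ee (of_int (K * int s * (int a - 1)) / 8))"
        unfolding sq j1 rs exps[symmetric] swap by (simp only: mult_ac mult_1_left mult_1_right)
      finally show ?thesis ..
    qed
    show ?thesis unfolding q_def[symmetric] L R E using main by (simp add: mult_ac)
  next
    case False
    \<comment> \<open>The lower right entry a s is even here. But then N is odd and l even, so the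
      2-part of the character is trivial and \<open>eta_char_trivial_2_part\<close> covers both
      matrices.\<close>
    have oN: "odd N" using coprime_common_divisor[OF a(1), of 2] False by auto
    have el: "even l" using l(2) False by simp
    note eight = L_f_even[OF l(1) el]
    obtain k where k: "twok N r = 2 * k" using L_f_even_odd_level(1)[OF N oN l(1) el] by blast
    have L: "eta_char N r 1 p q (int N) (int (a * s)) = of_int (jacobi (int a) (varpi N r) * jacobi (int s) (varpi N r)) *
        ee (of_int (int (a * s) * (q * x - x')) / 24)"
      using eta_char_trivial_2_part[OF N oN det1 _ _ eight three] pos s0 unfolding x_def x'_def by (simp add: jacobi_mult_left)
    have R: "eta_char N r 1 e t (int N * int d) (int s) = of_int (jacobi (int s) (varpi N r)) *
        ee (of_int (int s * (t * x - int d * x')) / 24)"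
      using eta_char_trivial_2_part[OF N oN det2 _ s0 eight three'] pos unfolding x_def x'_def by simp
    have E: "ee (of_int (int (a * s) * (q * x - x')) / 24) =
      ee (of_int (int s * (t * x - int d * x')) / 24) * ee (- of_int (int b * int d * x) / 24)"
    proof -
      have "[(int (a * s) * (q * x - x') - int s * (t * x - int d * x')) + int s * (t * x - int d * x')
         = - (int b * int d * x) + int s * (t * x - int d * x')] (mod 24)"
        by (intro cong_add expo cong_refl)
      then have "ee (of_int (int (a * s) * (q * x - x')) / 24) = ee (of_int (- (int b * int d * x) + int s * (t * x - int d * x')) / 24)"
        by (intro ee_cong24) simp
      also have "\<dots> = ee (of_int (int s * (t * x - int d * x')) / 24 + - of_int (int b * int d * x) / 24)"
        by (intro arg_cong[where f = ee]) (simp add: field_simps)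
      finally show ?thesis unfolding ee_add .
    qed
    show ?thesis unfolding q_def[symmetric] L R E hecke_weight_even_twok[OF N l a k] using False by (simp add: x_def mult_ac)
  qed
qed

section \<open>Coset representatives\<close>

type_synonym mat2 = "int \<times> int \<times> int \<times> int"

definition mm :: "mat2 \<Rightarrow> mat2 \<Rightarrow> mat2" where
  "mm = (\<lambda>(a, b, c, d) (a', b', c', d'). (a * a' + b * c', a * b' + b * d', c * a' + d * c', c * b' + d * d'))"

definition mdet :: "mat2 \<Rightarrow> int" where
  "mdet = (\<lambda>(a, b, c, d). a * d - b * c)"

text \<open>The adjugate, which is the inverse for determinant 1.\<close>

definition minv :: "mat2 \<Rightarrow> mat2" where
  "minv = (\<lambda>(a, b, c, d). (d, - b, - c, a))"

definition act :: "mat2 \<Rightarrow> complex \<Rightarrow> complex" where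
  "act = (\<lambda>(a, b, c, d). moeb a b c d)"

definition Gam :: "nat \<Rightarrow> mat2 set" where
  "Gam N = {(a, b, c, d). in_Gamma0 N a b c d}"

lemma mm_simp [simp]: "mm (a, b, c, d) (a', b', c', d') = (a * a' + b * c', a * b' + b * d', c * a' + d * c', c * b' + d * d')"
  by (simp add: mm_def)

lemma mdet_simp [simp]: "mdet (a, b, c, d) = a * d - b * c"
  by (simp add: mdet_def)

lemma minv_simp [simp]: "minv (a, b, c, d) = (d, - b, - c, a)"
  by (simp add: minv_def)

lemma act_simp [simp]: "act (a, b, c, d) = moeb a b c d"
  by (simp add: act_def)

lemma Gam_simp [simp]: "(a, b, c, d) \<in> Gam N \<longleftrightarrow> a * d - b * c = 1 \<and> int N dvd c"
  by (simp add: Gam_def in_Gamma0_def)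

lemma mm_assoc: "mm (mm A B) C = mm A (mm B C)"
  by (cases A; cases B; cases C) (simp add: algebra_simps)

lemma mdet_mm: "mdet (mm A B) = mdet A * mdet B"
  by (cases A; cases B) (simp add: algebra_simps)

lemma mm_1 [simp]: "mm (1, 0, 0, 1) A = A" "mm A (1, 0, 0, 1) = A"
  by (cases A; simp)+

lemma mm_minv: "mdet A = 1 \<Longrightarrow> mm A (minv A) = (1, 0, 0, 1)" "mdet A = 1 \<Longrightarrow> mm (minv A) A = (1, 0, 0, 1)"
  by (cases A; simp add: algebra_simps)+

lemma mdet_minv [simp]: "mdet (minv A) = mdet A"
  by (cases A) (simp add: algebra_simps)

lemma Gam_mdet: "A \<in> Gam N \<Longrightarrow> mdet A = 1"
  by (cases A) simp

lemma Gam_mm: "A \<in> Gam N \<Longrightarrow> B \<in> Gam N \<Longrightarrow> mm A B \<in> Gam N"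
proof -
  assume A: "A \<in> Gam N" "B \<in> Gam N"
  then have "mdet (mm A B) = 1" by (simp add: mdet_mm Gam_mdet)
  with A show ?thesis by (cases A; cases B) auto
qed

lemma Gam_minv: "A \<in> Gam N \<Longrightarrow> minv A \<in> Gam N"
  by (cases A) (auto simp: algebra_simps)

lemma Im_moeb:
  assumes "Im \<tau> > 0" "a * d - b * c > 0"
  shows "of_int c * \<tau> + of_int d \<noteq> 0" 
    and "Im (moeb a b c d \<tau>) = of_int (a * d - b * c) * Im \<tau> / (cmod (of_int c * \<tau> + of_int d))^2"
    and "Im (moeb a b c d \<tau>) > 0"
proof -
  show nz: "of_int c * \<tau> + of_int d \<noteq> 0"
  proof
    assume z: "of_int c * \<tau> + of_int d = 0"
    then have "Im (of_int c * \<tau> + of_int d) = 0" by simp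
    then have "c = 0" using assms by simp
    moreover from this z have "d = 0" by simp
    ultimately show False using assms by simp
  qed
  have "Im (moeb a b c d \<tau>) = Im ((of_int a * \<tau> + of_int b) * cnj (of_int c * \<tau> + of_int d)) / (cmod (of_int c * \<tau> + of_int d))^2"
    unfolding moeb_def by (subst complex_div_cnj) (simp add: Im_divide_of_real)
  also have "Im ((of_int a * \<tau> + of_int b) * cnj (of_int c * \<tau> + of_int d)) = of_int (a * d - b * c) * Im \<tau>"
    by (simp add: algebra_simps)
  finally show eq: "Im (moeb a b c d \<tau>) = of_int (a * d - b * c) * Im \<tau> / (cmod (of_int c * \<tau> + of_int d))^2" .
  have "real_of_int (a * d - b * c) > 0" using assms(2) by (simp only: of_int_0_less_iff)
  then show "Im (moeb a b c d \<tau>) > 0" unfolding eq using assms(1) nz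
    by (metis divide_pos_pos mult_pos_pos zero_less_norm_iff zero_less_power)
qed

lemma Im_act: "Im \<tau> > 0 \<Longrightarrow> mdet A > 0 \<Longrightarrow> Im (act A \<tau>) > 0"
  by (cases A) (simp add: Im_moeb(3))

lemma act_mm:
  assumes "Im \<tau> > 0" "mdet A > 0" "mdet B > 0"
  shows "act (mm A B) \<tau> = act A (act B \<tau>)"
proof -
  obtain a b c d where A: "A = (a, b, c, d)" by (cases A)
  obtain a' b' c' d' where B: "B = (a', b', c', d')" by (cases B)
  have 1: "of_int c' * \<tau> + of_int d' \<noteq> 0" using Im_moeb(1) assms B by auto
  have 2: "of_int c * moeb a' b' c' d' \<tau> + of_int d \<noteq> 0"
    using Im_moeb(1)[of "moeb a' b' c' d' \<tau>" a d b c] Im_moeb(3)[of \<tau> a' d' b' c'] assms A B by auto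
  have eq: "of_int c * moeb a' b' c' d' \<tau> + of_int d =
      (of_int (c * a' + d * c') * \<tau> + of_int (c * b' + d * d')) / (of_int c' * \<tau> + of_int d')"
    "of_int a * moeb a' b' c' d' \<tau> + of_int b =
      (of_int (a * a' + b * c') * \<tau> + of_int (a * b' + b * d')) / (of_int c' * \<tau> + of_int d')"
    unfolding moeb_def using 1 by (simp_all add: field_simps)
  show ?thesis unfolding A B using 1 by (simp add: moeb_def[of a b c d] eq) (simp add: moeb_def)
qed

lemma act_1 [simp]: "act (1, 0, 0, 1) = (\<lambda>\<tau>. \<tau>)"
  by (auto simp: moeb_def)

text \<open>Representatives \<open>(a, b; 0, d)\<close> of the cosets \<open>\<Gamma>\<^sub>0(N)\<alpha>\<close> contained in \<open>\<Gamma>\<^sub>0(N) diag(1,l) \<Gamma>\<^sub>0(N)\<close>.\<close>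

definition hecke_reps :: "nat \<Rightarrow> nat \<Rightarrow> (nat \<times> nat) set" where
  "hecke_reps N l = {(a, b). a dvd l \<and> coprime a N \<and> b < l div a \<and> gcd (gcd a b) (l div a) = 1}"

definition rep_mat :: "nat \<Rightarrow> nat \<times> nat \<Rightarrow> mat2" where
  "rep_mat l = (\<lambda>(a, b). (int a, int b, 0, int (l div a)))"

lemma finite_hecke_reps: "l > 0 \<Longrightarrow> finite (hecke_reps N l)"
proof (rule finite_subset)
  show "hecke_reps N l \<subseteq> {..l} \<times> {..l}" if "l > 0"
    using that by (auto simp: hecke_reps_def dest: dvd_imp_le intro: order.trans[OF less_imp_le div_le_dividend])
qed auto

lemma rep_mat_det:
  assumes "\<alpha> \<in> hecke_reps N l" "l > 0"
  shows "mdet (rep_mat l \<alpha>) = int l"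
  using assms by (auto simp: hecke_reps_def rep_mat_def simp flip: of_nat_mult)

lemma dvd_mm_entries:
  assumes "k dvd a" "k dvd b" "k dvd c" "k dvd (d::int)"
  shows "mm (a, b, c, d) M = (a', b', c', d') \<Longrightarrow> k dvd a' \<and> k dvd b' \<and> k dvd c' \<and> k dvd d'"
    and "mm M (a, b, c, d) = (a', b', c', d') \<Longrightarrow> k dvd a' \<and> k dvd b' \<and> k dvd c' \<and> k dvd d'"
  using assms by (cases M; auto)+

text \<open>Hermite normal form inside \<Gamma>_0(N): the first column of the product is u times a
  primitive column, which is completed to a matrix of determinant 1, and a translation then reduces
  the upper right entry. That the completion lies in \<Gamma>_0(N) needs u prime to N.\<close>

lemma hecke_reps_right_mult:
  assumes \<alpha>: "\<alpha> \<in> hecke_reps N l" and l: "l > 0" and \<gamma>: "\<gamma> \<in> Gam N"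
  shows "\<exists>\<alpha>'\<in>hecke_reps N l. \<exists>\<gamma>'\<in>Gam N. mm (rep_mat l \<alpha>) \<gamma> = mm \<gamma>' (rep_mat l \<alpha>')"
proof -
  obtain a b where ab: "\<alpha> = (a, b)" by (cases \<alpha>)
  define d where "d = l div a"
  have a: "a dvd l" "coprime a N" "b < d" "gcd (gcd a b) d = 1" using \<alpha> unfolding ab hecke_reps_def d_def by auto
  have ad: "a * d = l" using a(1) by (simp add: d_def)
  then have pos: "a > 0" "d > 0" using l by auto
  obtain A B C D where \<gamma>e: "\<gamma> = (A, B, C, D)" by (cases \<gamma>)
  have det: "A * D - B * C = 1" and NC: "int N dvd C" using \<gamma> unfolding \<gamma>e by auto
  define X where "X = int a * A + int b * C"
  define Y where "Y = int d * C"
  define Z where "Z = int a * B + int b * D"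
  define W where "W = int d * D"
  have prod: "mm (rep_mat l \<alpha>) \<gamma> = (X, Z, Y, W)"
    unfolding ab rep_mat_def \<gamma>e X_def Y_def Z_def W_def d_def by simp
  have detXY: "X * W - Z * Y = int l"
    using arg_cong[OF prod, of mdet] rep_mat_det[OF \<alpha> l] det unfolding mdet_mm \<gamma>e by simp
  define u where "u = gcd X Y"
  have "X \<noteq> 0 \<or> Y \<noteq> 0" using detXY l by auto
  then have u: "u > 0" unfolding u_def by simp
  obtain x y where xy: "X = u * x" "Y = u * y" "coprime x y"
    using gcd_coprime_exists[of X Y] u unfolding u_def by (auto simp: mult.commute)
  obtain w v where bez: "w * x + v * y = 1" using xy(3) bezout_int[of x y] by auto
  \<comment> \<open>A common divisor of u and N divides C and a A; being prime to a it divides A,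
    against A D - B C = 1.\<close>
  have copu: "coprime u (int N)"
  proof (rule coprimeI)
    fix k assume k: "k dvd u" "k dvd int N"
    then have kC: "k dvd C" and kX: "k dvd X" using NC xy(1) by (auto intro: dvd_trans)
    then have "k dvd X - int b * C" by (intro dvd_diff dvd_mult)
    then have "k dvd int a * A" unfolding X_def by simp
    moreover have "coprime k (int a)"
    proof -
      have "coprime (int N) (int a)" using a(2) by (simp add: coprime_commute)
      then show ?thesis using k(2) by (meson coprime_divisors dvd_refl)
    qed
    ultimately have "k dvd A" by (simp add: coprime_dvd_mult_right_iff)
    then have "k dvd A * D - B * C" using kC by auto
    then show "is_unit k" using det by simp
  qed
  have Ny: "int N dvd y"
  proof -
    have "int N dvd Y" unfolding Y_def using NC by simp
    then show ?thesis unfolding xy(2) using copu by (simp add: coprime_dvd_mult_right_iff coprime_commute)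
  qed
  define \<gamma>1 where "\<gamma>1 = (x, - v, y, w)"
  have \<gamma>1: "\<gamma>1 \<in> Gam N" using bez Ny unfolding \<gamma>1_def by (simp add: algebra_simps)
  define d' where "d' = x * W - y * Z"
  define b'' where "b'' = w * Z + v * W"
  have ud: "u * d' = int l" using detXY unfolding d'_def xy by (simp add: algebra_simps)
  then have d': "d' > 0" using u l by (metis of_nat_0_less_iff zero_less_mult_pos)
  have prod1: "(X, Z, Y, W) = mm \<gamma>1 (u, b'', 0, d')"
  proof -
    have "x * b'' - v * d' = Z" "y * b'' + w * d' = W"
    proof -
      have "x * b'' - v * d' = (w * x + v * y) * Z" "y * b'' + w * d' = (w * x + v * y) * W"
        unfolding b''_def d'_def by (simp_all add: algebra_simps)
      then show "x * b'' - v * d' = Z" "y * b'' + w * d' = W" using bez by simp_all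
    qed
    then show ?thesis unfolding \<gamma>1_def using xy by (simp add: mult.commute)
  qed
  define m where "m = b'' div d'"
  define b' where "b' = b'' mod d'"
  have b': "0 \<le> b'" "b' < d'" using d' unfolding b'_def by auto
  define \<gamma>' where "\<gamma>' = mm \<gamma>1 (1, m, 0, 1)"
  have \<gamma>': "\<gamma>' \<in> Gam N" unfolding \<gamma>'_def using \<gamma>1 by (intro Gam_mm) auto
  have "mm (1, m, 0, 1) (u, b', 0, d') = (u, b'', 0, d')" by (simp add: m_def b'_def)
  then have prod2: "(X, Z, Y, W) = mm \<gamma>' (u, b', 0, d')" unfolding prod1 \<gamma>'_def mm_assoc by simp
  \<comment> \<open>A common divisor of the new entries divides all entries of the product, hence,
    after multiplication by the inverse of \<gamma>, those of the primitive representative.\<close>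
  have prim: "is_unit k" if k: "k dvd u" "k dvd b'" "k dvd d'" for k
  proof -
    have kX: "k dvd X \<and> k dvd Z \<and> k dvd Y \<and> k dvd W"
      using dvd_mm_entries(2)[OF k(1,2) dvd_0_right k(3) prod2[symmetric]] .
    have "mm (X, Z, Y, W) (minv \<gamma>) = rep_mat l \<alpha>"
      unfolding prod[symmetric] mm_assoc by (simp add: mm_minv(1)[OF Gam_mdet[OF \<gamma>]])
    also have "\<dots> = (int a, int b, 0, int d)" unfolding ab rep_mat_def d_def by simp
    finally have "k dvd int a \<and> k dvd int b \<and> k dvd 0 \<and> k dvd int d"
      using dvd_mm_entries(1)[of k X Z Y W "minv \<gamma>"] kX by blast
    then have "k dvd gcd (gcd (int a) (int b)) (int d)" by (intro gcd_greatest) auto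
    also have "gcd (gcd (int a) (int b)) (int d) = 1" using a(4) by (simp only: gcd_int_int_eq of_nat_1)
    finally show ?thesis .
  qed
  define \<alpha>' where "\<alpha>' = (nat u, nat b')"
  have ldu: "int (l div nat u) = d'"
  proof -
    have "int l = int (nat u) * d'" using ud u by simp
    then have "int l div int (nat u) = d'" using u by simp
    then show ?thesis by (simp add: zdiv_int)
  qed
  have "rep_mat l \<alpha>' = (u, b', 0, d')" unfolding \<alpha>'_def rep_mat_def using u b' ldu by simp
  moreover have "\<alpha>' \<in> hecke_reps N l"
  proof -
    have "nat u dvd l" using ud u by (metis dvd_triv_left int_dvd_int_iff int_nat_eq less_imp_le)
    moreover have "coprime (nat u) N" using copu u by (simp flip: coprime_int_iff)
    moreover have "nat b' < l div nat u" using b' ldu by linarith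
    moreover have "gcd (gcd (nat u) (nat b')) (l div nat u) = 1"
    proof -
      have "int (gcd (gcd (nat u) (nat b')) (l div nat u)) = gcd (gcd u b') d'"
        using u b' ldu by (simp flip: gcd_int_int_eq)
      moreover have "is_unit (gcd (gcd u b') d')" by (rule prim) (auto intro: dvd_trans)
      ultimately show ?thesis by simp
    qed
    ultimately show ?thesis unfolding \<alpha>'_def hecke_reps_def by simp
  qed
  ultimately show ?thesis using \<gamma>' prod prod2 by metis
qed

lemma hecke_reps_disjoint:
  assumes \<alpha>: "\<alpha>1 \<in> hecke_reps N l" "\<alpha>2 \<in> hecke_reps N l" and l: "l > 0" and \<kappa>: "\<kappa> \<in> Gam N"
    and eq: "rep_mat l \<alpha>1 = mm \<kappa> (rep_mat l \<alpha>2)"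
  shows "\<alpha>1 = \<alpha>2"
proof -
  obtain a1 b1 a2 b2 where ab: "\<alpha>1 = (a1, b1)" "\<alpha>2 = (a2, b2)" by (cases \<alpha>1; cases \<alpha>2)
  obtain k1 k2 k3 k4 where k: "\<kappa> = (k1, k2, k3, k4)" by (cases \<kappa>)
  have p: "a1 dvd l" "a2 dvd l" "b1 < l div a1" "b2 < l div a2" using \<alpha> unfolding ab hecke_reps_def by auto
  then have pos: "a1 > 0" "a2 > 0" using l by (auto intro!: Nat.gr0I)
  have e: "int a1 = k1 * int a2" "0 = k3 * int a2" "int b1 = k1 * int b2 + k2 * int (l div a2)"
    using eq unfolding ab k rep_mat_def by auto
  have k3: "k3 = 0" using e(2) pos by simp
  then have "k1 * k4 = 1" using \<kappa> unfolding k by simp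
  moreover have "k1 > 0" using e(1) pos by (metis of_nat_0_less_iff zero_less_mult_pos2)
  ultimately have k1: "k1 = 1" by (metis zmult_eq_1_iff less_minus_one_simps(1) not_less_iff_gr_or_eq)
  then have a: "a1 = a2" using e(1) by simp
  have "int b1 mod int (l div a2) = int b2 mod int (l div a2)" using e(3) k1 by simp
  then have "b1 = b2" using p unfolding a by (simp flip: zmod_int)
  then show ?thesis using a ab by simp
qed

text \<open>Take for p the product of the primes of M that do not divide B. A prime of M then
  divides exactly one of p A and B, hence not their sum.\<close>

lemma ex_coprime_shift:
  fixes A B M :: int
  assumes "M \<noteq> 0" "\<And>p. prime p \<Longrightarrow> p dvd M \<Longrightarrow> p dvd A \<Longrightarrow> \<not> p dvd B"
  shows "\<exists>p. coprime (p * A + B) M"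
proof -
  define p where "p = (\<Prod>q\<in>{q\<in>prime_factors M. \<not> q dvd B}. q)"
  have "coprime (p * A + B) M"
  proof (rule ccontr)
    assume "\<not> coprime (p * A + B) M"
    then have "\<not> is_unit (gcd (p * A + B) M)" by (auto simp: is_unit_gcd)
    then obtain q where "prime q" "q dvd gcd (p * A + B) M"
      using prime_divisor_exists[of "gcd (p * A + B) M"] assms(1) by auto
    then have q: "prime q" "q dvd p * A + B" "q dvd M" by (auto intro: dvd_trans)
    show False
    proof (cases "q dvd B")
      case True
      then have "q dvd p * A" using q(2) by (simp add: dvd_add_left_iff)
      then have "q dvd p" using assms(2)[OF q(1,3)] True q(1) prime_dvd_mult_iff by blast
      then obtain q' where "q' \<in> prime_factors M" "\<not> q' dvd B" "q dvd q'"
        unfolding p_def using q(1) by (subst (asm) prime_dvd_prod_iff) auto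
      then have "q = q'" using q(1) primes_dvd_imp_eq by blast
      then show False using \<open>\<not> q' dvd B\<close> True by simp
    next
      case False
      then have "q dvd p" unfolding p_def using q assms(1)
        by (intro dvd_prodI) (auto simp: in_prime_factors_iff)
      then have "q dvd p * A" by simp
      then have "q dvd B" using q(2) by (simp add: dvd_add_right_iff)
      then show False using False by simp
    qed
  qed
  then show ?thesis ..
qed

lemma ex_coprime_shift_pos:
  fixes A B M :: int
  assumes "M > 0" "A > 0" "\<And>p. prime p \<Longrightarrow> p dvd M \<Longrightarrow> p dvd A \<Longrightarrow> \<not> p dvd B"
  shows "\<exists>p. coprime (p * A + B) M \<and> p * A + B > 0"
proof -
  obtain p where p: "coprime (p * A + B) M" using ex_coprime_shift[of M A B] assms by auto
  define S where "S = \<bar>p\<bar> + \<bar>B\<bar> + 1"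
  \<comment> \<open>A multiple of M does not affect coprimality; S is large enough that p' exceeds
    the absolute value of B.\<close>
  define p' where "p' = p + M * S"
  have "p' * A + B = (p * A + B) + M * (S * A)" unfolding p'_def by (simp add: algebra_simps)
  moreover have "coprime ((p * A + B) + M * (S * A)) M"
  proof (rule coprimeI)
    fix k assume k: "k dvd p * A + B + M * (S * A)" "k dvd M"
    then have "k dvd p * A + B" by (simp add: dvd_add_left_iff)
    then show "is_unit k" using p k(2) coprime_common_divisor by blast
  qed
  moreover have "p' * A + B > 0"
  proof -
    have "M * S \<ge> 1 * S" using assms by (intro mult_right_mono) (auto simp: S_def)
    then have "p' \<ge> p + S" unfolding p'_def by simp
    then have "p' \<ge> \<bar>B\<bar> + 1" unfolding S_def by linarith
    then have "p' * A \<ge> (\<bar>B\<bar> + 1) * 1" using assms by (intro mult_mono) auto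
    then have "p' * A \<ge> \<bar>B\<bar> + 1" by simp
    then show ?thesis by linarith
  qed
  ultimately show ?thesis by metis
qed

section \<open>Expansions of eta quotients\<close>

definition euler :: "complex \<Rightarrow> complex" where
  "euler q = prodinf (\<lambda>j. 1 - q ^ Suc j)"

lemma convergent_prod_euler:
  assumes "norm (q::complex) < 1"
  shows "convergent_prod (\<lambda>j. 1 - q ^ Suc j)"
proof -
  have "summable (\<lambda>j. norm q ^ j)" using assms by (simp add: summable_geometric)
  then have "summable (\<lambda>j. norm q ^ Suc j)" by (subst summable_Suc_iff)
  then have "summable (\<lambda>j. norm ((1 - q ^ Suc j) - 1))" by (simp add: norm_power norm_mult)
  then show ?thesis by (intro abs_convergent_prod_imp_convergent_prod summable_imp_abs_convergent_prod)
qed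

lemma euler_factor_nonzero:
  assumes "norm (q::complex) < 1"
  shows "1 - q ^ Suc j \<noteq> 0"
proof
  assume "1 - q ^ Suc j = 0"
  then have "norm (q ^ Suc j) = 1" by simp
  moreover have "norm (q ^ Suc j) < 1" using assms by (simp only: norm_power power_less_one_iff norm_ge_zero) simp
  ultimately show False by simp
qed

lemma euler_nonzero: "norm q < 1 \<Longrightarrow> euler q \<noteq> 0"
  unfolding euler_def using convergent_prod_euler euler_factor_nonzero by (intro prodinf_nonzero) auto

lemma uniform_limit_euler:
  assumes "\<rho> < 1"
  shows "uniform_limit (cball 0 \<rho>) (\<lambda>M q. \<Prod>j<M. 1 - q ^ Suc j) euler sequentially"
proof (cases "\<rho> \<ge> 0")
  case \<rho>: True
  have "uniformly_convergent_on (cball 0 \<rho>) (\<lambda>M q. \<Prod>j<M. 1 - q ^ Suc j :: complex)"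
  proof (rule uniformly_convergent_on_prod')
    show "uniformly_convergent_on (cball 0 \<rho>) (\<lambda>M q. \<Sum>j<M. norm ((1 - q ^ Suc j) - 1 :: complex))"
    proof (rule Weierstrass_m_test')
      show "norm (norm ((1 - q ^ Suc j) - 1)) \<le> \<bar>\<rho>\<bar> ^ Suc j" if "q \<in> cball 0 \<rho>" for j and q :: complex
        using that by (auto simp: norm_power norm_mult intro!: mult_mono power_mono)
      show "summable (\<lambda>j. \<bar>\<rho>\<bar> ^ Suc j)"
        using assms \<rho> by (subst summable_Suc_iff) (simp add: summable_geometric)
    qed
  qed (auto intro!: continuous_intros)
  then have 1: "uniform_limit (cball 0 \<rho>) (\<lambda>M q. \<Prod>j<M. 1 - q ^ Suc j) (\<lambda>q. lim (\<lambda>M. \<Prod>j<M. 1 - q ^ Suc j :: complex)) sequentially"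
    by (simp add: uniformly_convergent_uniform_limit_iff)
  have "lim (\<lambda>M. \<Prod>j<M. 1 - q ^ Suc j) = euler q" if "q \<in> cball 0 \<rho>" for q :: complex
  proof -
    have "norm q < 1" using that assms by simp
    then have "(\<lambda>j. 1 - q ^ Suc j) has_prod euler q"
      unfolding euler_def by (intro convergent_prod_has_prod convergent_prod_euler)
    then show ?thesis using has_prod_imp_tendsto' limI by blast
  qed
  then show ?thesis by (intro uniform_limit_cong'[THEN iffD1, OF _ _ 1]) (auto simp del: power_Suc)
qed simp

lemma holomorphic_euler: "euler holomorphic_on ball 0 1"
proof (rule holomorphic_uniform_sequence)
  show "(\<lambda>q. \<Prod>j<M. 1 - q ^ Suc j :: complex) holomorphic_on ball 0 1" for M
    by (intro holomorphic_intros)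
  fix q :: complex assume q: "q \<in> ball 0 1"
  define e where "e = (1 - norm q) / 2"
  have e: "e > 0" "norm q + e < 1" using q by (auto simp: e_def field_simps)
  have sub: "cball q e \<subseteq> cball 0 (norm q + e)"
  proof
    fix z assume "z \<in> cball q e"
    then have "norm (z - q) \<le> e" by (simp add: dist_norm norm_minus_commute)
    moreover have "norm z \<le> norm q + norm (z - q)" using norm_triangle_ineq[of q "z - q"] by simp
    ultimately show "z \<in> cball 0 (norm q + e)" by simp
  qed
  have "uniform_limit (cball q e) (\<lambda>M q. \<Prod>j<M. 1 - q ^ Suc j) euler sequentially"
    using uniform_limit_on_subset[OF uniform_limit_euler[OF e(2)] sub] .
  moreover have "cball q e \<subseteq> ball 0 1" using sub e(2) by auto
  ultimately show "\<exists>d>0. cball q d \<subseteq> ball 0 1 \<and> uniform_limit (cball q d) (\<lambda>M q. \<Prod>j<M. 1 - q ^ Suc j) euler sequentially"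
    using e(1) by blast
qed auto

section \<open>Formal expansion of the Euler product\<close>

definition euler_trunc :: "nat \<Rightarrow> nat \<Rightarrow> complex fps" where
  "euler_trunc n M = (\<Prod>j\<in>{1..M}. 1 - fps_X ^ (n * j))"

text \<open>The infinite product as a diagonal limit: factors beyond the m-th do not reach the
  coefficient of X^m.\<close>

definition euler_fps :: "nat \<Rightarrow> complex fps" where
  "euler_fps n = Abs_fps (\<lambda>m. fps_nth (euler_trunc n m) m)"

text \<open>Divisibility of a difference by a power of X expresses agreement up to that order, so
  the rules on \<open>dvd\<close> below work as a congruence calculus.\<close>

lemma fps_X_power_dvd_iff:
  "fps_X ^ n dvd (f :: 'a::comm_ring_1 fps) \<longleftrightarrow> (\<forall>i<n. fps_nth f i = 0)"
proof
  assume "\<forall>i<n. fps_nth f i = 0"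
  then have "f = fps_X ^ n * fps_shift n f" by (intro fps_ext) (simp add: fps_X_power_mult_nth)
  then show "fps_X ^ n dvd f" by (metis dvd_triv_left)
qed (auto simp: fps_X_power_mult_nth elim!: dvdE)

lemma euler_trunc_stable:
  assumes "n > 0" "m \<le> M"
  shows "fps_nth (euler_trunc n M) m = fps_nth (euler_trunc n m) m"
  using assms(2)
proof (induction M rule: dec_induct)
  case (step M)
  have "euler_trunc n (Suc M) = euler_trunc n M * (1 - fps_X ^ (n * Suc M))"
    by (simp add: euler_trunc_def)
  also have "\<dots> = euler_trunc n M - fps_X ^ (n * Suc M) * euler_trunc n M"
    by (simp only: right_diff_distrib mult_1_right mult.commute[of "euler_trunc n M" "fps_X ^ (n * Suc M)"])
  finally have "fps_nth (euler_trunc n (Suc M)) m = fps_nth (euler_trunc n M - fps_X ^ (n * Suc M) * euler_trunc n M) m"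
    by simp
  also have "\<dots> = fps_nth (euler_trunc n M) m"
  proof -
    have "m < n * Suc M" using step assms(1) by (cases n) auto
    then show ?thesis by (simp add: fps_X_power_mult_nth)
  qed
  finally show ?case using step by simp
qed simp

lemma euler_fps_cong:
  assumes "n > 0"
  shows "fps_X ^ Suc M dvd euler_fps n - euler_trunc n M"
  unfolding fps_X_power_dvd_iff
proof (intro allI impI)
  fix i assume "i < Suc M"
  then show "fps_nth (euler_fps n - euler_trunc n M) i = 0"
    using euler_trunc_stable[OF assms, of i M] by (simp add: euler_fps_def)
qed

text \<open>The link between the formal and the analytic product: near 0 the finite products
  converge uniformly while their Taylor coefficients stabilise, so the limits correspond.\<close>

lemma has_fps_expansion_euler:
  assumes "n > 0"
  shows "(\<lambda>q. euler (q ^ n)) has_fps_expansion euler_fps n"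
proof -
  define A where "A = ball (0::complex) (1/2)"
  have holo: "(\<lambda>q. euler (q ^ n)) holomorphic_on A"
  proof -
    have "(euler \<circ> (\<lambda>q. q ^ n)) holomorphic_on A"
    proof (rule holomorphic_on_compose_gen[OF _ holomorphic_euler])
      show "(\<lambda>q. q ^ n) ` A \<subseteq> ball 0 1"
        using assms by (auto simp: A_def norm_power power_less_one_iff)
    qed (auto intro!: holomorphic_intros)
    then show ?thesis by (simp add: o_def)
  qed
  then have exp: "(\<lambda>q. euler (q ^ n)) has_fps_expansion fps_expansion (\<lambda>q. euler (q ^ n)) 0"
    by (intro has_fps_expansion_fps_expansion[of A]) (auto simp: A_def)
  have "fps_expansion (\<lambda>q. euler (q ^ n)) 0 = euler_fps n"
  proof (rule uniform_limit_imp_fps_expansion_eq)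
    show "(\<lambda>M. euler_trunc n M) \<longlonglongrightarrow> euler_fps n"
      unfolding tendsto_fps_iff
    proof
      fix m
      show "\<forall>\<^sub>F M in sequentially. fps_nth (euler_trunc n M) m = fps_nth (euler_fps n) m"
        using euler_trunc_stable[OF assms, of m] unfolding euler_fps_def fps_nth_Abs_fps
        by (rule eventually_sequentiallyI)
    qed
    show "uniform_limit A (\<lambda>M q. \<Prod>j<M. 1 - (q ^ n) ^ Suc j) (\<lambda>q. euler (q ^ n)) sequentially"
    proof -
      have "uniform_limit (cball 0 (1/2)) (\<lambda>M q. \<Prod>j<M. 1 - q ^ Suc j) euler sequentially"
        by (rule uniform_limit_euler) simp
      moreover have "q ^ n \<in> cball 0 (1/2)" if "q \<in> A" for q
      proof -
        have "norm q ^ n \<le> norm q ^ 1" using that assms by (intro power_decreasing) (auto simp: A_def)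
        then show ?thesis using that by (simp add: A_def norm_power)
      qed
      ultimately show ?thesis unfolding uniform_limit_iff by (fastforce elim!: eventually_mono)
    qed
    show "\<forall>\<^sub>F M in sequentially. (\<lambda>q. \<Prod>j<M. 1 - (q ^ n) ^ Suc j) has_fps_expansion euler_trunc n M"
    proof (intro always_eventually allI)
      fix M
      have "euler_trunc n M = (\<Prod>j<M. 1 - (fps_X ^ n) ^ Suc j)"
        unfolding euler_trunc_def
        by (rule prod.reindex_bij_witness[where i = Suc and j = "\<lambda>j. j - 1"]) (auto simp: power_mult[symmetric])
      also have "(\<lambda>q::complex. \<Prod>j<M. 1 - (q ^ n) ^ Suc j) has_fps_expansion \<dots>"
        by (intro fps_expansion_intros)
      finally show "(\<lambda>q::complex. \<Prod>j<M. 1 - (q ^ n) ^ Suc j) has_fps_expansion euler_trunc n M" .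
    qed
    show "\<forall>\<^sub>F M in sequentially. (\<lambda>q. \<Prod>j<M. 1 - (q ^ n) ^ Suc j) holomorphic_on A"
      by (intro always_eventually allI holomorphic_intros)
  qed (use exp in \<open>auto simp: A_def\<close>)
  with exp show ?thesis by simp
qed

lemma dvd_diff_mult:
  fixes D :: "'a::comm_ring_1"
  assumes "D dvd A - B" "D dvd A' - B'"
  shows "D dvd A * A' - B * B'"
proof -
  have "A * A' - B * B' = (A - B) * A' + B * (A' - B')" by (simp add: algebra_simps)
  then show ?thesis using assms by auto
qed

lemma dvd_diff_power:
  fixes D :: "'a::comm_ring_1"
  assumes "D dvd A - B"
  shows "D dvd A ^ e - B ^ e"
  by (induction e) (auto intro: dvd_diff_mult assms)

lemma dvd_diff_prod:
  fixes D :: "'a::comm_ring_1"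
  assumes "\<And>i. i \<in> I \<Longrightarrow> D dvd A i - B i"
  shows "D dvd (\<Prod>i\<in>I. A i) - (\<Prod>i\<in>I. B i)"
  using assms by (induction I rule: infinite_finite_induct) (auto intro: dvd_diff_mult)

lemma fps_powi_cong:
  fixes A B :: "complex fps"
  assumes "D dvd A - B" "fps_nth A 0 \<noteq> 0" "fps_nth B 0 \<noteq> 0"
  shows "D dvd fps_powi A e - fps_powi B e"
proof (cases "e \<ge> 0")
  case False
  have "inverse A - inverse B = - (inverse A * inverse B) * (A - B)"
    using inverse_mult_eq_1[OF assms(2)] inverse_mult_eq_1[OF assms(3)] by (simp add: algebra_simps)
  then have "D dvd inverse A - inverse B" using assms(1) by (metis dvd_mult)
  then show ?thesis using False by (simp add: fps_powi_def dvd_diff_power)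
qed (simp add: fps_powi_def dvd_diff_power assms)

lemma fps_nth_euler_0:
  assumes "n > 0"
  shows "fps_nth (euler_trunc n M) 0 = 1" "fps_nth (euler_fps n) 0 = 1"
proof -
  have "fps_nth (euler_trunc n M) 0 = 1" for M
    unfolding euler_trunc_def using assms by (induction M) (auto simp: fps_mult_nth_0 fps_X_power_nth)
  then show "fps_nth (euler_trunc n M) 0 = 1" "fps_nth (euler_fps n) 0 = 1"
    by (auto simp: euler_fps_def)
qed

section \<open>The power series of an eta quotient\<close>

definition eta_series :: "nat \<Rightarrow> (nat \<Rightarrow> int) \<Rightarrow> complex \<Rightarrow> complex" where
  "eta_series N r q = (\<Prod>n | n dvd N. euler (q ^ n) powi r n)"

definition eta_coeff :: "nat \<Rightarrow> (nat \<Rightarrow> int) \<Rightarrow> nat \<Rightarrow> complex" where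
  "eta_coeff N r m = fps_nth (eta_prod_trunc N r m) m"

lemma has_fps_expansion_powi:
  assumes "f has_fps_expansion F" "fps_nth F 0 \<noteq> (0::complex)"
  shows "(\<lambda>q. f q powi e) has_fps_expansion fps_powi F e"
  unfolding fps_powi_def power_int_def using assms by (auto intro!: fps_expansion_intros)

text \<open>Identifies the coefficients read off from truncated products, as in \<open>cf\<close>,
  with Taylor coefficients: truncation is exact modulo X^(m+1), and inversion respects this as the
  constant terms are 1.\<close>

lemma has_fps_expansion_eta_series:
  assumes "N > 0"
  shows "eta_series N r has_fps_expansion Abs_fps (eta_coeff N r)"
proof -
  have pos: "n > 0" if "n dvd N" for n using that assms by (auto intro!: Nat.gr0I)
  define F where "F = (\<Prod>n | n dvd N. fps_powi (euler_fps n) (r n))"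
  have "(\<lambda>q. \<Prod>n | n dvd N. euler (q ^ n) powi r n) has_fps_expansion F"
    unfolding F_def using pos fps_nth_euler_0 
    by (intro has_fps_expansion_prod has_fps_expansion_powi has_fps_expansion_euler) auto
  then have 1: "eta_series N r has_fps_expansion F" unfolding eta_series_def[abs_def] .
  have "F = Abs_fps (eta_coeff N r)"
  proof (rule fps_ext)
    fix m
    have "fps_X ^ Suc m dvd F - eta_prod_trunc N r m"
      unfolding F_def eta_prod_trunc_def euler_trunc_def[symmetric]
      using pos by (intro dvd_diff_prod fps_powi_cong euler_fps_cong) (auto simp: fps_nth_euler_0)
    then show "fps_nth F m = fps_nth (Abs_fps (eta_coeff N r)) m"
      unfolding fps_X_power_dvd_iff by (simp add: eta_coeff_def)
  qed
  with 1 show ?thesis by simp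
qed

lemma holomorphic_eta_series:
  assumes "N > 0"
  shows "eta_series N r holomorphic_on ball 0 1"
proof -
  have "(\<lambda>q. euler (q ^ n) powi r n) holomorphic_on ball 0 1" if "n dvd N" for n
  proof -
    have n: "n > 0" using that assms by (auto intro!: Nat.gr0I)
    have lt: "norm (q ^ n) < 1" if "q \<in> ball 0 1" for q :: complex
      using that n by (simp add: norm_power power_less_one_iff)
    then have "(euler \<circ> (\<lambda>q. q ^ n)) holomorphic_on ball 0 1"
      by (intro holomorphic_on_compose_gen[OF _ holomorphic_euler] holomorphic_intros) auto
    then show ?thesis using lt euler_nonzero by (intro holomorphic_on_power_int) (auto simp: o_def)
  qed
  then show ?thesis unfolding eta_series_def[abs_def] by (intro holomorphic_on_prod) auto
qed

lemma eta_series_sums: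
  assumes "N > 0" "norm q < 1"
  shows "(\<lambda>m. eta_coeff N r m * q ^ m) sums eta_series N r q"
proof -
  have "(\<lambda>m. fps_nth (Abs_fps (eta_coeff N r)) m * q ^ m) sums eta_series N r q"
  proof (rule has_fps_expansion_imp_sums_complex[OF has_fps_expansion_eta_series[OF assms(1)]])
    show "eta_series N r holomorphic_on eball 0 1"
      using holomorphic_eta_series[OF assms(1)] by (simp add: one_ereal_def)
    show "ereal (norm q) < 1" using assms(2) by simp
  qed
  then show ?thesis by simp
qed

lemma eta_series_nonzero:
  assumes "N > 0" "norm q < 1"
  shows "eta_series N r q \<noteq> 0"
proof -
  have "euler (q ^ n) \<noteq> 0" if "n dvd N" for n
  proof -
    have "n > 0" using that assms by (auto intro!: Nat.gr0I)
    then have "norm (q ^ n) < 1" using assms(2) by (simp add: norm_power power_less_one_iff)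
    then show ?thesis by (rule euler_nonzero)
  qed
  then show ?thesis unfolding eta_series_def using assms(1) by (auto simp: power_int_eq_0_iff)
qed

lemma eta_coeff_0: "eta_coeff N r 0 = 1"
proof -
  have "eta_prod_trunc N r 0 = 1"
    unfolding eta_prod_trunc_def by (intro prod.neutral) (simp add: fps_powi_def)
  then show ?thesis by (simp add: eta_coeff_def)
qed

lemma norm_eC: "norm (eC z) = exp (- 2 * pi * Im z)"
  by (simp add: eC_def norm_exp_eq_Re)

lemma eC_add: "eC (x + y) = eC x * eC y"
  by (simp add: eC_def exp_add[symmetric] algebra_simps)

lemma eC_of_real: "eC (of_real x) = ee x"
  by (simp add: eC_def ee_def)

lemma eC_nonzero [simp]: "eC z \<noteq> 0"
  by (simp add: eC_def)

lemma eC_power: "eC z ^ n = eC (of_nat n * z)"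
  by (simp add: eC_def exp_of_nat_mult[symmetric] algebra_simps)

lemma eC_powi: "eC z powi n = eC (of_int n * z)"
  by (simp add: eC_def exp_power_int algebra_simps)

lemma eC_sum: "finite A \<Longrightarrow> eC (\<Sum>i\<in>A. f i) = (\<Prod>i\<in>A. eC (f i))"
  by (induction A rule: finite_induct) (auto simp: eC_add, simp add: eC_def)

lemma norm_eC_less_1: "Im z > 0 \<Longrightarrow> norm (eC z) < 1"
  by (simp add: norm_eC)

lemma eta_eq: "Im \<tau> > 0 \<Longrightarrow> eta \<tau> = eC (\<tau> / 24) * euler (eC \<tau>)"
  unfolding eta_def euler_def eC_power by simp

lemma eta_quotient_eq:
  assumes "N > 0" "Im \<tau> > 0"
  shows "eta_quotient N r \<tau> = eC (of_int (xN N r) * \<tau> / 24) * eta_series N r (eC \<tau>)"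
proof -
  have "eta (of_nat n * \<tau>) powi r n = eC (of_int (int n * r n) * \<tau> / 24) * euler (eC \<tau> ^ n) powi r n" if "n dvd N" for n
  proof -
    have "n > 0" using that assms by (auto intro!: Nat.gr0I)
    then have "Im (of_nat n * \<tau>) > 0" using assms by simp
    then show ?thesis
      by (simp add: eta_eq power_int_mult_distrib eC_powi eC_power) (simp add: mult_ac)
  qed
  then have "eta_quotient N r \<tau> = (\<Prod>n | n dvd N. eC (of_int (int n * r n) * \<tau> / 24) * euler (eC \<tau> ^ n) powi r n)"
    unfolding eta_quotient_def using assms by simp
  also have "\<dots> = eC (\<Sum>n | n dvd N. of_int (int n * r n) * \<tau> / 24) * eta_series N r (eC \<tau>)"
    unfolding prod.distrib eta_series_def using assms(1) by (simp add: eC_sum)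
  also have "(\<Sum>n | n dvd N. of_int (int n * r n) * \<tau> / 24) = of_int (xN N r) * \<tau> / 24"
    by (simp add: xN_def sum_divide_distrib sum_distrib_right)
  finally show ?thesis .
qed

text \<open>This is what permits division by f throughout.\<close>

lemma eta_quotient_nonzero: "N > 0 \<Longrightarrow> Im \<tau> > 0 \<Longrightarrow> eta_quotient N r \<tau> \<noteq> 0"
  by (simp add: eta_quotient_eq eta_series_nonzero norm_eC_less_1)

lemma eta_quotient_translate:
  assumes "N > 0" "Im \<tau> > 0"
  shows "eta_quotient N r (\<tau> + of_int j) = ee (of_int (j * xN N r) / 24) * eta_quotient N r \<tau>"
proof -
  have 1: "eC (\<tau> + of_int j) = eC \<tau>"
    unfolding eC_add using eC_of_real[of "of_int j"] by simp
  have "eC (of_int (xN N r) * (\<tau> + of_int j) / 24) = eC (of_int (xN N r) * \<tau> / 24) * eC (of_real (of_int (j * xN N r) / 24))"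
    unfolding eC_add[symmetric] by (simp add: field_simps)
  then show ?thesis using assms by (simp only: eta_quotient_eq 1 eC_of_real) (simp add: eta_quotient_eq 1)
qed

section \<open>Invariance of the Hecke operator\<close>

lemma csqrt_of_real_mult:
  assumes "s > 0"
  shows "csqrt (of_real s * z) = of_real (sqrt s) * csqrt z"
proof (rule csqrt_unique)
  show "(of_real (sqrt s) * csqrt z)^2 = of_real s * z"
    using assms by (simp add: power_mult_distrib flip: of_real_power)
  show "0 < Re (of_real (sqrt s) * csqrt z) \<or> Re (of_real (sqrt s) * csqrt z) = 0 \<and> 0 \<le> Im (of_real (sqrt s) * csqrt z)"
    using assms csqrt_principal[of z] by (auto simp: zero_less_mult_iff)
qed

lemma Mspace_transform:
  assumes "g \<in> Mspace N r b" "(a', b', c', d') \<in> Gam N" "Im \<tau> > 0"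
  shows "g (moeb a' b' c' d' \<tau>) = eta_char N r 1 a' b' c' d' * csqrt (of_int c' * \<tau> + of_int d') powi twok N r * g \<tau>"
proof -
  have nz: "of_int c' * \<tau> + of_int d' \<noteq> 0"
    using assms by (intro Im_moeb(1)[where a = a' and b = b']) auto
  have "slash (twok N r) g 1 a' b' c' d' \<tau> = eta_char N r 1 a' b' c' d' * g \<tau>"
    using assms unfolding Mspace_def by (auto simp: in_Gamma0_def)
  then show ?thesis using nz unfolding slash_def by (simp add: power_int_minus field_simps)
qed

definition phi :: "nat \<Rightarrow> (nat \<Rightarrow> int) \<Rightarrow> nat \<Rightarrow> complex \<Rightarrow> complex" where
  "phi N r l \<tau> = eta_quotient N r (\<tau> / of_nat l) / eta_quotient N r \<tau>"

lemma phi_translate: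
  assumes N: "N > 0" and l: "l \<in> L_f N r" and \<tau>: "Im \<tau> > 0"
  shows "phi N r l (\<tau> + of_int (int l * j)) = phi N r l \<tau>"
proof -
  have l0: "l > 0" using l by (auto simp: L_f_def)
  have eq: "(\<tau> + of_int (int l * j)) / of_nat l = \<tau> / of_nat l + of_int j"
    using l0 by (simp add: field_simps)
  have Im: "Im (\<tau> / of_nat l) > 0" using \<tau> l0 by (simp add: Im_divide_of_nat)
  have "ee (of_int (int l * j * xN N r) / 24) = ee (of_int (j * xN N r) / 24)"
  proof (rule ee_cong24)
    have "24 dvd j * ((int l - 1) * xN N r)" using m_f_dvd_imp(1)[OF L_f_dvd[OF l]] by (rule dvd_mult)
    then show "[int l * j * xN N r = j * xN N r] (mod 24)" by (simp add: cong_iff_dvd_diff algebra_simps)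
  qed
  then show ?thesis
    unfolding phi_def eq eta_quotient_translate[OF N \<tau>] eta_quotient_translate[OF N Im] by simp
qed

text \<open>The automorphy factors of numerator and denominator coincide, because N l c (\<tau>/l) +
  d = N c \<tau> + d; so the principal roots cancel without any choice of sign, and the characters
  cancel by \<open>eta_char_conj\<close>.\<close>

lemma phi_invariant_main:
  fixes a b c :: int and d :: nat
  assumes N: "N > 0" and l: "l \<in> L_f N r" and f: "eta_quotient N r \<in> Mspace N r False"
    and det: "a * int d - (int l * b) * (int N * c) = 1" and c: "c > 0" and d: "odd d" "\<not> 3 dvd int d"
    and \<tau>: "Im \<tau> > 0"
  shows "phi N r l (moeb a (int l * b) (int N * c) (int d) \<tau>) = phi N r l \<tau>"
proof -
  have l0: "l > 0" using l by (auto simp: L_f_def)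
  have Im: "Im (\<tau> / of_nat l) > 0" using \<tau> l0 by (simp add: Im_divide_of_nat)
  define j where "j = csqrt (of_int (int N * c) * \<tau> + of_nat d) powi twok N r"
  define X where "X = eta_char N r 1 a (int l * b) (int N * c) (int d)"
  have nz: "of_int (int N * c) * \<tau> + of_nat d \<noteq> 0"
    using Im_moeb(1)[OF \<tau>, of a "int d" "int l * b" "int N * c"] det by simp
  have 1: "eta_quotient N r (moeb a (int l * b) (int N * c) (int d) \<tau>) = X * j * eta_quotient N r \<tau>"
    using Mspace_transform[OF f _ \<tau>, of a "int l * b" "int N * c" "int d"] det unfolding j_def X_def by simp
  have 2: "moeb a (int l * b) (int N * c) (int d) \<tau> / of_nat l = moeb a b (int N * (int l * c)) (int d) (\<tau> / of_nat l)"
    using l0 nz by (simp add: moeb_def field_simps)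
  have "a * int d - b * (int N * (int l * c)) = 1" using det by (simp add: algebra_simps)
  then have "eta_quotient N r (moeb a b (int N * (int l * c)) (int d) (\<tau> / of_nat l)) =
      X * csqrt (of_int (int N * (int l * c)) * (\<tau> / of_nat l) + of_nat d) powi twok N r * eta_quotient N r (\<tau> / of_nat l)"
    using Mspace_transform[OF f _ Im, of a b "int N * (int l * c)" "int d"] eta_char_conj[OF N l det c d] unfolding X_def by simp
  also have "of_int (int N * (int l * c)) * (\<tau> / of_nat l) + of_nat d = of_int (int N * c) * \<tau> + of_nat d"
    using l0 by simp
  finally have 3: "eta_quotient N r (moeb a b (int N * (int l * c)) (int d) (\<tau> / of_nat l)) = X * j * eta_quotient N r (\<tau> / of_nat l)"
    unfolding j_def .
  have "eta_quotient N r (moeb a (int l * b) (int N * c) (int d) \<tau>) \<noteq> 0"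
    using Im_moeb(3)[OF \<tau>, of a "int d" "int l * b" "int N * c"] det by (intro eta_quotient_nonzero[OF N]) simp
  then have "X * j \<noteq> 0" unfolding 1 by auto
  then show ?thesis unfolding phi_def 1 2 3 by simp
qed

text \<open>Multiplying by a translation by a multiple of l, under which \<phi> is invariant, makes
  the lower right entry positive and prime to 6; negating the matrix makes c positive. For c = 0
  only such translations are left.\<close>

lemma phi_invariant:
  assumes N: "N > 0" and l: "l \<in> L_f N r" and f: "eta_quotient N r \<in> Mspace N r False"
    and \<gamma>: "(a, int l * b, c, d) \<in> Gam N" and \<tau>: "Im \<tau> > 0"
  shows "phi N r l (moeb a (int l * b) c d \<tau>) = phi N r l \<tau>"
proof -
  have l0: "l > 0" using l by (auto simp: L_f_def)
  have pos: "phi N r l (moeb a (int l * b) c d \<tau>) = phi N r l \<tau>"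
    if \<gamma>: "(a, int l * b, c, d) \<in> Gam N" and c: "c > 0" for a b c d
  proof -
    have det: "a * d - (int l * b) * c = 1" using \<gamma> by simp
    obtain c' where c': "c = int N * c'" using \<gamma> by auto
    have c'0: "c' > 0" using c N unfolding c' by (simp add: zero_less_mult_iff)
    have "\<exists>j. coprime (j * (int l * c) + d) 6 \<and> j * (int l * c) + d > 0"
    proof (rule ex_coprime_shift_pos)
      fix p :: int assume p: "prime p" "p dvd int l * c"
      show "\<not> p dvd d"
      proof
        assume "p dvd d"
        moreover have "p dvd (int l * b) * c" using p(2) by (metis dvd_mult2 mult.assoc mult.commute)
        ultimately have "p dvd a * d - (int l * b) * c" by (intro dvd_diff[OF dvd_mult])
        then have "is_unit p" unfolding det .
        then show False using p(1) not_prime_unit by blast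
      qed
    qed (use c l0 in auto)
    then obtain j where j: "coprime (j * (int l * c) + d) 6" "j * (int l * c) + d > 0" by blast
    define D where "D = nat (j * (int l * c) + d)"
    have D: "int D = d + j * int l * c" using j(2) by (simp add: D_def)
    have cop: "coprime (int D) 6" using j by (simp add: D_def)
    have "odd D"
    proof
      assume "even D"
      then have "even (int D)" by simp
      then show False using coprime_common_divisor[OF cop, of 2] by simp
    qed
    moreover have "\<not> 3 dvd int D" using coprime_common_divisor[OF cop, of 3] by auto
    moreover have "a * int D - (int l * (b + j * a)) * (int N * c') = 1"
      using det unfolding D c'[symmetric] by (simp add: algebra_simps)
    moreover define \<tau>' where "\<tau>' = \<tau> - of_int (int l * j)"
    moreover have \<tau>': "Im \<tau>' > 0" using \<tau> by (simp add: \<tau>'_def)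
    ultimately have "phi N r l (moeb a (int l * (b + j * a)) (int N * c') (int D) \<tau>') = phi N r l \<tau>'"
      using phi_invariant_main[OF N l f _ c'0] by blast
    moreover have "moeb a (int l * (b + j * a)) (int N * c') (int D) \<tau>' = moeb a (int l * b) c d \<tau>"
      unfolding moeb_def c'[symmetric] D \<tau>'_def by (intro arg_cong2[where f = "(/)"]) (simp_all add: algebra_simps)
    moreover have "phi N r l \<tau>' = phi N r l \<tau>"
      using phi_translate[OF N l \<tau>', of j] by (simp add: \<tau>'_def)
    ultimately show ?thesis by simp
  qed
  have det: "a * d - (int l * b) * c = 1" using \<gamma> by simp
  consider "c > 0" | "c < 0" | "c = 0" by linarith
  then show ?thesis
  proof cases
    case 1
    then show ?thesis using pos \<gamma> by blast
  next
    case 2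
    have "(- a, int l * (- b), - c, - d) \<in> Gam N" using \<gamma> by auto
    from pos[OF this] 2 have "phi N r l (moeb (- a) (int l * - b) (- c) (- d) \<tau>) = phi N r l \<tau>" by simp
    also have "moeb (- a) (int l * - b) (- c) (- d) \<tau> = moeb a (int l * b) c d \<tau>"
    proof -
      have "of_int (- a) * \<tau> + of_int (int l * - b) = - (of_int a * \<tau> + of_int (int l * b))"
        "of_int (- c) * \<tau> + of_int (- d) = - (of_int c * \<tau> + of_int d)" by simp_all
      then show ?thesis unfolding moeb_def by (simp only: minus_divide_divide)
    qed
    finally show ?thesis .
  next
    case 3
    then have ad: "a * d = 1" using det by simp
    then have "a = 1 \<and> d = 1 \<or> a = -1 \<and> d = -1" by (simp add: zmult_eq_1_iff)
    then have "moeb a (int l * b) c d \<tau> = \<tau> + of_int (int l * (a * b))"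
      using 3 by (elim disjE conjE) (simp_all add: moeb_def)
    then show ?thesis using phi_translate[OF N l \<tau>, of "a * b"] by simp
  qed
qed

lemma of_real_powr_half:
  assumes "a > 0"
  shows "complex_of_real (real a powr wt N r) = of_real (sqrt (real a)) powi twok N r"
proof -
  have "sqrt (real a) powi twok N r = sqrt (real a) powr of_int (twok N r)"
    using assms by (simp add: powr_real_of_int')
  also have "\<dots> = real a powr wt N r"
    using assms by (simp add: powr_half_sqrt[symmetric] powr_powr wt_def)
  finally show ?thesis by (metis of_real_power_int)
qed

text \<open>Computes the coset term \<phi>(h \<tau>) for the representative (a, b). The freedom in p
  and s is used to solve the matrix equation with e prime to d N and with s positive and prime to 6,
  as the character formula requires.\<close>

lemma phi_at_rep:
  assumes N: "N > 0" and l: "l \<in> L_f N r" and f: "eta_quotient N r \<in> Mspace N r False"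
    and \<alpha>: "(a, b) \<in> hecke_reps N l"
  shows "\<exists>h\<in>Gam N. \<exists>M\<in>Gam N. mm (1, 0, 0, int l) h = mm M (rep_mat l (a, b)) \<and>
    (\<forall>\<tau>. Im \<tau> > 0 \<longrightarrow> phi N r l (act h \<tau>) = hecke_weight N r l a b * of_real (real a powr wt N r) *
      eta_quotient N r (act (rep_mat l (a, b)) \<tau>) / eta_quotient N r \<tau>)"
proof -
  have l0: "l > 0" using l by (auto simp: L_f_def)
  define d where "d = l div a"
  have a: "a dvd l" "coprime a N" "gcd (gcd a b) d = 1" using \<alpha> unfolding hecke_reps_def d_def by auto
  have ld: "l = a * d" using a(1) by (simp add: d_def)
  have pos: "a > 0" "d > 0" using l0 ld by auto
  have copaN: "coprime (int a) (int N)" using a(2) by simp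
  \<comment> \<open>A prime of d N that divides both a and b N divides a, b and d, since a is prime
    to N; this contradicts primitivity.\<close>
  have "\<exists>p. coprime (p * int a + int b * int N) (int d * int N)"
  proof (rule ex_coprime_shift)
    fix q :: int assume q: "prime q" "q dvd int d * int N" "q dvd int a"
    show "\<not> q dvd int b * int N"
    proof
      assume "q dvd int b * int N"
      have "\<not> q dvd int N" using coprime_common_divisor[OF copaN q(3)] q(1) not_prime_unit by blast
      then have "q dvd int d" "q dvd int b"
        using q \<open>q dvd int b * int N\<close> prime_dvd_mult_iff by blast+
      then have "q dvd gcd (gcd (int a) (int b)) (int d)" using q(3) by (intro gcd_greatest)
      also have "\<dots> = 1" using a(3) by (simp only: gcd_int_int_eq of_nat_1)
      finally show False using q(1) not_prime_unit by blast
    qed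
  qed (use pos N in auto)
  then obtain p where p: "coprime (p * int a + int b * int N) (int d * int N)" by blast
  define e where "e = p * int a + int b * int N"
  obtain s0 t0 where st0: "s0 * e + t0 * (int d * int N) = 1"
    using bezout_int[of e "int d * int N"] p unfolding e_def by auto
  have "\<exists>j. coprime (j * (int d * int N) + s0) 6 \<and> j * (int d * int N) + s0 > 0"
  proof (rule ex_coprime_shift_pos)
    fix q :: int assume q: "prime q" "q dvd int d * int N"
    show "\<not> q dvd s0"
    proof
      assume "q dvd s0"
      then have "q dvd s0 * e + t0 * (int d * int N)" using q(2) by (intro dvd_add) auto
      then show False using q(1) not_prime_unit unfolding st0 by blast
    qed
  qed (use pos N in auto)
  then obtain j where j: "coprime (j * (int d * int N) + s0) 6" "j * (int d * int N) + s0 > 0" by blast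
  define s where "s = nat (j * (int d * int N) + s0)"
  \<comment> \<open>Compensates the shift of s by j d N, so that the determinant stays 1.\<close>
  define t where "t = j * e - t0"
  have s: "int s = j * (int d * int N) + s0" using j(2) by (simp add: s_def)
  have s0: "s > 0" using j(2) s by simp
  have cop6: "coprime (int s) 6" using j s by simp
  have s_odd: "odd s"
  proof
    assume "even s"
    then have "even (int s)" by simp
    then show False using coprime_common_divisor[OF cop6, of 2] by simp
  qed
  have s3: "\<not> 3 dvd s"
  proof
    assume "3 dvd s"
    then have "3 dvd int s" by presburger
    then show False using coprime_common_divisor[OF cop6, of 3] by simp
  qed
  have det: "int s * e - int d * t * int N = 1" using st0 unfolding s t_def by (simp add: algebra_simps)
  define q where "q = int d * t - int b * int s"
  define \<chi>1 where "\<chi>1 = eta_char N r 1 e t (int N * int d) (int s)"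
  have W: "eta_char N r 1 p q (int N) (int (a * s)) = hecke_weight N r l a b * \<chi>1"
    unfolding q_def \<chi>1_def by (rule eta_char_hecke_weight[OF N l ld a(2,3) s_odd s3 e_def det])
  define g :: mat2 where "g = (p, q, int N, int (a * s))"
  define \<gamma>1 :: mat2 where "\<gamma>1 = (e, t, int N * int d, int s)"
  have detg: "p * int (a * s) - q * int N = 1" using det unfolding e_def q_def by (simp add: algebra_simps)
  have g: "g \<in> Gam N" unfolding g_def using detg by simp
  have det1: "e * int s - t * (int N * int d) = 1" using det by (simp add: algebra_simps)
  have \<gamma>1: "\<gamma>1 \<in> Gam N" unfolding \<gamma>1_def using det1 by simp
  have rep: "rep_mat l (a, b) = (int a, int b, 0, int d)" by (simp add: rep_mat_def d_def)
  have prod: "mm \<gamma>1 (1, 0, 0, int l) = mm (rep_mat l (a, b)) g"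
    unfolding \<gamma>1_def g_def rep q_def e_def by (simp add: ld algebra_simps)
  define h where "h = minv g"
  have h: "h \<in> Gam N" unfolding h_def using g by (rule Gam_minv)
  have "mm (1, 0, 0, int l) h = mm (mm (minv \<gamma>1) (mm \<gamma>1 (1, 0, 0, int l))) h"
    unfolding mm_assoc[symmetric] by (simp add: mm_minv Gam_mdet[OF \<gamma>1])
  also have "\<dots> = mm (minv \<gamma>1) (rep_mat l (a, b))"
    unfolding prod h_def by (simp add: mm_assoc mm_minv Gam_mdet[OF g])
  finally have prod2: "mm (1, 0, 0, int l) h = mm (minv \<gamma>1) (rep_mat l (a, b))" .
  have "phi N r l (act h \<tau>) = hecke_weight N r l a b * of_real (real a powr wt N r) *
      eta_quotient N r (act (rep_mat l (a, b)) \<tau>) / eta_quotient N r \<tau>" if \<tau>: "Im \<tau> > 0" for \<tau>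
  proof -
    define z where "z = act h \<tau>"
    have z: "Im z > 0" unfolding z_def using Im_act[OF \<tau>, of h] Gam_mdet[OF h] by simp
    have gz: "act g z = \<tau>"
      unfolding z_def using act_mm[OF \<tau>, of g h] Gam_mdet[OF g] Gam_mdet[OF h]
      by (simp add: h_def mm_minv del: act_simp)
    have Imz: "Im (z / of_nat l) > 0" using z l0 by (simp add: Im_divide_of_nat)
    define J where "J = csqrt (of_int (int N) * z + of_nat (a * s)) powi twok N r"
    have nz: "of_int (int N) * z + of_nat (a * s) \<noteq> 0"
      using Im_moeb(1)[OF z, of p "int (a * s)" q "int N"] detg by simp
    have J0: "J \<noteq> 0" unfolding J_def using nz by simp
    have 1: "eta_quotient N r \<tau> = hecke_weight N r l a b * \<chi>1 * J * eta_quotient N r z"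
      using Mspace_transform[OF f g[unfolded g_def] z] gz unfolding W J_def g_def by simp
    have "act (rep_mat l (a, b)) \<tau> = act (mm (rep_mat l (a, b)) g) z"
      using act_mm[OF z, of "rep_mat l (a, b)" g] gz Gam_mdet[OF g] rep_mat_det[OF \<alpha> l0] l0 by simp
    also have "\<dots> = act \<gamma>1 (act (1, 0, 0, int l) z)"
      unfolding prod[symmetric] using l0 Gam_mdet[OF \<gamma>1] by (intro act_mm z) auto
    also have "act (1, 0, 0, int l) z = z / of_nat l" by (simp add: moeb_def)
    finally have "eta_quotient N r (act (rep_mat l (a, b)) \<tau>) = eta_quotient N r (moeb e t (int N * int d) (int s) (z / of_nat l))"
      unfolding \<gamma>1_def by simp
    also have "\<dots> = \<chi>1 * csqrt (of_int (int N * int d) * (z / of_nat l) + of_nat s) powi twok N r * eta_quotient N r (z / of_nat l)"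
      using Mspace_transform[OF f \<gamma>1[unfolded \<gamma>1_def] Imz] unfolding \<chi>1_def by simp
    \<comment> \<open>The two automorphy factors differ by the positive scalar 1/a, so the principal
      root splits and a^k appears.\<close>
    also have "of_int (int N * int d) * (z / of_nat l) + of_nat s = of_real (1 / real a) * (of_int (int N) * z + of_nat (a * s))"
      using pos unfolding ld by (simp add: field_simps)
    also have "csqrt \<dots> powi twok N r = of_real (sqrt (1 / real a)) powi twok N r * J"
      unfolding J_def using pos by (subst csqrt_of_real_mult) (auto simp: power_int_mult_distrib)
    also have "complex_of_real (sqrt (1 / real a)) powi twok N r = inverse (of_real (real a powr wt N r))"
      unfolding of_real_powr_half[OF pos(1)] by (simp add: real_sqrt_divide power_int_divide_distrib inverse_eq_divide)
    finally have 2: "eta_quotient N r (act (rep_mat l (a, b)) \<tau>) =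
        \<chi>1 * (inverse (of_real (real a powr wt N r)) * J) * eta_quotient N r (z / of_nat l)" .
    have ne: "eta_quotient N r z \<noteq> 0" "eta_quotient N r \<tau> \<noteq> 0" using eta_quotient_nonzero[OF N] z \<tau> by auto
    have ne': "\<chi>1 \<noteq> 0" "hecke_weight N r l a b \<noteq> 0" using ne(2) unfolding 1 by auto
    have ne'': "complex_of_real (real a powr wt N r) \<noteq> 0" using pos by simp
    show ?thesis unfolding z_def[symmetric] phi_def 1 2 using ne(1) ne' ne'' J0 by (simp add: field_simps)
  qed
  then show ?thesis using h Gam_minv[OF \<gamma>1] prod2 by blast
qed

text \<open>T_l with the normalisation of c_l, extended by 0 as \<open>Mspace\<close>
  demands.\<close>

definition hecke_op :: "nat \<Rightarrow> (nat \<Rightarrow> int) \<Rightarrow> nat \<Rightarrow> (complex \<Rightarrow> complex) \<Rightarrow> complex \<Rightarrow> complex" where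
  "hecke_op N r l g \<tau> = (if Im \<tau> > 0 then of_real (real l powr (- wt N r / 2)) *
     (\<Sum>\<alpha>\<in>hecke_reps N l. hecke_weight N r l (fst \<alpha>) (snd \<alpha>) * of_real (real (fst \<alpha>) powr wt N r) * g (act (rep_mat l \<alpha>) \<tau>)) else 0)"

text \<open>Up to a constant the quotient is the sum of \<phi>(h \<tau>) over the cosets. Right
  multiplication by \<gamma> permutes the representatives, and the discrepancy between the matrices
  h fixes \<phi>.\<close>

theorem hecke_op_quotient_invariant:
  assumes N: "N > 0" and l: "l \<in> L_f N r" and f: "eta_quotient N r \<in> Mspace N r False"
    and \<gamma>: "\<gamma> \<in> Gam N" and \<tau>: "Im \<tau> > 0"
  shows "hecke_op N r l (eta_quotient N r) (act \<gamma> \<tau>) / eta_quotient N r (act \<gamma> \<tau>) =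
    hecke_op N r l (eta_quotient N r) \<tau> / eta_quotient N r \<tau>"
proof -
  have l0: "l > 0" using l by (auto simp: L_f_def)
  define Q where "Q \<alpha> h M \<longleftrightarrow> h \<in> Gam N \<and> M \<in> Gam N \<and> mm (1, 0, 0, int l) h = mm M (rep_mat l \<alpha>) \<and>
    (\<forall>\<tau>. Im \<tau> > 0 \<longrightarrow> phi N r l (act h \<tau>) = hecke_weight N r l (fst \<alpha>) (snd \<alpha>) * of_real (real (fst \<alpha>) powr wt N r) *
      eta_quotient N r (act (rep_mat l \<alpha>) \<tau>) / eta_quotient N r \<tau>)" for \<alpha> h M
  have "\<forall>\<alpha>\<in>hecke_reps N l. \<exists>h M. Q \<alpha> h M"
  proof
    fix \<alpha> assume "\<alpha> \<in> hecke_reps N l"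
    moreover obtain a b where "\<alpha> = (a, b)" by (cases \<alpha>)
    ultimately show "\<exists>h M. Q \<alpha> h M" using phi_at_rep[OF N l f, of a b] unfolding Q_def by (metis fst_conv snd_conv)
  qed
  then obtain h M where hM: "\<And>\<alpha>. \<alpha> \<in> hecke_reps N l \<Longrightarrow> Q \<alpha> (h \<alpha>) (M \<alpha>)" by metis
  have F: "hecke_op N r l (eta_quotient N r) \<tau> / eta_quotient N r \<tau> =
      of_real (real l powr (- wt N r / 2)) * (\<Sum>\<alpha>\<in>hecke_reps N l. phi N r l (act (h \<alpha>) \<tau>))" if "Im \<tau> > 0" for \<tau>
  proof -
    have "(\<Sum>\<alpha>\<in>hecke_reps N l. phi N r l (act (h \<alpha>) \<tau>)) =
        (\<Sum>\<alpha>\<in>hecke_reps N l. hecke_weight N r l (fst \<alpha>) (snd \<alpha>) * of_real (real (fst \<alpha>) powr wt N r) *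
          eta_quotient N r (act (rep_mat l \<alpha>) \<tau>)) / eta_quotient N r \<tau>"
      unfolding sum_divide_distrib using hM that unfolding Q_def by (intro sum.cong) auto
    then show ?thesis unfolding hecke_op_def using that by simp
  qed
  have "\<forall>\<alpha>\<in>hecke_reps N l. \<exists>\<alpha>'. \<alpha>' \<in> hecke_reps N l \<and> (\<exists>\<gamma>'\<in>Gam N. mm (rep_mat l \<alpha>) \<gamma> = mm \<gamma>' (rep_mat l \<alpha>'))"
    using hecke_reps_right_mult[OF _ l0 \<gamma>] by blast
  then obtain \<pi> where \<pi>: "\<And>\<alpha>. \<alpha> \<in> hecke_reps N l \<Longrightarrow> \<pi> \<alpha> \<in> hecke_reps N l"
    and \<pi>': "\<And>\<alpha>. \<alpha> \<in> hecke_reps N l \<Longrightarrow> \<exists>\<gamma>'\<in>Gam N. mm (rep_mat l \<alpha>) \<gamma> = mm \<gamma>' (rep_mat l (\<pi> \<alpha>))" by metis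
  have "inj_on \<pi> (hecke_reps N l)"
  proof (rule inj_onI)
    fix \<alpha> \<beta> assume \<alpha>\<beta>: "\<alpha> \<in> hecke_reps N l" "\<beta> \<in> hecke_reps N l" "\<pi> \<alpha> = \<pi> \<beta>"
    obtain \<gamma>1 where 1: "\<gamma>1 \<in> Gam N" "mm (rep_mat l \<alpha>) \<gamma> = mm \<gamma>1 (rep_mat l (\<pi> \<alpha>))" using \<pi>' \<alpha>\<beta> by blast
    obtain \<gamma>2 where 2: "\<gamma>2 \<in> Gam N" "mm (rep_mat l \<beta>) \<gamma> = mm \<gamma>2 (rep_mat l (\<pi> \<alpha>))" using \<pi>' \<alpha>\<beta> by metis
    have "rep_mat l (\<pi> \<alpha>) = mm (minv \<gamma>2) (mm (rep_mat l \<beta>) \<gamma>)"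
      unfolding 2(2) mm_assoc[symmetric] by (simp add: mm_minv Gam_mdet[OF 2(1)])
    then have "mm (rep_mat l \<alpha>) \<gamma> = mm (mm (mm \<gamma>1 (minv \<gamma>2)) (rep_mat l \<beta>)) \<gamma>"
      using 1(2) by (simp add: mm_assoc)
    then have "mm (mm (rep_mat l \<alpha>) \<gamma>) (minv \<gamma>) = mm (mm (mm (mm \<gamma>1 (minv \<gamma>2)) (rep_mat l \<beta>)) \<gamma>) (minv \<gamma>)" by simp
    then have "rep_mat l \<alpha> = mm (mm \<gamma>1 (minv \<gamma>2)) (rep_mat l \<beta>)"
      unfolding mm_assoc by (simp add: mm_minv Gam_mdet[OF \<gamma>])
    then show "\<alpha> = \<beta>" using hecke_reps_disjoint[OF \<alpha>\<beta>(1,2) l0] Gam_mm[OF 1(1) Gam_minv[OF 2(1)]] by blast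
  qed
  then have bij: "bij_betw \<pi> (hecke_reps N l) (hecke_reps N l)"
    using endo_inj_surj[OF finite_hecke_reps[OF l0], of \<pi> N] \<pi> unfolding bij_betw_def by blast
  have step: "phi N r l (act (h \<alpha>) (act \<gamma> \<tau>)) = phi N r l (act (h (\<pi> \<alpha>)) \<tau>)" if \<alpha>: "\<alpha> \<in> hecke_reps N l" for \<alpha>
  proof -
    obtain \<gamma>' where \<gamma>': "\<gamma>' \<in> Gam N" "mm (rep_mat l \<alpha>) \<gamma> = mm \<gamma>' (rep_mat l (\<pi> \<alpha>))" using \<pi>' \<alpha> by blast
    have h1: "h \<alpha> \<in> Gam N" "M \<alpha> \<in> Gam N" "mm (1, 0, 0, int l) (h \<alpha>) = mm (M \<alpha>) (rep_mat l \<alpha>)"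
      using hM[OF \<alpha>] unfolding Q_def by auto
    have h2: "h (\<pi> \<alpha>) \<in> Gam N" "M (\<pi> \<alpha>) \<in> Gam N" "mm (1, 0, 0, int l) (h (\<pi> \<alpha>)) = mm (M (\<pi> \<alpha>)) (rep_mat l (\<pi> \<alpha>))"
      using hM[OF \<pi>[OF \<alpha>]] unfolding Q_def by auto
    \<comment> \<open>\<eta> is what \<phi> has to be invariant under. Conjugation by diag(1, l)
      keeps it integral, which says exactly that its upper right entry is divisible by l.\<close>
    define \<eta> where "\<eta> = mm (mm (h \<alpha>) \<gamma>) (minv (h (\<pi> \<alpha>)))"
    have \<eta>: "\<eta> \<in> Gam N" unfolding \<eta>_def using h1 h2 \<gamma> by (intro Gam_mm Gam_minv)
    have "rep_mat l (\<pi> \<alpha>) = mm (minv (M (\<pi> \<alpha>))) (mm (1, 0, 0, int l) (h (\<pi> \<alpha>)))"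
      unfolding h2(3) mm_assoc[symmetric] by (simp add: mm_minv Gam_mdet[OF h2(2)])
    then have "mm (mm (1, 0, 0, int l) (h \<alpha>)) \<gamma> = mm (mm (mm (M \<alpha>) \<gamma>') (minv (M (\<pi> \<alpha>)))) (mm (1, 0, 0, int l) (h (\<pi> \<alpha>)))"
      unfolding h1(3) by (simp add: mm_assoc \<gamma>'(2))
    then have "mm (mm (mm (1, 0, 0, int l) (h \<alpha>)) \<gamma>) (minv (h (\<pi> \<alpha>))) =
      mm (mm (mm (mm (M \<alpha>) \<gamma>') (minv (M (\<pi> \<alpha>)))) (mm (1, 0, 0, int l) (h (\<pi> \<alpha>)))) (minv (h (\<pi> \<alpha>)))" by simp
    then have conj: "mm (1, 0, 0, int l) \<eta> = mm (mm (mm (M \<alpha>) \<gamma>') (minv (M (\<pi> \<alpha>)))) (1, 0, 0, int l)"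
      unfolding \<eta>_def mm_assoc by (simp add: mm_minv Gam_mdet[OF h2(1)])
    obtain A B C D where \<eta>e: "\<eta> = (A, B, C, D)" by (cases \<eta>)
    obtain A' B' C' D' where "mm (mm (M \<alpha>) \<gamma>') (minv (M (\<pi> \<alpha>))) = (A', B', C', D')" by (cases "mm (mm (M \<alpha>) \<gamma>') (minv (M (\<pi> \<alpha>)))")
    then have B: "B = int l * B'" using conj unfolding \<eta>e by simp
    define z where "z = act (h (\<pi> \<alpha>)) \<tau>"
    have z: "Im z > 0" unfolding z_def using Im_act[OF \<tau>, of "h (\<pi> \<alpha>)"] Gam_mdet[OF h2(1)] by simp
    have "act (h \<alpha>) (act \<gamma> \<tau>) = act (mm (h \<alpha>) \<gamma>) \<tau>"
      using Gam_mdet[OF h1(1)] Gam_mdet[OF \<gamma>] by (intro act_mm[symmetric] \<tau>) auto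
    also have "mm (h \<alpha>) \<gamma> = mm \<eta> (h (\<pi> \<alpha>))"
      unfolding \<eta>_def mm_assoc by (simp add: mm_minv Gam_mdet[OF h2(1)])
    also have "act \<dots> \<tau> = act \<eta> z"
      unfolding z_def using Gam_mdet[OF \<eta>] Gam_mdet[OF h2(1)] by (intro act_mm \<tau>) auto
    finally have "phi N r l (act (h \<alpha>) (act \<gamma> \<tau>)) = phi N r l (moeb A (int l * B') C D z)"
      unfolding \<eta>e B by simp
    also have "\<dots> = phi N r l z" using phi_invariant[OF N l f _ z] \<eta> unfolding \<eta>e B by blast
    finally show ?thesis unfolding z_def .
  qed
  have "(\<Sum>\<alpha>\<in>hecke_reps N l. phi N r l (act (h \<alpha>) (act \<gamma> \<tau>))) = (\<Sum>\<alpha>\<in>hecke_reps N l. phi N r l (act (h (\<pi> \<alpha>)) \<tau>))"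
    using step by (intro sum.cong) auto
  also have "\<dots> = (\<Sum>\<alpha>\<in>hecke_reps N l. phi N r l (act (h \<alpha>) \<tau>))"
    by (rule sum.reindex_bij_betw[OF bij])
  finally show ?thesis using F[OF \<tau>] F[of "act \<gamma> \<tau>"] Im_act[OF \<tau>, of \<gamma>] Gam_mdet[OF \<gamma>] by simp
qed

section \<open>Behaviour at the cusps\<close>

text \<open>Boundedness for \<open>s\<close> false, exponential decay for \<open>s\<close> true. For
  periodic holomorphic functions this amounts to the cusp condition, but unlike an expansion it
  passes directly to finite sums.\<close>

definition decays :: "bool \<Rightarrow> (complex \<Rightarrow> complex) \<Rightarrow> bool" where
  "decays s G \<longleftrightarrow> (\<exists>C \<epsilon>. \<epsilon> \<ge> 0 \<and> (s \<longrightarrow> \<epsilon> > 0) \<and> (\<forall>\<tau>. Im \<tau> \<ge> 1 \<longrightarrow> norm (G \<tau>) \<le> C * exp (- \<epsilon> * Im \<tau>)))"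

lemma decaysI:
  assumes "\<epsilon> \<ge> 0" "s \<Longrightarrow> \<epsilon> > 0" "\<And>\<tau>. Im \<tau> \<ge> 1 \<Longrightarrow> norm (G \<tau>) \<le> C * exp (- \<epsilon> * Im \<tau>)"
  shows "decays s G"
  using assms unfolding decays_def by blast

lemma decays_0: "decays s (\<lambda>_. 0)"
  by (rule decaysI[where \<epsilon> = 1 and C = 0]) auto

lemma decays_cmult:
  assumes "decays s G"
  shows "decays s (\<lambda>\<tau>. c * G \<tau>)"
proof -
  obtain C \<epsilon> where C: "\<epsilon> \<ge> 0" "s \<longrightarrow> \<epsilon> > 0" "\<And>\<tau>. Im \<tau> \<ge> 1 \<Longrightarrow> norm (G \<tau>) \<le> C * exp (- \<epsilon> * Im \<tau>)"
    using assms unfolding decays_def by blast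
  show ?thesis
  proof (rule decaysI[of \<epsilon>])
    fix \<tau> :: complex assume "Im \<tau> \<ge> 1"
    then have "norm c * norm (G \<tau>) \<le> norm c * (C * exp (- \<epsilon> * Im \<tau>))"
      using C(3) by (intro mult_left_mono) auto
    then show "norm (c * G \<tau>) \<le> (norm c * C) * exp (- \<epsilon> * Im \<tau>)" by (simp add: norm_mult mult.assoc)
  qed (use C in auto)
qed

lemma decays_add:
  assumes "decays s G" "decays s G'"
  shows "decays s (\<lambda>\<tau>. G \<tau> + G' \<tau>)"
proof -
  obtain C \<epsilon> where C: "\<epsilon> \<ge> 0" "s \<longrightarrow> \<epsilon> > 0" "\<And>\<tau>. Im \<tau> \<ge> 1 \<Longrightarrow> norm (G \<tau>) \<le> C * exp (- \<epsilon> * Im \<tau>)"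
    using assms unfolding decays_def by blast
  obtain C' \<epsilon>' where C': "\<epsilon>' \<ge> 0" "s \<longrightarrow> \<epsilon>' > 0" "\<And>\<tau>. Im \<tau> \<ge> 1 \<Longrightarrow> norm (G' \<tau>) \<le> C' * exp (- \<epsilon>' * Im \<tau>)"
    using assms unfolding decays_def by blast
  define \<delta> where "\<delta> = min \<epsilon> \<epsilon>'"
  have bound: "norm z \<le> \<bar>c\<bar> * exp (- \<delta> * t)" if "norm z \<le> c * exp (- e * t)" "\<delta> \<le> e" "t \<ge> 1" for z :: complex and c e t
  proof -
    have "norm z \<le> \<bar>c\<bar> * exp (- e * t)" using that(1) by (rule order.trans) (intro mult_right_mono; simp)
    also have "\<dots> \<le> \<bar>c\<bar> * exp (- \<delta> * t)" using that by (intro mult_left_mono) auto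
    finally show ?thesis .
  qed
  show ?thesis
  proof (rule decaysI[of \<delta>])
    fix \<tau> :: complex assume t: "Im \<tau> \<ge> 1"
    have "norm (G \<tau> + G' \<tau>) \<le> norm (G \<tau>) + norm (G' \<tau>)" by (rule norm_triangle_ineq)
    also have "\<dots> \<le> \<bar>C\<bar> * exp (- \<delta> * Im \<tau>) + \<bar>C'\<bar> * exp (- \<delta> * Im \<tau>)"
      using bound[OF C(3)[OF t] _ t] bound[OF C'(3)[OF t] _ t] by (intro add_mono) (auto simp: \<delta>_def)
    finally show "norm (G \<tau> + G' \<tau>) \<le> (\<bar>C\<bar> + \<bar>C'\<bar>) * exp (- \<delta> * Im \<tau>)" by (simp add: distrib_right)
  qed (use C C' in \<open>auto simp: \<delta>_def\<close>)
qed

lemma decays_sum: "(\<And>i. i \<in> I \<Longrightarrow> decays s (G i)) \<Longrightarrow> decays s (\<lambda>\<tau>. \<Sum>i\<in>I. G i \<tau>)"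
  by (induction I rule: infinite_finite_induct) (auto simp: decays_0 intro: decays_add)

lemma decays_cong: "(\<And>\<tau>. Im \<tau> \<ge> 1 \<Longrightarrow> G \<tau> = G' \<tau>) \<Longrightarrow> decays s G \<longleftrightarrow> decays s G'"
  unfolding decays_def by simp

text \<open>The exponents lie in x + Z/h, so the positive ones stay above some \<epsilon> > 0. The
  sum of absolute values at height \<open>y0\<close> then bounds G at all greater heights.\<close>

lemma cusp_expansion_bound:
  assumes "cusp_expansion_ok G s" "y0 > 0"
  shows "\<exists>C \<epsilon>. \<epsilon> \<ge> 0 \<and> (s \<longrightarrow> \<epsilon> > 0) \<and> (\<forall>\<tau>. Im \<tau> \<ge> y0 \<longrightarrow> norm (G \<tau>) \<le> C * exp (- \<epsilon> * Im \<tau>))"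
proof -
  obtain h x :: real and co where h: "h > 0"
    and sum: "\<And>\<tau>. Im \<tau> > 0 \<Longrightarrow> ((\<lambda>m. co m * eC (of_real (x + of_int m / h) * \<tau>)) has_sum G \<tau>) UNIV"
    and nn: "\<And>m. co m \<noteq> 0 \<Longrightarrow> (if s then x + of_int m / h > 0 else x + of_int m / h \<ge> 0)"
    using assms(1) unfolding cusp_expansion_ok_def by blast
  define E where "E m = x + of_int m / h" for m :: int
  \<comment> \<open>The index is the least m whose exponent is positive.\<close>
  define \<epsilon> where "\<epsilon> = (if s then E (\<lfloor>- x * h\<rfloor> + 1) else 0)"
  have \<epsilon>: "\<epsilon> \<ge> 0" "s \<longrightarrow> \<epsilon> > 0"
  proof -
    have "- x * h < of_int (\<lfloor>- x * h\<rfloor> + 1)" by linarith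
    then have "E (\<lfloor>- x * h\<rfloor> + 1) > 0" unfolding E_def using h by (simp add: field_simps)
    then show "\<epsilon> \<ge> 0" "s \<longrightarrow> \<epsilon> > 0" unfolding \<epsilon>_def by auto
  qed
  have E: "E m \<ge> \<epsilon>" if "co m \<noteq> 0" for m
  proof (cases s)
    case True
    then have "x + of_int m / h > 0" using nn[OF that] by simp
    then have "of_int m > - x * h" using h by (simp add: field_simps)
    then have "m \<ge> \<lfloor>- x * h\<rfloor> + 1" by linarith
    then have "real_of_int (\<lfloor>- x * h\<rfloor> + 1) / h \<le> of_int m / h" using h by (intro divide_right_mono) auto
    then show ?thesis using True unfolding \<epsilon>_def E_def by simp
  next
    case False
    then show ?thesis using nn[OF that] unfolding \<epsilon>_def E_def by simp
  qed
  have nrm: "norm (co m * eC (of_real (x + of_int m / h) * \<tau>)) = norm (co m) * exp (- 2 * pi * E m * Im \<tau>)" for m \<tau>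
    by (simp add: norm_mult norm_eC E_def mult.assoc)
  have abs: "(\<lambda>m. norm (co m) * exp (- 2 * pi * E m * Im \<tau>)) summable_on UNIV" if "Im \<tau> > 0" for \<tau>
  proof -
    have "(\<lambda>m. norm (co m * eC (of_real (x + of_int m / h) * \<tau>))) summable_on UNIV"
      using has_sum_imp_summable[OF sum[OF that]] by (subst (asm) summable_on_iff_abs_summable_on_complex)
    then show ?thesis unfolding nrm .
  qed
  define C where "C = infsum (\<lambda>m. norm (co m) * exp (- 2 * pi * E m * y0)) UNIV"
  have y0s: "(\<lambda>m. norm (co m) * exp (- 2 * pi * E m * y0)) summable_on UNIV"
    using abs[of "\<i> * of_real y0"] assms(2) by simp
  have "norm (G \<tau>) \<le> (C * exp (2 * pi * \<epsilon> * y0)) * exp (- (2 * pi * \<epsilon>) * Im \<tau>)" if \<tau>: "Im \<tau> \<ge> y0" for \<tau>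
  proof -
    have \<tau>0: "Im \<tau> > 0" using \<tau> assms(2) by simp
    have "norm (G \<tau>) = norm (infsum (\<lambda>m. co m * eC (of_real (x + of_int m / h) * \<tau>)) UNIV)"
      using infsumI[OF sum[OF \<tau>0]] by simp
    also have "\<dots> \<le> infsum (\<lambda>m. norm (co m) * exp (- 2 * pi * E m * Im \<tau>)) UNIV"
      using norm_infsum_bound[of "\<lambda>m. co m * eC (of_real (x + of_int m / h) * \<tau>)" UNIV] abs[OF \<tau>0] unfolding nrm by simp
    also have "\<dots> \<le> infsum (\<lambda>m. norm (co m) * exp (- 2 * pi * E m * y0) * exp (- 2 * pi * \<epsilon> * (Im \<tau> - y0))) UNIV"
    proof (rule infsum_mono[OF abs[OF \<tau>0]])
      show "(\<lambda>m. norm (co m) * exp (- 2 * pi * E m * y0) * exp (- 2 * pi * \<epsilon> * (Im \<tau> - y0))) summable_on UNIV"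
        by (intro summable_on_cmult_left y0s)
      fix m :: int
      show "norm (co m) * exp (- 2 * pi * E m * Im \<tau>) \<le> norm (co m) * exp (- 2 * pi * E m * y0) * exp (- 2 * pi * \<epsilon> * (Im \<tau> - y0))"
      proof (cases "co m = 0")
        case False
        have "\<epsilon> * (Im \<tau> - y0) \<le> E m * (Im \<tau> - y0)" using E[OF False] \<tau> by (intro mult_right_mono) auto
        then have "2 * pi * (\<epsilon> * (Im \<tau> - y0)) \<le> 2 * pi * (E m * (Im \<tau> - y0))" by (intro mult_left_mono) auto
        then have "- 2 * pi * E m * Im \<tau> \<le> - 2 * pi * E m * y0 + - 2 * pi * \<epsilon> * (Im \<tau> - y0)"
          by (simp add: algebra_simps)
        then have "exp (- 2 * pi * E m * Im \<tau>) \<le> exp (- 2 * pi * E m * y0) * exp (- 2 * pi * \<epsilon> * (Im \<tau> - y0))"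
          by (simp only: exp_add[symmetric] exp_le_cancel_iff)
        then show ?thesis unfolding mult.assoc by (intro mult_left_mono) (auto simp: mult.assoc)
      qed simp
    qed
    also have "\<dots> = C * exp (- 2 * pi * \<epsilon> * (Im \<tau> - y0))" unfolding C_def by (rule infsum_cmult_left')
    also have "exp (- 2 * pi * \<epsilon> * (Im \<tau> - y0)) = exp (2 * pi * \<epsilon> * y0) * exp (- (2 * pi * \<epsilon>) * Im \<tau>)"
      by (simp add: exp_add[symmetric] algebra_simps)
    finally show ?thesis by (simp add: mult.assoc)
  qed
  then show ?thesis using \<epsilon> by (intro exI[of _ "C * exp (2 * pi * \<epsilon> * y0)"] exI[of _ "2 * pi * \<epsilon>"]) auto
qed

text \<open>By periodicity G is a function of q = e(\<tau>/P) on the punctured disc. Boundedness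
  removes the singularity at 0, decay makes the extension vanish there, and its Taylor series is the
  expansion.\<close>

theorem cusp_expansion_of_periodic:
  assumes holo: "G holomorphic_on {z. Im z > 0}" and P: "P > 0"
    and per: "\<And>\<tau>. Im \<tau> > 0 \<Longrightarrow> G (\<tau> + of_real P) = G \<tau>" and dec: "decays s G"
  shows "cusp_expansion_ok G s"
proof -
  \<comment> \<open>Inverse to multiplication of \<tau> by 2 \<pi> i / P, so that
    \<open>U (Ln q)\<close> is a preimage of q.\<close>
  define U where "U w = of_real P * w / (2 * of_real pi * \<i>)" for w :: complex
  have ImU: "Im (U w) = - (P / (2 * pi)) * Re w" for w
    by (simp add: U_def Im_divide power2_eq_square)
  have U_add: "U (w + of_int (2 * k) * of_real pi * \<i>) = U w + of_int k * of_real P" for w k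
    by (simp add: U_def field_simps)
  have per': "G (\<tau> + of_int k * of_real P) = G \<tau>" if "Im \<tau> > 0" for \<tau> k
  proof -
    have n: "G (\<tau> + of_nat n * of_real P) = G \<tau>" if "Im \<tau> > 0" for \<tau> n
    proof (induction n)
      case (Suc n)
      have "G (\<tau> + of_nat n * of_real P + of_real P) = G (\<tau> + of_nat n * of_real P)" using that by (intro per) simp
      then show ?case using Suc by (simp add: algebra_simps)
    qed simp
    show ?thesis
    proof (cases "k \<ge> 0")
      case True
      then show ?thesis using n[OF that, of "nat k"] by simp
    next
      case False
      then have "complex_of_nat (nat (- k)) = - of_int k" by (simp add: of_nat_nat)
      then show ?thesis using n[of "\<tau> + of_int k * of_real P" "nat (- k)"] that by simp
    qed
  qed
  define g where "g q = G (U (Ln q))" for q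
  have g_eq: "g q = G (U w)" if "exp w = q" "norm q < 1" for q w
  proof -
    have q0: "q \<noteq> 0" using that by auto
    have "exp (Ln q) = exp w" using that q0 by simp
    then obtain k :: int where k: "Ln q = w + of_int (2 * k) * of_real pi * \<i>" by (auto simp: exp_eq)
    have "norm q = exp (Re w)" using that(1) by (metis norm_exp_eq_Re)
    then have "Re w < 0" using that(2) by (metis exp_less_one_iff)
    then have "Im (U w) > 0" unfolding ImU using P by (simp add: mult_pos_neg field_simps)
    then show ?thesis unfolding g_def k U_add by (rule per')
  qed
  have g_holo: "g holomorphic_on ball 0 1 - {0}"
  proof -
    have "g field_differentiable (at q0)" if q0: "q0 \<in> ball 0 1 - {0}" for q0
    proof -
      define V where "V = ball q0 (norm q0) \<inter> ball 0 1"
      \<comment> \<open>A branch of the logarithm near q0; \<open>Ln\<close> itself is discontinuous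
        at negative q0.\<close>
      define L where "L q = Ln (q / q0) + Ln q0" for q
      have nonpos: "q / q0 \<notin> \<real>\<^sub>\<le>\<^sub>0" if "q \<in> V" for q
      proof
        assume "q / q0 \<in> \<real>\<^sub>\<le>\<^sub>0"
        then obtain x where x: "q / q0 = of_real x" "x \<le> 0" by (auto elim: nonpos_Reals_cases)
        have "norm (q - q0) < norm q0" using that by (simp add: V_def dist_norm norm_minus_commute)
        moreover have "q - q0 = (of_real x - 1) * q0" using x q0 by (simp add: field_simps)
        ultimately have "norm (of_real x - 1 :: complex) < 1" using q0 by (simp add: norm_mult)
        moreover have "norm (of_real x - 1 :: complex) = \<bar>x - 1\<bar>" by (metis norm_of_real of_real_1 of_real_diff)
        ultimately show False using x(2) by simp
      qed
      have LV: "exp (L q) = q" if "q \<in> V" for q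
      proof -
        have "q / q0 \<noteq> 0" using nonpos[OF that] by auto
        then show ?thesis unfolding L_def using q0 by (simp add: exp_add)
      qed
      have "g q = (G \<circ> (\<lambda>q. U (L q))) q" if "q \<in> V" for q
        using g_eq[OF LV[OF that]] that by (simp add: V_def)
      moreover have "(G \<circ> (\<lambda>q. U (L q))) holomorphic_on V"
      proof (rule holomorphic_on_compose_gen[OF _ holo])
        show "(\<lambda>q. U (L q)) holomorphic_on V"
          unfolding U_def L_def using q0 nonpos by (intro holomorphic_intros) auto
        show "(\<lambda>q. U (L q)) ` V \<subseteq> {z. Im z > 0}"
        proof
          fix z assume "z \<in> (\<lambda>q. U (L q)) ` V"
          then obtain q where q: "q \<in> V" "z = U (L q)" by blast
          have "norm q = exp (Re (L q))" using LV[OF q(1)] by (metis norm_exp_eq_Re)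
          then have "Re (L q) < 0" using q(1) unfolding V_def by (metis Int_iff exp_less_one_iff mem_ball_0)
          then show "z \<in> {z. Im z > 0}" unfolding q(2) using P by (simp add: ImU mult_pos_neg field_simps)
        qed
      qed
      ultimately have "g holomorphic_on V" by (metis (no_types, lifting) holomorphic_cong)
      moreover have "open V" "q0 \<in> V" using q0 by (auto simp: V_def)
      ultimately show ?thesis using holomorphic_on_imp_differentiable_at by blast
    qed
    then show ?thesis by (simp add: field_differentiable_at_within holomorphic_on_def)
  qed
  obtain C \<epsilon> where C: "\<epsilon> \<ge> 0" "s \<longrightarrow> \<epsilon> > 0" "\<And>\<tau>. Im \<tau> \<ge> 1 \<Longrightarrow> norm (G \<tau>) \<le> C * exp (- \<epsilon> * Im \<tau>)"
    using dec unfolding decays_def by blast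
  \<comment> \<open>The value of |q| at Im \<tau> = 1. Below, \<kappa> is chosen so that
    exp(-\<epsilon> Im \<tau>) is |q| to the power \<kappa>.\<close>
  define \<rho> where "\<rho> = exp (- 2 * pi / P)"
  have \<rho>: "\<rho> > 0" "\<rho> < 1" unfolding \<rho>_def using P by auto
  define \<kappa> where "\<kappa> = \<epsilon> * P / (2 * pi)"
  have g_bound: "norm (g q) \<le> C * norm q powr \<kappa>" if "q \<noteq> 0" "norm q < \<rho>" for q
  proof -
    have q1: "norm q < 1" using that \<rho> by simp
    have Re: "Re (Ln q) = ln (norm q)" using that by simp
    have "ln (norm q) \<le> ln \<rho>" using that \<rho> by simp
    then have "ln (norm q) \<le> - 2 * pi / P" by (simp add: \<rho>_def)
    then have "Im (U (Ln q)) \<ge> 1" unfolding ImU Re using P by (simp add: field_simps)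
    then have "norm (g q) \<le> C * exp (- \<epsilon> * Im (U (Ln q)))" unfolding g_def by (rule C(3))
    also have "- \<epsilon> * Im (U (Ln q)) = \<kappa> * ln (norm q)" unfolding ImU Re \<kappa>_def by simp
    also have "exp (\<kappa> * ln (norm q)) = norm q powr \<kappa>" using that by (simp add: powr_def)
    finally show ?thesis .
  qed
  have C0: "C \<ge> 0"
  proof -
    have "0 \<le> norm (G \<i>)" by simp
    also have "\<dots> \<le> C * exp (- \<epsilon> * Im \<i>)" by (rule C(3)) simp
    finally show ?thesis by (simp add: zero_le_mult_iff)
  qed
  have \<kappa>0: "\<kappa> \<ge> 0" unfolding \<kappa>_def using C P by simp
  have "\<exists>g2. g2 holomorphic_on ball 0 1 \<and> (\<forall>z\<in>ball 0 1 - {0}. g2 z = g z)"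
  proof (rule holomorphic_on_extend[OF g_holo])
    show "g \<in> O[at 0](\<lambda>_. 1)"
    proof (rule bigoI)
      have "\<forall>\<^sub>F q in at (0::complex). q \<in> ball 0 \<rho> - {0}"
        using \<rho> by (intro eventually_at_in_open) auto
      then show "\<forall>\<^sub>F q in at 0. norm (g q) \<le> C * norm (1 :: complex)"
      proof eventually_elim
        case (elim q)
        then have "norm (g q) \<le> C * norm q powr \<kappa>" by (intro g_bound) auto
        also have "\<dots> \<le> C * 1"
        proof (rule mult_left_mono[OF _ C0])
          show "norm q powr \<kappa> \<le> 1" using elim \<rho> \<kappa>0 by (intro powr_le1) auto
        qed
        finally show ?case by simp
      qed
    qed
  qed simp
  then obtain g2 where g2: "g2 holomorphic_on ball 0 1" "\<And>q. q \<in> ball 0 1 - {0} \<Longrightarrow> g2 q = g q" by blast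
  define a where "a n = (deriv ^^ n) g2 0 / fact n" for n
  have sums: "(\<lambda>n. a n * q ^ n) sums g2 q" if "norm q < 1" for q
    using holomorphic_power_series[OF g2(1), of q] that unfolding a_def by simp
  have abs: "summable (\<lambda>n. norm (a n * q ^ n))" if qn: "norm q < 1" for q
  proof -
    obtain t where t: "norm q < t" "t < 1" using dense[OF qn] by blast
    then have t0: "t > 0" using norm_ge_zero[of q] by linarith
    have "summable (\<lambda>n. a n * (of_real t) ^ n)" by (rule sums_summable[OF sums]) (use t t0 in simp)
    then show ?thesis by (rule powser_insidea) (use t t0 in simp)
  qed
  have a0: "a 0 = 0" if s
  proof -
    have k0: "\<kappa> > 0" unfolding \<kappa>_def using C(2) that P by simp
    have "(g2 \<longlongrightarrow> g2 0) (at 0)"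
      using holomorphic_on_imp_continuous_on[OF g2(1)] by (simp add: continuous_on_eq_continuous_at isCont_def)
    moreover have "(g2 \<longlongrightarrow> 0) (at 0)"
    proof (rule Lim_null_comparison)
      have "\<forall>\<^sub>F q in at (0::complex). q \<in> ball 0 \<rho> - {0}"
        using \<rho> by (intro eventually_at_in_open) auto
      then show "\<forall>\<^sub>F q in at 0. norm (g2 q) \<le> C * norm q powr \<kappa>"
      proof eventually_elim
        case (elim q)
        then show ?case using g2(2)[of q] g_bound[of q] \<rho> by auto
      qed
      have "((\<lambda>q::complex. norm q powr \<kappa>) \<longlongrightarrow> 0 powr \<kappa>) (at 0)"
        using k0 by (intro tendsto_powr' tendsto_norm_zero tendsto_ident_at tendsto_const) auto
      then show "((\<lambda>q::complex. C * norm q powr \<kappa>) \<longlongrightarrow> 0) (at 0)"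
        using k0 tendsto_mult_right_zero by fastforce
    qed
    ultimately have "g2 0 = 0" using tendsto_unique[OF at_neq_bot] by blast
    then show ?thesis by (simp add: a_def)
  qed
  define co where "co m = (if m \<ge> 0 then a (nat m) else 0)" for m :: int
  have "((\<lambda>m. co m * eC (of_real (0 + of_int m / P) * \<tau>)) has_sum G \<tau>) UNIV" if \<tau>: "Im \<tau> > 0" for \<tau>
  proof -
    define q where "q = eC (\<tau> / of_real P)"
    have q: "norm q < 1" unfolding q_def using \<tau> P by (intro norm_eC_less_1) (simp add: Im_divide_of_real)
    have q0: "q \<noteq> 0" unfolding q_def by simp
    have "g2 q = g q" using q q0 by (intro g2(2)) simp
    also have "g q = G (U (2 * of_real pi * \<i> * (\<tau> / of_real P)))"
      using q by (intro g_eq) (simp_all add: q_def eC_def)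
    also have "U (2 * of_real pi * \<i> * (\<tau> / of_real P)) = \<tau>" unfolding U_def using P by simp
    finally have gq: "g2 q = G \<tau>" .
    have 1: "((\<lambda>n. a n * q ^ n) has_sum G \<tau>) UNIV"
      using norm_summable_imp_has_sum[OF abs[OF q] sums[OF q]] unfolding gq .
    define F where "F m = co m * eC (of_real (0 + of_int m / P) * \<tau>)" for m
    have "(F \<circ> int) = (\<lambda>n. a n * q ^ n)"
      unfolding F_def q_def eC_power by (auto simp: fun_eq_iff co_def)
    then have "(F has_sum G \<tau>) (int ` UNIV)"
      using 1 by (subst has_sum_reindex) auto
    also have "(F has_sum G \<tau>) (int ` UNIV) \<longleftrightarrow> (F has_sum G \<tau>) UNIV"
      by (rule has_sum_cong_neutral) (auto simp: F_def co_def image_iff dest: nonneg_int_cases)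
    finally show ?thesis unfolding F_def .
  qed
  moreover have "if s then 0 + of_int m / P > 0 else 0 + of_int m / P \<ge> 0" if "co m \<noteq> 0" for m
  proof -
    have m: "m \<ge> 0" using that by (auto simp: co_def split: if_splits)
    moreover have "m \<noteq> 0" if s using a0[OF that] \<open>co m \<noteq> 0\<close> by (auto simp: co_def)
    ultimately show ?thesis using P by auto
  qed
  ultimately show ?thesis unfolding cusp_expansion_ok_def using P by blast
qed

section \<open>Periods of slashed functions\<close>

lemma Rats_sum: "(\<And>i. i \<in> I \<Longrightarrow> f i \<in> \<rat>) \<Longrightarrow> (\<Sum>i\<in>I. f i) \<in> (\<rat> :: real set)"
  by (induction I rule: infinite_finite_induct) auto

lemma Psi_rational: "Psi a b c d \<in> \<rat>"
proof -
  have saw: "sawtooth x \<in> \<rat>" if "x \<in> \<rat>" for x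
    using that by (auto simp: sawtooth_def)
  have "dedekind_sum h k \<in> \<rat>" for h k
    unfolding dedekind_sum_def by (intro Rats_sum Rats_mult saw Rats_divide Rats_of_int)
  then show ?thesis unfolding Psi_def by auto
qed

lemma ee_power: "ee x ^ n = ee (real n * x)"
  by (induction n) (auto simp: ee_add[symmetric] algebra_simps)

lemma eta_char_root_of_unity: "\<exists>m>0. eta_char N r 1 a b c d ^ m = 1"
proof -
  define y where "y = (1 / 24) * (\<Sum>n | n dvd N. of_int (r n) * Psi a (b * int n) (c div int n) d)"
  have "y \<in> \<rat>" unfolding y_def by (intro Rats_mult Rats_sum Psi_rational) auto
  then obtain i :: int and m :: nat where "y = of_int i / real m" "m \<noteq> 0"
    unfolding Rats_eq_int_div_nat by blast
  then have "ee y ^ m = 1" unfolding ee_power by simp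
  then show ?thesis using \<open>m \<noteq> 0\<close> unfolding eta_char_def y_def[symmetric] by (intro exI[of _ m]) simp
qed

lemma upper_half_plane_linear_nonneg_real:
  assumes "Im \<tau> > 0" "c \<noteq> 0"
  shows "of_int c * \<tau> + of_int d \<notin> \<real>\<^sub>\<le>\<^sub>0"
proof
  assume "of_int c * \<tau> + of_int d \<in> \<real>\<^sub>\<le>\<^sub>0"
  then have "Im (of_int c * \<tau> + of_int d) = 0" by (elim nonpos_Reals_cases) (simp only: Im_complex_of_real)
  then show False using assms by simp
qed

lemma holomorphic_csqrt_linear:
  "(\<lambda>\<tau>. csqrt (of_int c * \<tau> + of_int d)) holomorphic_on {\<tau>. Im \<tau> > 0}"
proof (cases "c = 0")
  case False
  then show ?thesis using upper_half_plane_linear_nonneg_real by (intro holomorphic_intros) auto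
qed auto

lemma connected_upper_half_plane: "connected {\<tau>. Im \<tau> > 0}"
  by (intro convex_connected convex_halfspace_Im_gt)

text \<open>The two sides have equal squares, and their quotient is continuous on the upper half plane.\<close>

lemma csqrt_cocycle_constant:
  assumes "a * d - b * c = 1"
  shows "\<exists>\<sigma>. (\<sigma> = 1 \<or> \<sigma> = -1) \<and> (\<forall>\<tau>. Im \<tau> > 0 \<longrightarrow>
    csqrt (of_int (- c * c * n) * moeb a b c d \<tau> + of_int (1 + a * c * n)) * csqrt (of_int c * \<tau> + of_int d) =
    \<sigma> * csqrt (of_int c * (\<tau> + of_int n) + of_int d))"
proof -
  define H where "H = {\<tau>. Im \<tau> > 0}"
  define L where "L \<tau> = of_int c * \<tau> + of_int d" for \<tau> :: complex
  define L' where "L' \<tau> = of_int c * (\<tau> + of_int n) + of_int d" for \<tau> :: complex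
  define Q where "Q \<tau> = of_int (- c * c * n) * moeb a b c d \<tau> + of_int (1 + a * c * n)" for \<tau>
  have L0: "L \<tau> \<noteq> 0" if "\<tau> \<in> H" for \<tau>
    unfolding L_def using that assms Im_moeb(1)[of \<tau> a d b c] by (auto simp: H_def)
  have L'0: "L' \<tau> \<noteq> 0" if "\<tau> \<in> H" for \<tau>
    unfolding L'_def using that assms Im_moeb(1)[of "\<tau> + of_int n" a d b c] by (auto simp: H_def)
  have QL: "Q \<tau> * L \<tau> = L' \<tau>" if "\<tau> \<in> H" for \<tau>
  proof -
    have "Q \<tau> * L \<tau> = of_int (- c * c * n) * (of_int a * \<tau> + of_int b) + of_int (1 + a * c * n) * L \<tau>"
      unfolding Q_def moeb_def L_def[symmetric] using L0[OF that] by (simp add: field_simps)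
    also have "\<dots> = L \<tau> + of_int (c * n * (a * d - b * c))"
      unfolding L_def by (simp add: algebra_simps)
    finally show ?thesis unfolding assms L_def L'_def by (simp add: algebra_simps)
  qed
  have Qnp: "Q \<tau> \<notin> \<real>\<^sub>\<le>\<^sub>0" if "\<tau> \<in> H" for \<tau>
  proof (cases "c = 0 \<or> n = 0")
    case True
    then have "Q \<tau> = 1" by (auto simp: Q_def)
    then show ?thesis by simp
  next
    case False
    have "Im (moeb a b c d \<tau>) > 0" using that assms by (intro Im_moeb(3)) (auto simp: H_def)
    then show ?thesis using upper_half_plane_linear_nonneg_real[of "moeb a b c d \<tau>" "- c * c * n" "1 + a * c * n"] False
      unfolding Q_def by auto
  qed
  define \<rho> where "\<rho> \<tau> = csqrt (Q \<tau>) * csqrt (L \<tau>) / csqrt (L' \<tau>)" for \<tau>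
  have "\<rho> constant_on H"
  proof (rule continuous_finite_range_constant)
    show "connected H" unfolding H_def by (rule connected_upper_half_plane)
    have "(\<lambda>\<tau>. csqrt (L \<tau>)) holomorphic_on H"
      unfolding L_def H_def by (rule holomorphic_csqrt_linear)
    moreover have "(\<lambda>\<tau>. csqrt (L' \<tau>)) holomorphic_on H"
    proof -
      have "L' = (\<lambda>\<tau>. of_int c * \<tau> + of_int (c * n + d))" by (auto simp: L'_def algebra_simps)
      then show ?thesis using holomorphic_csqrt_linear[of c "c * n + d"] by (simp add: H_def)
    qed
    moreover have "(\<lambda>\<tau>. csqrt (Q \<tau>)) holomorphic_on H"
    proof -
      have "Q holomorphic_on H"
        unfolding Q_def[abs_def] moeb_def using L0 unfolding L_def by (intro holomorphic_intros) auto
      then show ?thesis using Qnp by (intro holomorphic_intros) auto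
    qed
    ultimately show "continuous_on H \<rho>"
      unfolding \<rho>_def[abs_def] using L'0 by (intro continuous_intros holomorphic_on_imp_continuous_on) auto
    have "\<rho> \<tau> = 1 \<or> \<rho> \<tau> = -1" if "\<tau> \<in> H" for \<tau>
    proof -
      have "(\<rho> \<tau>)^2 = 1"
        unfolding \<rho>_def power_divide power_mult_distrib power2_csqrt QL[OF that] using L'0[OF that] by simp
      then show ?thesis by (simp add: power2_eq_1_iff)
    qed
    then have "\<rho> ` H \<subseteq> {1, -1}" by auto
    then show "finite (\<rho> ` H)" by (rule finite_subset) simp
  qed
  then obtain \<sigma> where \<sigma>: "\<And>\<tau>. \<tau> \<in> H \<Longrightarrow> \<rho> \<tau> = \<sigma>" unfolding constant_on_def by blast
  have "\<sigma>^2 = 1"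
  proof -
    have i: "\<i> \<in> H" by (simp add: H_def)
    have "(\<rho> \<i>)^2 = 1"
      unfolding \<rho>_def power_divide power_mult_distrib power2_csqrt QL[OF i] using L'0[OF i] by simp
    then show ?thesis unfolding \<sigma>[OF i] .
  qed
  then have "\<sigma> = 1 \<or> \<sigma> = -1" by (simp add: power2_eq_1_iff)
  moreover have "csqrt (Q \<tau>) * csqrt (L \<tau>) = \<sigma> * csqrt (L' \<tau>)" if "Im \<tau> > 0" for \<tau>
  proof -
    have "\<tau> \<in> H" using that by (simp add: H_def)
    from \<sigma>[OF this] L'0[OF this] show ?thesis unfolding \<rho>_def by (simp add: field_simps)
  qed
  ultimately show ?thesis unfolding Q_def L_def L'_def by blast
qed

definition weakly_modular :: "nat \<Rightarrow> (nat \<Rightarrow> int) \<Rightarrow> (complex \<Rightarrow> complex) \<Rightarrow> bool" where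
  "weakly_modular N r g \<longleftrightarrow> (\<forall>a b c d \<tau>. (a, b, c, d) \<in> Gam N \<longrightarrow> Im \<tau> > 0 \<longrightarrow>
     g (moeb a b c d \<tau>) = eta_char N r 1 a b c d * csqrt (of_int c * \<tau> + of_int d) powi twok N r * g \<tau>)"

text \<open>Conjugated by \<gamma>, the translation by N lies in \<Gamma>_0(N), so it multiplies the
  slashed function by a sign times a character value. This is a root of unity, hence some multiple
  of N is a period.\<close>

lemma slash_periodic:
  assumes N: "N > 0" and g: "weakly_modular N r g" and det: "a * d - b * c = 1"
  shows "\<exists>P::real. P > 0 \<and> (\<forall>\<tau>. Im \<tau> > 0 \<longrightarrow> slash (twok N r) g 1 a b c d (\<tau> + of_real P) = slash (twok N r) g 1 a b c d \<tau>)"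
proof -
  define K where "K = twok N r"
  define G where "G = slash K g 1 a b c d"
  \<comment> \<open>The entries of \<gamma> T \<gamma>^(-1), where T is the translation by
    N.\<close>
  define A B C D where "A = 1 - a * c * int N" and "B = a * a * int N" and "C = - c * c * int N" and "D = 1 + a * c * int N"
  have \<gamma>: "(A, B, C, D) \<in> Gam N" unfolding A_def B_def C_def D_def by (simp add: algebra_simps)
  have conj: "mm (A, B, C, D) (a, b, c, d) = mm (a, b, c, d) (1, int N, 0, 1)"
  proof -
    have "A * a + B * c = a" "C * a + D * c = c" unfolding A_def B_def C_def D_def by (simp_all add: algebra_simps)
    moreover have "A * b + B * d = b + a * int N * (a * d - b * c)" "C * b + D * d = d + c * int N * (a * d - b * c)"
      unfolding A_def B_def C_def D_def by (simp_all add: algebra_simps)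
    ultimately show ?thesis unfolding det by (simp add: algebra_simps)
  qed
  obtain \<sigma> where \<sigma>: "\<sigma> = 1 \<or> \<sigma> = -1" and coc: "\<And>\<tau>. Im \<tau> > 0 \<Longrightarrow>
      csqrt (of_int C * moeb a b c d \<tau> + of_int D) * csqrt (of_int c * \<tau> + of_int d) = \<sigma> * csqrt (of_int c * (\<tau> + of_int (int N)) + of_int d)"
    using csqrt_cocycle_constant[OF det, of "int N"] unfolding C_def D_def by blast
  define X where "X = eta_char N r 1 A B C D"
  define \<zeta> where "\<zeta> = \<sigma> powi K * X"
  have step: "G (\<tau> + of_nat N) = \<zeta> * G \<tau>" if \<tau>: "Im \<tau> > 0" for \<tau>
  proof -
    have z: "Im (moeb a b c d \<tau>) > 0" using \<tau> det by (intro Im_moeb(3)) auto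
    have \<tau>N: "Im (\<tau> + of_nat N) > 0" using \<tau> by simp
    have nz: "csqrt (of_int c * \<tau> + of_int d) \<noteq> 0" "csqrt (of_int c * (\<tau> + of_nat N) + of_int d) \<noteq> 0"
      using Im_moeb(1)[OF \<tau>, of a d b c] Im_moeb(1)[OF \<tau>N, of a d b c] det by auto
    have "moeb a b c d (\<tau> + of_nat N) = act (mm (a, b, c, d) (1, int N, 0, 1)) \<tau>"
      using act_mm[OF \<tau>, of "(a, b, c, d)" "(1, int N, 0, 1)"] det by (simp add: moeb_def[of 1 "int N" 0 1])
    also have "\<dots> = moeb A B C D (moeb a b c d \<tau>)"
      unfolding conj[symmetric] using act_mm[OF \<tau>, of "(A, B, C, D)" "(a, b, c, d)"] \<gamma> det by simp
    finally have "g (moeb a b c d (\<tau> + of_nat N)) = X * csqrt (of_int C * moeb a b c d \<tau> + of_int D) powi K * g (moeb a b c d \<tau>)"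
      using g \<gamma> z unfolding weakly_modular_def X_def K_def by metis
    moreover have "csqrt (of_int C * moeb a b c d \<tau> + of_int D) = \<sigma> * csqrt (of_int c * (\<tau> + of_nat N) + of_int d) / csqrt (of_int c * \<tau> + of_int d)"
      using coc[OF \<tau>] nz by (simp add: field_simps)
    ultimately show ?thesis unfolding G_def slash_def \<zeta>_def using nz
      by (simp add: power_int_mult_distrib power_int_divide_distrib power_int_minus field_simps)
  qed
  obtain m where m: "m > 0" "X ^ m = 1" using eta_char_root_of_unity unfolding X_def by blast
  \<comment> \<open>The factor 2 absorbs the sign \<sigma>, and m the character value.\<close>
  have "\<zeta> ^ (2 * m) = 1"
  proof -
    have "(\<sigma> powi K)^2 = 1" using \<sigma> by (auto simp: power_int_def minus_one_power_iff)
    then have "(\<sigma> powi K) ^ (2 * m) = 1" by (simp only: power_mult power_one)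
    moreover have "X ^ (2 * m) = 1" by (simp only: mult.commute[of 2 m] power_mult m(2) power_one)
    ultimately show ?thesis unfolding \<zeta>_def power_mult_distrib by simp
  qed
  have iter: "G (\<tau> + of_nat (i * N)) = \<zeta> ^ i * G \<tau>" if "Im \<tau> > 0" for \<tau> i
  proof (induction i)
    case (Suc i)
    have "G (\<tau> + of_nat (i * N) + of_nat N) = \<zeta> * G (\<tau> + of_nat (i * N))" using that by (intro step) simp
    then show ?case using Suc by (simp add: algebra_simps)
  qed simp
  have "G (\<tau> + of_real (real (2 * m * N))) = G \<tau>" if "Im \<tau> > 0" for \<tau>
    using iter[OF that, of "2 * m"] \<open>\<zeta> ^ (2 * m) = 1\<close> by simp
  moreover have "real (2 * m * N) > 0" using m N by simp
  ultimately show ?thesis unfolding G_def K_def by blast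
qed

section \<open>T_l f as a modular form\<close>

lemma holomorphic_moeb:
  assumes "a * d - b * c > 0"
  shows "(\<lambda>\<tau>. moeb a b c d \<tau>) holomorphic_on {\<tau>. Im \<tau> > 0}"
  unfolding moeb_def using assms Im_moeb(1)[of _ a d b c] by (intro holomorphic_intros) auto

lemma holomorphic_slash:
  assumes g: "g holomorphic_on {\<tau>. Im \<tau> > 0}" and det: "a * d - b * c = 1"
  shows "slash K g 1 a b c d holomorphic_on {\<tau>. Im \<tau> > 0}"
proof -
  have "(g \<circ> moeb a b c d) holomorphic_on {\<tau>. Im \<tau> > 0}"
    using det Im_moeb(3)[of _ a d b c] by (intro holomorphic_on_compose_gen[OF _ g] holomorphic_moeb) auto
  moreover have "(\<lambda>\<tau>. csqrt (of_int c * \<tau> + of_int d) powi (- K)) holomorphic_on {\<tau>. Im \<tau> > 0}"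
    using det Im_moeb(1)[of _ a d b c] by (intro holomorphic_on_power_int holomorphic_csqrt_linear) auto
  ultimately have "(\<lambda>\<tau>. csqrt (of_int c * \<tau> + of_int d) powi (- K) * (g \<circ> moeb a b c d) \<tau>) holomorphic_on {\<tau>. Im \<tau> > 0}"
    by (intro holomorphic_on_mult)
  then show ?thesis unfolding slash_def[abs_def] by (simp add: o_def)
qed

text \<open>Write \<alpha> \<gamma> = \<gamma>' \<alpha>' with \<gamma>' of determinant 1: the
  summand becomes f slashed by \<gamma>' at z = \<alpha>' \<tau>, up to automorphy factors of
  constant ratio. Only absolute values matter, so no signs of square roots enter.\<close>

lemma decays_slash_translate:
  assumes f: "\<And>a b c d. a * d - b * c = 1 \<Longrightarrow> cusp_expansion_ok (slash K f 1 a b c d) s"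
    and l: "l > 0" and \<alpha>: "\<alpha> \<in> hecke_reps N l" and det: "a * d - b * c = 1"
  shows "decays s (slash K (\<lambda>\<tau>. f (act (rep_mat l \<alpha>) \<tau>)) 1 a b c d)"
proof -
  \<comment> \<open>The cusp is arbitrary, so the coset lemma is applied at level 1.\<close>
  have \<alpha>1: "\<alpha> \<in> hecke_reps 1 l" using \<alpha> by (auto simp: hecke_reps_def)
  have \<gamma>: "(a, b, c, d) \<in> Gam 1" using det by simp
  obtain \<alpha>' \<gamma>' where \<alpha>': "\<alpha>' \<in> hecke_reps 1 l" and \<gamma>': "\<gamma>' \<in> Gam 1"
    and eq: "mm (rep_mat l \<alpha>) (a, b, c, d) = mm \<gamma>' (rep_mat l \<alpha>')"
    using hecke_reps_right_mult[OF \<alpha>1 l \<gamma>] by blast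
  obtain u v where uv: "\<alpha>' = (u, v)" by (cases \<alpha>')
  obtain p q where pq: "\<alpha> = (p, q)" by (cases \<alpha>)
  obtain a' b' c' d' where \<gamma>'e: "\<gamma>' = (a', b', c', d')" by (cases \<gamma>')
  have det': "a' * d' - b' * c' = 1" using \<gamma>' unfolding \<gamma>'e by simp
  define D1 where "D1 = l div p"
  define D2 where "D2 = l div u"
  have pos: "p > 0" "D1 > 0" "u > 0" "D2 > 0" "u \<le> l" "D2 \<le> l"
    using \<alpha> \<alpha>' l unfolding uv pq hecke_reps_def D1_def D2_def
    by (auto intro!: Nat.gr0I dvd_imp_le simp: dvd_div_eq_0_iff)
  have rows: "int D1 * c = c' * int u" "int D1 * d = c' * int v + d' * int D2"
    using eq unfolding uv pq \<gamma>'e rep_mat_def D1_def D2_def by (auto simp: algebra_simps)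
  \<comment> \<open>The bound is taken from height 1/l on, since Im z may be as small as Im \<tau> /
    l.\<close>
  obtain C \<epsilon> where C: "\<epsilon> \<ge> 0" "s \<longrightarrow> \<epsilon> > 0" "\<And>\<tau>. Im \<tau> \<ge> 1 / real l \<Longrightarrow> norm (slash K f 1 a' b' c' d' \<tau>) \<le> C * exp (- \<epsilon> * Im \<tau>)"
    using cusp_expansion_bound[OF f[OF det'], of "1 / real l"] l by auto
  define B where "B = sqrt (real D1 / real D2) powi K"
  have B: "B \<ge> 0" unfolding B_def by simp
  show ?thesis
  proof (rule decaysI[where \<epsilon> = "\<epsilon> / real l" and C = "B * C"])
    fix \<tau> :: complex assume \<tau>1: "Im \<tau> \<ge> 1"
    then have \<tau>: "Im \<tau> > 0" by simp
    define z where "z = act (rep_mat l \<alpha>') \<tau>"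
    have z_eq: "z = (of_nat u * \<tau> + of_nat v) / of_nat D2"
      unfolding z_def uv rep_mat_def D2_def by (simp add: moeb_def)
    have Imz: "Im z = real u / real D2 * Im \<tau>" unfolding z_eq by (simp add: Im_divide_of_nat)
    have "1 / real l \<le> real u / real D2"
      using pos by (intro frac_le) auto
    then have "1 / real l * Im \<tau> \<le> Im z" unfolding Imz using \<tau> by (intro mult_right_mono) auto
    then have Imz1: "Im \<tau> / real l \<le> Im z" by simp
    moreover have "1 / real l \<le> Im \<tau> / real l" using \<tau>1 by (intro divide_right_mono) auto
    ultimately have Imz2: "Im z \<ge> 1 / real l" by linarith
    have z0: "Im z > 0" using Imz pos \<tau> by simp
    have "act (rep_mat l \<alpha>) (moeb a b c d \<tau>) = act (mm (rep_mat l \<alpha>) (a, b, c, d)) \<tau>"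
      using act_mm[OF \<tau>, of "rep_mat l \<alpha>" "(a, b, c, d)"] rep_mat_det[OF \<alpha> l] l det by simp
    also have "\<dots> = moeb a' b' c' d' z"
      unfolding eq z_def using act_mm[OF \<tau>, of \<gamma>' "rep_mat l \<alpha>'"] rep_mat_det[OF \<alpha>' l] l det' unfolding \<gamma>'e by simp
    finally have act_eq: "act (rep_mat l \<alpha>) (moeb a b c d \<tau>) = moeb a' b' c' d' z" .
    define w where "w = of_int c * \<tau> + of_int d"
    define w' where "w' = of_int c' * z + of_int d'"
    have w0: "w \<noteq> 0" unfolding w_def using Im_moeb(1)[OF \<tau>, of a d b c] det by simp
    have ww: "w' = of_real (real D1 / real D2) * w"
    proof -
      have "of_nat D2 * w' = of_int (c' * int u) * \<tau> + of_int (c' * int v + d' * int D2)"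
        unfolding w'_def z_eq using pos by (simp add: field_simps)
      also have "\<dots> = of_nat D1 * w" unfolding rows[symmetric] w_def by (simp add: algebra_simps)
      finally show ?thesis using pos by (simp add: field_simps)
    qed
    have w'0: "w' \<noteq> 0" unfolding ww using w0 pos by simp
    have nw: "norm (csqrt w') = sqrt (real D1 / real D2) * norm (csqrt w)"
      unfolding ww by (simp add: norm_mult norm_divide real_sqrt_mult real_sqrt_divide)
    have sl: "f (moeb a' b' c' d' z) = csqrt w' powi K * slash K f 1 a' b' c' d' z"
      unfolding slash_def w'_def[symmetric] using w'0 by (simp add: power_int_minus field_simps)
    have "norm (slash K (\<lambda>\<tau>. f (act (rep_mat l \<alpha>) \<tau>)) 1 a b c d \<tau>) =
        norm (csqrt w) powi (- K) * (norm (csqrt w') powi K * norm (slash K f 1 a' b' c' d' z))"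
      unfolding slash_def[of K "\<lambda>\<tau>. f (act (rep_mat l \<alpha>) \<tau>)"] act_eq sl w_def[symmetric]
      by (simp add: norm_mult norm_power_int)
    also have "\<dots> = B * norm (slash K f 1 a' b' c' d' z)"
      unfolding nw B_def using w0 by (simp add: power_int_mult_distrib power_int_minus field_simps del: norm_csqrt)
    also have "\<dots> \<le> B * (C * exp (- \<epsilon> * Im z))" using C(3)[OF Imz2] B by (intro mult_left_mono)
    also have "\<dots> \<le> B * (C * exp (- (\<epsilon> / real l) * Im \<tau>))"
    proof -
      have "C \<ge> 0"
        using order.trans[OF norm_ge_zero C(3)[OF Imz2]] by (simp add: zero_le_mult_iff)
      moreover have "\<epsilon> * (Im \<tau> / real l) \<le> \<epsilon> * Im z" using Imz1 C(1) by (intro mult_left_mono)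
      ultimately show ?thesis using B by (intro mult_left_mono) auto
    qed
    finally show "norm (slash K (\<lambda>\<tau>. f (act (rep_mat l \<alpha>) \<tau>)) 1 a b c d \<tau>) \<le> B * C * exp (- (\<epsilon> / real l) * Im \<tau>)"
      by (simp add: mult.assoc)
  qed (use C l in auto)
qed

text \<open>The transformation law is inherited from f, the quotient by f being invariant; the cusp
  conditions follow from the growth of the summands together with periodicity. The parameter
  \<open>s\<close> treats M_k and S_k at once.\<close>

theorem hecke_op_in_Mspace:
  assumes N: "N > 0" and l: "l \<in> L_f N r" and f: "eta_quotient N r \<in> Mspace N r False"
    and fs: "eta_quotient N r \<in> Mspace N r s"
  shows "hecke_op N r l (eta_quotient N r) \<in> Mspace N r s"
proof -
  define K where "K = twok N r"
  define f0 where "f0 = eta_quotient N r"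
  define H where "H = hecke_op N r l f0"
  have l0: "l > 0" using l by (auto simp: L_f_def)
  have f0_holo: "f0 holomorphic_on {\<tau>. Im \<tau> > 0}" using fs unfolding f0_def Mspace_def by auto
  have f0_cusp: "cusp_expansion_ok (slash K f0 1 a b c d) s" if "a * d - b * c = 1" for a b c d
    using fs that unfolding f0_def K_def Mspace_def by auto
  have inv: "H (moeb a b c d \<tau>) * f0 \<tau> = H \<tau> * f0 (moeb a b c d \<tau>)" if "(a, b, c, d) \<in> Gam N" "Im \<tau> > 0" for a b c d \<tau>
  proof -
    have "Im (moeb a b c d \<tau>) > 0" using that Im_moeb(3)[of \<tau> a d b c] by simp
    then have "f0 (moeb a b c d \<tau>) \<noteq> 0" "f0 \<tau> \<noteq> 0" using eta_quotient_nonzero[OF N] that unfolding f0_def by auto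
    then show ?thesis using hecke_op_quotient_invariant[OF N l f that] unfolding H_def f0_def by (simp add: field_simps)
  qed
  define cst where "cst \<alpha> = complex_of_real (real l powr (- wt N r / 2)) * (hecke_weight N r l (fst \<alpha>) (snd \<alpha>) * of_real (real (fst \<alpha>) powr wt N r))" for \<alpha>
  have H_eq: "H \<tau> = (\<Sum>\<alpha>\<in>hecke_reps N l. cst \<alpha> * f0 (act (rep_mat l \<alpha>) \<tau>))" if "Im \<tau> > 0" for \<tau>
    using that unfolding H_def hecke_op_def cst_def by (simp add: sum_distrib_left mult.assoc)
  have H_holo: "H holomorphic_on {\<tau>. Im \<tau> > 0}"
  proof -
    have "(\<lambda>\<tau>. f0 (act (rep_mat l \<alpha>) \<tau>)) holomorphic_on {\<tau>. Im \<tau> > 0}" if \<alpha>: "\<alpha> \<in> hecke_reps N l" for \<alpha>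
    proof -
      obtain a b c d where e: "rep_mat l \<alpha> = (a, b, c, d)" by (cases "rep_mat l \<alpha>")
      have "a * d - b * c > 0" using rep_mat_det[OF \<alpha> l0] l0 unfolding e by simp
      then have "(f0 \<circ> moeb a b c d) holomorphic_on {\<tau>. Im \<tau> > 0}"
        using Im_moeb(3)[of _ a d b c] by (intro holomorphic_on_compose_gen[OF _ f0_holo] holomorphic_moeb) auto
      then show ?thesis unfolding e by (simp add: o_def)
    qed
    then have "(\<lambda>\<tau>. \<Sum>\<alpha>\<in>hecke_reps N l. cst \<alpha> * f0 (act (rep_mat l \<alpha>) \<tau>)) holomorphic_on {\<tau>. Im \<tau> > 0}"
      by (intro holomorphic_intros)
    then show ?thesis by (rule holomorphic_transform) (simp add: H_eq)
  qed
  have H_slash: "slash K H \<epsilon> a b c d \<tau> = eta_char N r \<epsilon> a b c d * H \<tau>"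
    if "in_Gamma0 N a b c d" "\<epsilon> \<in> {-1, 1}" "Im \<tau> > 0" for a b c d \<epsilon> \<tau>
  proof -
    have G: "(a, b, c, d) \<in> Gam N" using that(1) by (simp add: in_Gamma0_def)
    have "slash K f0 \<epsilon> a b c d \<tau> = eta_char N r \<epsilon> a b c d * f0 \<tau>"
      using fs that unfolding f0_def K_def Mspace_def by auto
    then have 1: "(of_int \<epsilon> * csqrt (of_int c * \<tau> + of_int d)) powi (- K) * f0 (moeb a b c d \<tau>) = eta_char N r \<epsilon> a b c d * f0 \<tau>"
      unfolding slash_def .
    have f0n: "f0 \<tau> \<noteq> 0" using eta_quotient_nonzero[OF N that(3)] unfolding f0_def .
    have "slash K H \<epsilon> a b c d \<tau> * f0 \<tau> = (of_int \<epsilon> * csqrt (of_int c * \<tau> + of_int d)) powi (- K) * (H (moeb a b c d \<tau>) * f0 \<tau>)"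
      unfolding slash_def by simp
    also have "\<dots> = ((of_int \<epsilon> * csqrt (of_int c * \<tau> + of_int d)) powi (- K) * f0 (moeb a b c d \<tau>)) * H \<tau>"
      unfolding inv[OF G that(3)] by simp
    also have "\<dots> = eta_char N r \<epsilon> a b c d * H \<tau> * f0 \<tau>" unfolding 1 by simp
    finally show ?thesis using f0n by simp
  qed
  have wm: "weakly_modular N r H"
    unfolding weakly_modular_def
  proof (intro allI impI)
    fix a b c d \<tau> assume G: "(a, b, c, d) \<in> Gam N" and \<tau>: "Im \<tau> > 0"
    have nz: "of_int c * \<tau> + of_int d \<noteq> 0" using Im_moeb(1)[OF \<tau>, of a d b c] G by simp
    have "slash K H 1 a b c d \<tau> = eta_char N r 1 a b c d * H \<tau>"
      using H_slash[of a b c d 1 \<tau>] G \<tau> by (simp add: in_Gamma0_def)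
    then show "H (moeb a b c d \<tau>) = eta_char N r 1 a b c d * csqrt (of_int c * \<tau> + of_int d) powi twok N r * H \<tau>"
      using nz unfolding slash_def K_def by (simp add: power_int_minus field_simps)
  qed
  have H_cusp: "cusp_expansion_ok (slash K H 1 a b c d) s" if det: "a * d - b * c = 1" for a b c d
  proof -
    obtain P :: real where P: "P > 0" "\<And>\<tau>. Im \<tau> > 0 \<Longrightarrow> slash K H 1 a b c d (\<tau> + of_real P) = slash K H 1 a b c d \<tau>"
      using slash_periodic[OF N wm det] unfolding K_def by blast
    have "decays s (\<lambda>\<tau>. \<Sum>\<alpha>\<in>hecke_reps N l. cst \<alpha> * slash K (\<lambda>\<tau>. f0 (act (rep_mat l \<alpha>) \<tau>)) 1 a b c d \<tau>)"
      by (intro decays_sum decays_cmult decays_slash_translate f0_cusp l0 det)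
    also have "decays s (\<lambda>\<tau>. \<Sum>\<alpha>\<in>hecke_reps N l. cst \<alpha> * slash K (\<lambda>\<tau>. f0 (act (rep_mat l \<alpha>) \<tau>)) 1 a b c d \<tau>) \<longleftrightarrow>
        decays s (slash K H 1 a b c d)"
    proof (rule decays_cong)
      fix \<tau> :: complex assume "Im \<tau> \<ge> 1"
      then have "Im (moeb a b c d \<tau>) > 0" using det by (intro Im_moeb(3)) auto
      from H_eq[OF this] show "(\<Sum>\<alpha>\<in>hecke_reps N l. cst \<alpha> * slash K (\<lambda>\<tau>. f0 (act (rep_mat l \<alpha>) \<tau>)) 1 a b c d \<tau>) = slash K H 1 a b c d \<tau>"
        unfolding slash_def by (simp add: sum_distrib_left mult_ac)
    qed
    finally have "decays s (slash K H 1 a b c d)" .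
    from cusp_expansion_of_periodic[OF holomorphic_slash[OF H_holo det] P this] show ?thesis .
  qed
  have "H \<tau> = 0" if "Im \<tau> \<le> 0" for \<tau> using that by (simp add: H_def hecke_op_def)
  then show ?thesis
    using H_holo H_slash H_cusp unfolding Mspace_def H_def f0_def K_def by auto
qed

section \<open>Eigenvalues\<close>

lemma vector_space_fscale: "vector_space fscale"
  by unfold_locales (auto simp: fscale_def fun_eq_iff algebra_simps)

lemma cdim_1_imp_multiple:
  assumes "cdim V = 1" "f \<in> V" "g \<in> V" "f \<noteq> 0"
  shows "\<exists>c. g = fscale c f"
proof -
  interpret vs: vector_space fscale by (rule vector_space_fscale)
  obtain B where B: "B \<subseteq> V" "vs.independent B" "V \<subseteq> vs.span B" "card B = vs.dim V"
    by (rule vs.basis_exists)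
  then have "card B = 1" using assms(1) by (simp add: cdim_def)
  then obtain b where b: "B = {b}" by (rule card_1_singletonE)
  have "f \<in> range (\<lambda>k. fscale k b)" "g \<in> range (\<lambda>k. fscale k b)"
    using assms(2,3) B(3) unfolding b vs.span_singleton by auto
  then obtain k1 k2 where k: "f = fscale k1 b" "g = fscale k2 b" by auto
  have "k1 \<noteq> 0" using assms(4) k by auto
  then have "g = fscale (k2 / k1) f" unfolding k by (simp add: fscale_def)
  then show ?thesis ..
qed

theorem hecke_eigenform:
  assumes N: "N > 0" and wa: "weakly_admissible N r" and l: "l \<in> L_f N r"
  shows "\<exists>c. \<forall>\<tau>. hecke_op N r l (eta_quotient N r) \<tau> = c * eta_quotient N r \<tau>"
proof -
  have f: "eta_quotient N r \<in> Mspace N r False" using wa by (simp add: weakly_admissible_def)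
  \<comment> \<open>Either alternative of weak admissibility provides a one-dimensional space that
    contains f.\<close>
  obtain s where s: "cdim (Mspace N r s) = 1" "eta_quotient N r \<in> Mspace N r s"
    using wa unfolding weakly_admissible_def by blast
  have "eta_quotient N r \<noteq> 0"
    using eta_quotient_nonzero[OF N, of \<i> r] by (metis imaginary_unit.simps(2) zero_fun_apply zero_less_one)
  then obtain c where "hecke_op N r l (eta_quotient N r) = fscale c (eta_quotient N r)"
    using cdim_1_imp_multiple[OF s hecke_op_in_Mspace[OF N l f s(2)]] by blast
  then show ?thesis unfolding fscale_def by metis
qed

text \<open>The identity theorem, with Q = 0 left to the vanishing constant term since Q will be an
  exponential.\<close>

lemma powser_coeff_zero:
  fixes B :: "nat \<Rightarrow> complex"
  assumes "B 0 = 0" "\<And>Q. Q \<noteq> 0 \<Longrightarrow> norm Q < 1 \<Longrightarrow> (\<lambda>n. B n * Q ^ n) sums 0"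
  shows "B n = 0"
proof (rule ccontr)
  assume n: "B n \<noteq> 0"
  then have "n > 0" using assms(1) by (cases n) auto
  have sm: "(\<lambda>n. B n * (Q - 0) ^ n) sums (\<lambda>_. 0) Q" if "norm (Q - 0) < 1" for Q
  proof (cases "Q = 0")
    case True
    then have "(\<lambda>n. B n * (Q - 0) ^ n) = (\<lambda>_. 0)" using assms(1) by (auto simp: power_0_left)
    then show ?thesis by simp
  qed (use assms(2)[of Q] that in simp)
  obtain s where s: "0 < s" "\<And>z. z \<in> cball 0 s - {0} \<Longrightarrow> (\<lambda>_::complex. 0 :: complex) z \<noteq> 0"
    using powser_0_nonzero[of 1 0 B "\<lambda>_. 0" n] sm n \<open>n > 0\<close> by auto
  have "of_real s \<in> cball (0::complex) s - {0}" using s(1) by simp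
  from s(2)[OF this] show False by simp
qed

section \<open>Comparison of coefficients\<close>

lemma eta_quotient_sums:
  assumes N: "N > 0" and z: "Im z > 0"
  shows "(\<lambda>m. eta_coeff N r m * eC ((of_int (xN N r) / 24 + of_nat m) * z)) sums eta_quotient N r z"
proof -
  have "(\<lambda>m. eC (of_int (xN N r) * z / 24) * (eta_coeff N r m * eC z ^ m)) sums (eC (of_int (xN N r) * z / 24) * eta_series N r (eC z))"
    by (intro sums_mult eta_series_sums N norm_eC_less_1 z)
  also have "eC (of_int (xN N r) * z / 24) * eta_series N r (eC z) = eta_quotient N r z"
    using eta_quotient_eq[OF N z] by simp
  also have "(\<lambda>m. eC (of_int (xN N r) * z / 24) * (eta_coeff N r m * eC z ^ m)) =
    (\<lambda>m. eta_coeff N r m * eC ((of_int (xN N r) / 24 + of_nat m) * z))"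
  proof
    fix m
    have "eC (of_int (xN N r) * z / 24) * eC z ^ m = eC ((of_int (xN N r) / 24 + of_nat m) * z)"
      unfolding eC_power eC_add[symmetric] by (simp add: algebra_simps)
    then show "eC (of_int (xN N r) * z / 24) * (eta_coeff N r m * eC z ^ m) =
      eta_coeff N r m * eC ((of_int (xN N r) / 24 + of_nat m) * z)" by (simp add: mult_ac)
  qed
  finally show ?thesis .
qed

text \<open>In the common variable Q = e(\<tau>/(24 l)) all exponents are integers: as 1/d = a/l,
  the term of f with exponent x_N/24 + m acquires the exponent (x_N + 24 m) a^2.\<close>

lemma hecke_op_expansion_term:
  assumes N: "N > 0" and \<alpha>: "(a, b) \<in> hecke_reps N l" and l: "l > 0" and \<tau>: "Im \<tau> > 0"
  shows "(\<lambda>m. eta_coeff N r m * ee ((of_int (xN N r) / 24 + real m) * (real b / real (l div a))) *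
      eC (\<tau> / of_nat (24 * l)) powi ((xN N r + 24 * int m) * int a ^ 2)) sums eta_quotient N r (act (rep_mat l (a, b)) \<tau>)"
proof -
  define d where "d = l div a"
  have ad: "l = a * d" "a > 0" "d > 0" using \<alpha> l by (auto simp: hecke_reps_def d_def intro!: Nat.gr0I)
  define z where "z = act (rep_mat l (a, b)) \<tau>"
  have z: "z = (of_nat a * \<tau> + of_nat b) / of_nat d" by (simp add: z_def rep_mat_def moeb_def d_def)
  have Imz: "Im z > 0" unfolding z_def using Im_act[OF \<tau>] rep_mat_det[OF \<alpha> l] l by simp
  have "eC ((of_int (xN N r) / 24 + of_nat m) * z) =
      ee ((of_int (xN N r) / 24 + real m) * (real b / real d)) * eC (\<tau> / of_nat (24 * l)) powi ((xN N r + 24 * int m) * int a ^ 2)" for m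
  proof -
    have "z = of_nat (24 * a ^ 2) * (\<tau> / of_nat (24 * l)) + of_nat b / of_nat d"
      unfolding z ad(1) using ad(2,3) by (simp add: field_simps power2_eq_square)
    then have "(of_int (xN N r) / 24 + of_nat m) * z =
        (of_int (xN N r) / 24 + of_nat m) * of_nat (24 * a ^ 2) * (\<tau> / of_nat (24 * l)) + (of_int (xN N r) / 24 + of_nat m) * (of_nat b / of_nat d)"
      by (simp only: distrib_left mult.assoc)
    also have "(of_int (xN N r) / 24 + of_nat m) * of_nat (24 * a ^ 2) = (of_int ((xN N r + 24 * int m) * int a ^ 2) :: complex)"
      by (simp add: field_simps)
    also have "(of_int (xN N r) / 24 + of_nat m) * (of_nat b / of_nat d) =
        complex_of_real ((of_int (xN N r) / 24 + real m) * (real b / real d))" by simp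
    finally have eq: "(of_int (xN N r) / 24 + of_nat m) * z = of_int ((xN N r + 24 * int m) * int a ^ 2) * (\<tau> / of_nat (24 * l)) +
        complex_of_real ((of_int (xN N r) / 24 + real m) * (real b / real d))" .
    show ?thesis unfolding eq eC_add eC_powi eC_of_real by (rule mult.commute)
  qed
  then show ?thesis using eta_quotient_sums[OF N Imz, of r] unfolding z_def[symmetric] d_def[symmetric] by (simp only: mult.assoc)
qed

text \<open>Multiplication by Q^S makes all exponents positive, which gives an ordinary power
  series. The description \<open>THE m\<close> recovers the index, since the exponent is strictly
  increasing in m.\<close>

lemma sums_extend:
  fixes h :: "nat \<Rightarrow> complex"
  assumes "K > 0" "\<And>m. (x + 24 * int m) * K + S > 0" "Q \<noteq> 0"
    and "(\<lambda>m. h m * Q powi ((x + 24 * int m) * K)) sums v"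
  shows "(\<lambda>n. (if \<exists>m. int n = (x + 24 * int m) * K + S then h (THE m. int n = (x + 24 * int m) * K + S) else 0) * Q ^ n) sums (v * Q powi S)"
proof -
  define e where "e m = nat ((x + 24 * int m) * K + S)" for m
  have e: "int (e m) = (x + 24 * int m) * K + S" for m
    using assms(2)[of m] by (simp add: e_def)
  have mono: "strict_mono e"
  proof (rule strict_monoI)
    fix m m' :: nat assume "m < m'"
    then have "(x + 24 * int m) * K < (x + 24 * int m') * K"
      using assms(1) by (intro mult_strict_right_mono) auto
    then show "e m < e m'" using e[of m] e[of m'] by linarith
  qed
  define F where "F n = (if \<exists>m. int n = (x + 24 * int m) * K + S then h (THE m. int n = (x + 24 * int m) * K + S) else 0) * Q ^ n" for n
  have "F (e m) = h m * Q powi ((x + 24 * int m) * K) * Q powi S" for m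
  proof -
    have iff: "int (e m) = (x + 24 * int m') * K + S \<longleftrightarrow> m' = m" for m'
      unfolding e[symmetric] using strict_mono_eq[OF mono] by auto
    have "Q ^ e m = Q powi int (e m)" by (simp add: power_int_def)
    also have "\<dots> = Q powi ((x + 24 * int m) * K) * Q powi S" unfolding e using assms(3) by (simp add: power_int_add)
    finally show ?thesis unfolding F_def iff by (simp add: mult.assoc)
  qed
  then have "(\<lambda>m. F (e m)) sums (v * Q powi S)" using sums_mult2[OF assms(4), of "Q powi S"] by simp
  moreover have "F n = 0" if "n \<notin> range e" for n
  proof -
    have "\<not> (\<exists>m. int n = (x + 24 * int m) * K + S)"
      using that unfolding e[symmetric] by auto
    then show ?thesis by (simp add: F_def)
  qed
  ultimately have "F sums (v * Q powi S)" using sums_mono_reindex[OF mono] by blast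
  then show ?thesis unfolding F_def .
qed

lemma coeff_c_eq:
  assumes N: "N > 0" and l: "l > 0"
  shows "coeff_c N r l = of_real (real l powr (- wt N r / 2)) *
    (\<Sum>(a, b)\<in>hecke_reps N l. hecke_weight N r l a b * of_real (real a powr wt N r) *
      (cf N r (real l * of_int (xN N r) / (24 * real a ^ 2)) * ee (real b * real (l div a) * of_int (xN N r) / (24 * real l))))"
proof -
  define A where "A = {a. a dvd l \<and> coprime a N}"
  define B where "B a = {b. b < l div a \<and> gcd (gcd a b) (l div a) = 1}" for a
  define T where "T a b = hecke_weight N r l a b * of_real (real a powr wt N r) *
      (cf N r (real l * of_int (xN N r) / (24 * real a ^ 2)) * ee (real b * real (l div a) * of_int (xN N r) / (24 * real l)))" for a b
  have "finite A" using l by (auto simp: A_def intro: finite_subset[of _ "{d. d dvd l}"])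
  moreover have "\<forall>a\<in>A. finite (B a)" by (auto simp: B_def)
  ultimately have "(\<Sum>a\<in>A. \<Sum>b\<in>B a. T a b) = (\<Sum>(a, b)\<in>Sigma A B. T a b)" by (rule sum.Sigma)
  also have "Sigma A B = hecke_reps N l" by (auto simp: A_def B_def hecke_reps_def)
  finally have "(\<Sum>(a, b)\<in>hecke_reps N l. T a b) = (\<Sum>a\<in>A. \<Sum>b\<in>B a. T a b)" ..
  also have "\<dots> = (\<Sum>a\<in>A. of_int (kronecker (int a) (int (varpi N r))) * of_real (real a powr wt N r) *
        cf N r (real l * of_int (xN N r) / (24 * real a ^ 2)) *
        (\<Sum>b\<in>B a. of_int (kronecker (- int N * int b) (int (gcd a (l div a)))) powi twok N r *
           ee (real b * real (l div a) * (of_int (xN N r) / (24 * real l) - of_int (xN N r) / 24)) * psi_lr N r l a b))"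
    unfolding sum_distrib_left
  proof (intro sum.cong refl)
    fix a b
    have "real b * real (l div a) * (of_int (xN N r) / (24 * real l) - of_int (xN N r) / 24) =
      - of_int (int b * int (l div a) * xN N r) / 24 + real b * real (l div a) * of_int (xN N r) / (24 * real l)"
      by (simp add: algebra_simps)
    then have "ee (real b * real (l div a) * (of_int (xN N r) / (24 * real l) - of_int (xN N r) / 24)) =
      ee (- of_int (int b * int (l div a) * xN N r) / 24) * ee (real b * real (l div a) * of_int (xN N r) / (24 * real l))"
      by (simp only: ee_add)
    then show "T a b = of_int (kronecker (int a) (int (varpi N r))) * of_real (real a powr wt N r) *
        cf N r (real l * of_int (xN N r) / (24 * real a ^ 2)) *
        (of_int (kronecker (- int N * int b) (int (gcd a (l div a)))) powi twok N r *
           ee (real b * real (l div a) * (of_int (xN N r) / (24 * real l) - of_int (xN N r) / 24)) * psi_lr N r l a b)"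
      unfolding T_def hecke_weight_def by (simp only: mult_ac)
  qed
  finally show ?thesis unfolding coeff_c_def T_def A_def B_def by simp
qed

lemma cf_eq_eta_coeff: "cf N r (of_int (xN N r) / 24 + real m) = eta_coeff N r m"
  by (simp add: cf_def eta_coeff_def)

text \<open>The leading coefficient of f is 1, so the eigenvalue is the coefficient of e(x_N
  \<tau>/24) in T_l f; in the variable Q = e(\<tau>/(24 l)) this is the coefficient of Q^(x_N
  l).\<close>

theorem eigenvalue_eq_coeff_c:
  assumes N: "N > 0" and l: "l > 0"
    and eig: "\<And>\<tau>. Im \<tau> > 0 \<Longrightarrow> hecke_op N r l (eta_quotient N r) \<tau> = c * eta_quotient N r \<tau>"
  shows "coeff_c N r l = c"
proof -
  define x where "x = xN N r"
  define p where "p = eta_coeff N r"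
  \<comment> \<open>Large enough that (x + 24 m) K + S > 0 for 0 < K \<le> l^2, which covers K = a^2
    for the terms of T_l f and K = l for f.\<close>
  define S where "S = \<bar>x\<bar> * int l ^ 2 + 1"
  define E where "E K m = (x + 24 * int m) * K + S" for K m
  have Epos: "E K m > 0" if "0 < K" "K \<le> int l ^ 2" for K m
  proof -
    have "- x * K \<le> \<bar>x\<bar> * int l ^ 2"
      using that by (intro mult_mono) auto
    moreover have "(24 * int m) * K \<ge> 0" using that by simp
    moreover have "E K m = - (- x * K) + (24 * int m) * K + S" by (simp add: E_def algebra_simps)
    ultimately show ?thesis unfolding S_def by linarith
  qed
  define ser where "ser K h n = (if \<exists>m. int n = E K m then h (THE m. int n = E K m) else (0::complex))" for K h n
  define hh where "hh a b m = p m * ee ((of_int x / 24 + real m) * (real b / real (l div a)))" for a b m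
  define cst where "cst \<alpha> = complex_of_real (real l powr (- wt N r / 2)) * (hecke_weight N r l (fst \<alpha>) (snd \<alpha>) * of_real (real (fst \<alpha>) powr wt N r))" for \<alpha>
  define B where "B n = (\<Sum>\<alpha>\<in>hecke_reps N l. cst \<alpha> * ser (int (fst \<alpha>) ^ 2) (hh (fst \<alpha>) (snd \<alpha>)) n) - c * ser (int l) p n" for n
  have a_le: "0 < int a ^ 2" "int a ^ 2 \<le> int l ^ 2" if "(a, b) \<in> hecke_reps N l" for a b
    using that l by (auto simp: hecke_reps_def dvd_imp_le intro!: Nat.gr0I power_mono)
  have l_le: "0 < int l" "int l \<le> int l ^ 2"
    using l self_le_power[of "int l" 2] by auto
  have ser0: "ser K h 0 = 0" if "0 < K" "K \<le> int l ^ 2" for K h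
    using Epos[OF that] unfolding ser_def by (metis less_irrefl of_nat_0)
  have "B n = 0" for n
  proof (rule powser_coeff_zero)
    have "cst \<alpha> * ser (int (fst \<alpha>) ^ 2) (hh (fst \<alpha>) (snd \<alpha>)) 0 = 0" if "\<alpha> \<in> hecke_reps N l" for \<alpha>
      using ser0[OF a_le[of "fst \<alpha>" "snd \<alpha>"]] that by simp
    then show "B 0 = 0" unfolding B_def using ser0[OF l_le, of p] by (simp add: sum.neutral)
  next
    fix Q :: complex assume Q: "Q \<noteq> 0" "norm Q < 1"
    define \<tau> where "\<tau> = of_nat (24 * l) * (Ln Q / (2 * of_real pi * \<i>))"
    have QE: "eC (\<tau> / of_nat (24 * l)) = Q"
      using Q(1) l by (simp add: \<tau>_def eC_def)
    have "Im (Ln Q / (2 * of_real pi * \<i>)) = - ln (norm Q) / (2 * pi)"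
      using Q(1) by (simp add: Im_divide power2_eq_square)
    moreover have "\<dots> > 0" using Q by (simp add: divide_neg_pos)
    moreover have "Im \<tau> = real (24 * l) * Im (Ln Q / (2 * of_real pi * \<i>))"
      unfolding \<tau>_def by (metis Im_complex_of_real Re_complex_of_real add.right_neutral mult_zero_left of_real_of_nat_eq times_complex.simps(2))
    ultimately have \<tau>: "Im \<tau> > 0" using l by (metis mult_pos_pos of_nat_0_less_iff zero_less_numeral)
    have L: "(\<lambda>n. ser (int (fst \<alpha>) ^ 2) (hh (fst \<alpha>) (snd \<alpha>)) n * Q ^ n) sums (eta_quotient N r (act (rep_mat l \<alpha>) \<tau>) * Q powi S)"
      if "\<alpha> \<in> hecke_reps N l" for \<alpha>
    proof -
      have \<alpha>: "(fst \<alpha>, snd \<alpha>) \<in> hecke_reps N l" using that by simp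
      show ?thesis unfolding ser_def E_def
        using sums_extend[OF a_le(1)[OF \<alpha>] Epos[OF a_le[OF \<alpha>], unfolded E_def] Q(1)
          hecke_op_expansion_term[OF N \<alpha> l \<tau>, where r = r, unfolded QE, folded x_def p_def, folded hh_def]] by simp
    qed
    have "eC ((of_int (xN N r) / 24 + of_nat m) * \<tau>) = Q powi ((x + 24 * int m) * int l)" for m
    proof -
      have "(of_int (xN N r) / 24 + of_nat m) * \<tau> = of_int ((x + 24 * int m) * int l) * (\<tau> / of_nat (24 * l))"
        using l by (simp add: field_simps x_def)
      then show ?thesis unfolding QE[symmetric] eC_powi by simp
    qed
    then have R: "(\<lambda>n. ser (int l) p n * Q ^ n) sums (eta_quotient N r \<tau> * Q powi S)"
      unfolding ser_def E_def
      using sums_extend[OF l_le(1) Epos[OF l_le, unfolded E_def] Q(1)] eta_quotient_sums[OF N \<tau>, of r]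
      by (simp add: p_def)
    have "(\<lambda>n. (\<Sum>\<alpha>\<in>hecke_reps N l. cst \<alpha> * (ser (int (fst \<alpha>) ^ 2) (hh (fst \<alpha>) (snd \<alpha>)) n * Q ^ n)) - c * (ser (int l) p n * Q ^ n)) sums
       ((\<Sum>\<alpha>\<in>hecke_reps N l. cst \<alpha> * (eta_quotient N r (act (rep_mat l \<alpha>) \<tau>) * Q powi S)) - c * (eta_quotient N r \<tau> * Q powi S))"
      by (intro sums_diff sums_sum sums_mult L R)
    also have "(\<Sum>\<alpha>\<in>hecke_reps N l. cst \<alpha> * (eta_quotient N r (act (rep_mat l \<alpha>) \<tau>) * Q powi S)) =
        hecke_op N r l (eta_quotient N r) \<tau> * Q powi S"
      using \<tau> by (simp add: hecke_op_def cst_def sum_distrib_left sum_distrib_right mult.assoc)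
    also have "\<dots> - c * (eta_quotient N r \<tau> * Q powi S) = 0" using eig[OF \<tau>] by simp
    finally show "(\<lambda>n. B n * Q ^ n) sums 0"
      by (simp add: B_def left_diff_distrib sum_distrib_right mult.assoc)
  qed
  define n where "n = nat (E (int l) 0)"
  have n: "int n = x * int l + S" using Epos[OF l_le, of 0] by (simp add: n_def E_def)
  have "int n = E (int l) m \<longleftrightarrow> m = 0" for m
    unfolding n E_def using l by (simp add: distrib_right)
  then have rhs: "ser (int l) p n = 1" by (simp add: ser_def p_def eta_coeff_0)
  have lhs: "ser (int a ^ 2) (hh a b) n = cf N r (real l * of_int (xN N r) / (24 * real a ^ 2)) * ee (real b * real (l div a) * of_int (xN N r) / (24 * real l))"
    if ab: "(a, b) \<in> hecke_reps N l" for a b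
  proof -
    define d where "d = l div a"
    have ad: "l = a * d" "a > 0" "d > 0" using ab l by (auto simp: hecke_reps_def d_def intro!: Nat.gr0I)
    define y where "y = real l * of_int x / (24 * real a ^ 2)"
    have iff: "int n = E (int a ^ 2) m \<longleftrightarrow> y = of_int x / 24 + real m" for m
    proof -
      \<comment> \<open>The exponent x l is met exactly if l x/(24 a^2) = x/24 + m, whence the
        argument of c_f in c_l.\<close>
      have "int n = E (int a ^ 2) m \<longleftrightarrow> x * int l = (x + 24 * int m) * int a ^ 2" unfolding n E_def by simp
      also have "\<dots> \<longleftrightarrow> real_of_int (x * int l) = real_of_int ((x + 24 * int m) * int a ^ 2)"
        by (simp only: of_int_eq_iff)
      also have "\<dots> \<longleftrightarrow> y = of_int x / 24 + real m"
        unfolding y_def using ad(2) by (simp add: field_simps)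
      finally show ?thesis .
    qed
    show ?thesis
    proof (cases "\<exists>m. int n = E (int a ^ 2) m")
      case True
      then obtain m where m: "int n = E (int a ^ 2) m" ..
      then have y: "y = of_int x / 24 + real m" using iff by simp
      have "(THE m. int n = E (int a ^ 2) m) = m" using m unfolding iff by (intro the_equality) auto
      then have "ser (int a ^ 2) (hh a b) n = hh a b m" using True by (simp add: ser_def)
      also have "\<dots> = cf N r y * ee (y * (real b / real d))"
        unfolding hh_def p_def y d_def x_def cf_eq_eta_coeff ..
      also have "y * (real b / real d) = real b * real d * of_int x / (24 * real l)"
        unfolding y_def ad(1) using ad(2,3) by (simp add: field_simps power2_eq_square)
      finally show ?thesis unfolding y_def d_def x_def .
    next
      case False
      \<comment> \<open>Here the convention c_f(y) = 0 outside the support matches the absence of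
        such a term.\<close>
      have "cf N r y = 0"
      proof (rule ccontr)
        assume "cf N r y \<noteq> 0"
        then have "y - of_int x / 24 \<in> \<nat>" unfolding cf_def x_def by (metis)
        then obtain m where "y - of_int x / 24 = of_nat m" by (rule Nats_cases)
        then have "y = of_int x / 24 + real m" by simp
        with False iff show False by blast
      qed
      then show ?thesis using False by (simp add: ser_def y_def x_def)
    qed
  qed
  have "c = (\<Sum>\<alpha>\<in>hecke_reps N l. cst \<alpha> * ser (int (fst \<alpha>) ^ 2) (hh (fst \<alpha>) (snd \<alpha>)) n)"
    using \<open>B n = 0\<close> rhs unfolding B_def by simp
  also have "\<dots> = (\<Sum>(a, b)\<in>hecke_reps N l. cst (a, b) * (cf N r (real l * of_int (xN N r) / (24 * real a ^ 2)) * ee (real b * real (l div a) * of_int (xN N r) / (24 * real l))))"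
    using lhs by (intro sum.cong) auto
  also have "\<dots> = coeff_c N r l"
    unfolding coeff_c_eq[OF N l] sum_distrib_left by (intro sum.cong) (auto simp: cst_def mult_ac)
  finally show ?thesis ..
qed

section \<open>Composition of Hecke operators\<close>

lemma gcd3_eq_1_iff: "gcd (gcd a b) d = 1 \<longleftrightarrow> \<not> (\<exists>p. prime p \<and> p dvd a \<and> p dvd b \<and> p dvd (d::nat))"
proof
  assume "gcd (gcd a b) d = 1"
  then show "\<not> (\<exists>p. prime p \<and> p dvd a \<and> p dvd b \<and> p dvd d)"
    by (metis gcd_greatest nat_dvd_1_iff_1 not_prime_1)
next
  assume *: "\<not> (\<exists>p. prime p \<and> p dvd a \<and> p dvd b \<and> p dvd d)"
  show "gcd (gcd a b) d = 1"
  proof (rule ccontr)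
    assume "gcd (gcd a b) d \<noteq> 1"
    then obtain p where "prime p" "p dvd gcd (gcd a b) d" using prime_factor_nat by blast
    with * show False by auto
  qed
qed

lemma gcd3_mod: "gcd (gcd a (b mod d)) d = gcd (gcd a b) (d::nat)"
  by (metis gcd.assoc gcd.commute gcd_red_nat)

text \<open>A prime divides at most one of a1 d1 and a2 d2, so both sides can be compared one prime
  at a time.\<close>

lemma primitive_mult_iff:
  fixes a1 a2 b1 b2 d1 d2 :: nat
  assumes cop: "coprime (a1 * d1) (a2 * d2)"
  shows "gcd (gcd (a1 * a2) (a2 * b1 + b2 * d1)) (d1 * d2) = 1 \<longleftrightarrow> gcd (gcd a1 b1) d1 = 1 \<and> gcd (gcd a2 b2) d2 = 1"
proof -
  have no: "\<not> (p dvd a1 * d1 \<and> p dvd a2 * d2)" if "prime p" for p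
    using cop that by (meson coprime_common_divisor not_prime_unit)
  have "(p dvd a1 * a2 \<and> p dvd a2 * b1 + b2 * d1 \<and> p dvd d1 * d2) \<longleftrightarrow>
     (p dvd a1 \<and> p dvd b1 \<and> p dvd d1) \<or> (p dvd a2 \<and> p dvd b2 \<and> p dvd d2)" if p: "prime p" for p
    using no[OF p] by (auto simp: prime_dvd_mult_iff[OF p] dvd_add_right_iff dvd_add_left_iff)
  then show ?thesis unfolding gcd3_eq_1_iff by blast
qed

text \<open>The product of the representatives, the one for l2 on the left, with the upper right
  entry reduced by a left translation.\<close>

definition rep_prod :: "nat \<Rightarrow> nat \<Rightarrow> (nat \<times> nat) \<times> (nat \<times> nat) \<Rightarrow> nat \<times> nat" where
  "rep_prod l1 l2 = (\<lambda>((a1, b1), (a2, b2)).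
     (a1 * a2, (a2 * b1 + b2 * (l1 div a1)) mod ((l1 div a1) * (l2 div a2))))"

lemma hecke_repsE:
  assumes "\<alpha> \<in> hecke_reps N l" "l > 0"
  obtains a b d where "\<alpha> = (a, b)" "l = a * d" "a > 0" "d > 0" "l div a = d" "coprime a N" "b < d" "gcd (gcd a b) d = 1"
proof -
  obtain a b where ab: "\<alpha> = (a, b)" by (cases \<alpha>)
  then have "a dvd l" and *: "coprime a N" "b < l div a" "gcd (gcd a b) (l div a) = 1"
    using assms(1) by (auto simp: hecke_reps_def)
  then obtain d where d: "l = a * d" by blast
  then have "a > 0" "d > 0" using assms(2) by auto
  then show ?thesis using that[OF ab d] * d by simp
qed

text \<open>Injective: a1 is gcd(a1 a2, l1), then b1 is determined modulo d1 because a2 is a unit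
  there, then b2 modulo d2. Surjective: the same congruences are solved for given b.\<close>

lemma bij_rep_prod:
  assumes cop: "coprime l1 l2" and pos: "l1 > 0" "l2 > 0"
  shows "bij_betw (rep_prod l1 l2) (hecke_reps N l1 \<times> hecke_reps N l2) (hecke_reps N (l1 * l2))"
proof (rule bij_betwI')
  fix x y
  assume "x \<in> hecke_reps N l1 \<times> hecke_reps N l2" "y \<in> hecke_reps N l1 \<times> hecke_reps N l2"
  then obtain x1 x2 y1 y2 where xy: "x = (x1, x2)" "y = (y1, y2)"
    "x1 \<in> hecke_reps N l1" "x2 \<in> hecke_reps N l2" "y1 \<in> hecke_reps N l1" "y2 \<in> hecke_reps N l2" by auto
  obtain a1 b1 d1 where 1: "x1 = (a1, b1)" "l1 = a1 * d1" "a1 > 0" "d1 > 0" "l1 div a1 = d1" "b1 < d1"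
    using hecke_repsE[OF xy(3) pos(1)] by metis
  obtain a2 b2 d2 where 2: "x2 = (a2, b2)" "l2 = a2 * d2" "a2 > 0" "d2 > 0" "l2 div a2 = d2" "b2 < d2"
    using hecke_repsE[OF xy(4) pos(2)] by metis
  obtain a1' b1' d1' where p1: "y1 = (a1', b1')" "l1 = a1' * d1'" "a1' > 0" "l1 div a1' = d1'" "b1' < d1'"
    using hecke_repsE[OF xy(5) pos(1)] by metis
  obtain a2' b2' d2' where p2: "y2 = (a2', b2')" "l2 = a2' * d2'" "a2' > 0" "l2 div a2' = d2'" "b2' < d2'"
    using hecke_repsE[OF xy(6) pos(2)] by metis
  show "(rep_prod l1 l2 x = rep_prod l1 l2 y) = (x = y)"
  proof
    assume "rep_prod l1 l2 x = rep_prod l1 l2 y"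
    then have A: "a1 * a2 = a1' * a2'"
      and Bm: "(a2 * b1 + b2 * d1) mod (d1 * d2) = (a2' * b1' + b2' * d1') mod (d1' * d2')"
      unfolding xy rep_prod_def 1(1) 2(1) p1(1) p2(1) by (auto simp: 1(5) 2(5) p1(4) p2(4))
    have g: "gcd (a * a') l1 = a" if "a dvd l1" "a' dvd l2" for a a'
    proof -
      have "coprime a' l1" using cop that(2) by (meson coprime_commute coprime_divisors dvd_refl)
      then have "gcd (a * a') l1 = gcd a l1" by (metis coprime_commute gcd.commute gcd_mult_left_right_cancel)
      then show ?thesis using that(1) by simp
    qed
    have a1: "a1 = a1'"
      using g[of a1 a2] g[of a1' a2'] A 1(2) 2(2) p1(2) p2(2) by (metis dvd_triv_left)
    then have a2: "a2 = a2'" using A 1(3) by simp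
    have d: "d1 = d1'" "d2 = d2'" using a1 a2 1(5) p1(4) 2(5) p2(4) by auto
    have C: "[a2 * b1 + b2 * d1 = a2 * b1' + b2' * d1] (mod (d1 * d2))"
      using Bm unfolding a1[symmetric] a2[symmetric] d[symmetric] by (simp add: cong_def)
    have "[a2 * b1 = a2 * b1'] (mod d1)"
      using cong_dvd_modulus_nat[OF C, of d1] by (simp add: cong_def)
    moreover have "coprime a2 d1" using cop unfolding 1(2) 2(2) by (simp add: ac_simps)
    ultimately have "[b1 = b1'] (mod d1)" by (simp add: cong_mult_lcancel_nat)
    then have b1: "b1 = b1'" using 1(6) p1(5) d by (simp add: cong_def)
    have "[b2 * d1 = b2' * d1] (mod (d1 * d2))"
      using C unfolding b1 by (simp add: cong_add_lcancel_nat)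
    then have "[b2 = b2'] (mod d2)"
      using 1(4) by (simp add: cong_def mult.commute[of _ d1] mod_mult_mult1)
    then have "b2 = b2'" using 2(6) p2(5) d by (simp add: cong_def)
    then show "x = y" unfolding xy 1(1) 2(1) p1(1) p2(1) using a1 a2 b1 by simp
  qed simp
next
  fix x
  assume "x \<in> hecke_reps N l1 \<times> hecke_reps N l2"
  then obtain x1 x2 where x: "x = (x1, x2)" "x1 \<in> hecke_reps N l1" "x2 \<in> hecke_reps N l2" by auto
  obtain a1 b1 d1 where 1: "x1 = (a1, b1)" "l1 = a1 * d1" "a1 > 0" "d1 > 0" "l1 div a1 = d1" "coprime a1 N" "b1 < d1" "gcd (gcd a1 b1) d1 = 1"
    using hecke_repsE[OF x(2) pos(1)] by metis
  obtain a2 b2 d2 where 2: "x2 = (a2, b2)" "l2 = a2 * d2" "a2 > 0" "d2 > 0" "l2 div a2 = d2" "coprime a2 N" "b2 < d2" "gcd (gcd a2 b2) d2 = 1"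
    using hecke_repsE[OF x(3) pos(2)] by metis
  have "l1 * l2 = a1 * a2 * (d1 * d2)" unfolding 1(2) 2(2) by simp
  then have "l1 * l2 div (a1 * a2) = d1 * d2" "a1 * a2 dvd l1 * l2" using 1(3) 2(3) by auto
  moreover have "gcd (gcd (a1 * a2) (a2 * b1 + b2 * d1)) (d1 * d2) = 1"
    using primitive_mult_iff[OF cop[unfolded 1(2) 2(2)], THEN iffD2] 1(8) 2(8) by simp
  ultimately show "rep_prod l1 l2 x \<in> hecke_reps N (l1 * l2)"
    unfolding x(1) 1(1) 2(1) rep_prod_def hecke_reps_def
    using 1(4-6) 2(4-6) by (simp add: gcd3_mod)
next
  fix y assume "y \<in> hecke_reps N (l1 * l2)"
  then obtain a b D where y: "y = (a, b)" "l1 * l2 = a * D" "a > 0" "D > 0" "coprime a N" "b < D" "gcd (gcd a b) D = 1"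
    using hecke_repsE[of y N "l1 * l2"] pos by (metis nat_0_less_mult_iff)
  then have "a dvd l1 * l2" by simp
  then obtain a1 a2 where a: "a = a1 * a2" "a1 dvd l1" "a2 dvd l2" using division_decomp by blast
  then obtain d1 d2 where d: "l1 = a1 * d1" "l2 = a2 * d2" by (metis dvdE)
  have p: "a1 > 0" "a2 > 0" "d1 > 0" "d2 > 0" using pos d by auto
  have D: "D = d1 * d2" using y(2,3) unfolding d a(1) by (metis mult.assoc mult.left_commute mult_left_cancel nat_less_le)
  have "coprime a2 d1" using cop unfolding d by (simp add: ac_simps)
  then obtain t where "[a2 * t = Suc 0] (mod d1)" using cong_solve_coprime_nat by blast
  then have "[a2 * (t * b) = b] (mod d1)"
    using cong_mult[OF _ cong_refl, of "a2 * t" "Suc 0" d1 b] by (simp add: mult.assoc)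
  define b1 where "b1 = (t * b) mod d1"
  have b1: "b1 < d1" "[a2 * b1 = b] (mod d1)"
    using p \<open>[a2 * (t * b) = b] (mod d1)\<close> by (auto simp: b1_def cong_def mod_mult_right_eq)
  then have "int d1 dvd int b - int (a2 * b1)"
    by (metis cong_iff_dvd_diff cong_int_iff cong_sym)
  \<comment> \<open>s may be negative, so it is taken in the integers; b2 is its residue modulo
    d2.\<close>
  then obtain s where s: "int b - int (a2 * b1) = int d1 * s" by (rule dvdE)
  define b2 where "b2 = nat (s mod int d2)"
  have b2: "int b2 = s mod int d2" "b2 < d2" using p by (auto simp: b2_def nat_less_iff)
  have "int (a2 * b1 + b2 * d1) = int b - int d1 * int d2 * (s div int d2)"
  proof -
    have "s mod int d2 = s - int d2 * (s div int d2)" by (simp add: minus_mult_div_eq_mod)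
    then have "int d1 * int b2 = int d1 * s - int d1 * int d2 * (s div int d2)"
      unfolding b2(1) by (simp only: right_diff_distrib mult.assoc)
    then show ?thesis using s by (simp add: mult.commute)
  qed
  also have "\<dots> = int b + int D * (- (s div int d2))" unfolding D by simp
  finally have "int (a2 * b1 + b2 * d1) mod int D = int b mod int D" by (simp only: mod_mult_self2)
  then have "(a2 * b1 + b2 * d1) mod D = b mod D" unfolding zmod_int[symmetric] of_nat_eq_iff .
  then have bm: "(a2 * b1 + b2 * d1) mod D = b" using y(6) by simp
  have "gcd (gcd (a1 * a2) (a2 * b1 + b2 * d1)) (d1 * d2) = 1"
    using y(7) unfolding bm[symmetric] gcd3_mod D a(1) by simp
  then have "gcd (gcd a1 b1) d1 = 1 \<and> gcd (gcd a2 b2) d2 = 1"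
    by (rule primitive_mult_iff[OF cop[unfolded d], THEN iffD1])
  then have "((a1, b1), (a2, b2)) \<in> hecke_reps N l1 \<times> hecke_reps N l2"
    using y(5) p b1 b2 unfolding a(1) d hecke_reps_def by simp
  moreover have "rep_prod l1 l2 ((a1, b1), (a2, b2)) = y"
    unfolding rep_prod_def y(1) using bm p by (simp add: d a(1) D)
  ultimately show "\<exists>x\<in>hecke_reps N l1 \<times> hecke_reps N l2. y = rep_prod l1 l2 x" by (metis)
qed

text \<open>Reducing the product representative shifts it by a translation by j. The weight and f
  then change by inverse roots of unity, so the summands of both operators agree along
  \<open>rep_prod\<close>.\<close>

theorem hecke_op_mult:
  assumes N: "N > 0" and l: "l1 \<in> L_f N r" "l2 \<in> L_f N r" and cop: "coprime l1 l2" and \<tau>: "Im \<tau> > 0"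
  shows "hecke_op N r (l1 * l2) (eta_quotient N r) \<tau> = hecke_op N r l1 (hecke_op N r l2 (eta_quotient N r)) \<tau>"
proof -
  define f where "f = eta_quotient N r"
  define k where "k = wt N r"
  define w where "w = hecke_weight N r"
  define T where "T l \<alpha> \<tau> = w l (fst \<alpha>) (snd \<alpha>) * of_real (real (fst \<alpha>) powr k) * f (act (rep_mat l \<alpha>) \<tau>)" for l \<alpha> \<tau>
  have pos: "l1 > 0" "l2 > 0" using l by (auto simp: L_f_def)
  have T: "T (l1 * l2) (rep_prod l1 l2 (\<alpha>1, \<alpha>2)) \<tau> =
      w l1 (fst \<alpha>1) (snd \<alpha>1) * of_real (real (fst \<alpha>1) powr k) * T l2 \<alpha>2 (act (rep_mat l1 \<alpha>1) \<tau>)"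
    if \<alpha>: "\<alpha>1 \<in> hecke_reps N l1" "\<alpha>2 \<in> hecke_reps N l2" for \<alpha>1 \<alpha>2
  proof -
    obtain a1 b1 d1 where 1: "\<alpha>1 = (a1, b1)" "l1 = a1 * d1" "a1 > 0" "d1 > 0" "l1 div a1 = d1" "coprime a1 N" "b1 < d1" "gcd (gcd a1 b1) d1 = 1"
      using hecke_repsE[OF \<alpha>(1) pos(1)] by metis
    obtain a2 b2 d2 where 2: "\<alpha>2 = (a2, b2)" "l2 = a2 * d2" "a2 > 0" "d2 > 0" "l2 div a2 = d2" "coprime a2 N" "b2 < d2" "gcd (gcd a2 b2) d2 = 1"
      using hecke_repsE[OF \<alpha>(2) pos(2)] by metis
    define a D B where "a = a1 * a2" and "D = d1 * d2" and "B = a2 * b1 + b2 * d1"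
    define j b where "j = B div D" and "b = B mod D"
    have B: "B = b + j * D" by (simp add: j_def b_def)
    have prim: "gcd (gcd a B) D = 1" unfolding a_def B_def D_def
      using primitive_mult_iff[OF cop[unfolded 1(2) 2(2)], THEN iffD2] 1(8) 2(8) by simp
    have lD: "l1 * l2 = a * D" "a > 0" "D > 0" unfolding a_def D_def using 1 2 by auto
    have div: "l1 * l2 div a = D" using lD by simp
    have aN: "coprime a N" unfolding a_def using 1(6) 2(6) by simp
    have "w (l1 * l2) a B = w (l1 * l2) a b * ee (- of_int (int j * xN N r) / 24)"
      unfolding w_def B
      using hecke_weight_translate[OF N L_f_mult[OF l] lD(1) aN, of b j] prim
      by (simp add: b_def gcd3_mod)
    moreover have "w (l1 * l2) a B = w l1 a1 b1 * w l2 a2 b2"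
      unfolding w_def a_def B_def
      using hecke_weight_mult[OF N l cop 1(2) 2(2) 1(6,8) 2(6,8)] prim[unfolded a_def B_def D_def] by simp
    ultimately have W: "w l1 a1 b1 * w l2 a2 b2 = w (l1 * l2) a b * ee (- of_int (int j * xN N r) / 24)" by simp
    define z where "z = (of_nat a * \<tau> + of_nat b) / of_nat D"
    have z: "act (rep_mat (l1 * l2) (a, b)) \<tau> = z" by (simp add: z_def rep_mat_def moeb_def div)
    have Imz: "Im z > 0" unfolding z_def using \<tau> lD by simp
    have "act (rep_mat l2 (a2, b2)) (act (rep_mat l1 (a1, b1)) \<tau>) = (of_nat a * \<tau> + of_nat B) / of_nat D"
      using 1(4) 2(4) unfolding a_def B_def D_def
      by (simp add: rep_mat_def moeb_def 1(5) 2(5) field_simps)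
    also have "\<dots> = z + of_int (int j)" unfolding z_def B using lD(3) by (simp add: field_simps)
    finally have "f (act (rep_mat l2 (a2, b2)) (act (rep_mat l1 (a1, b1)) \<tau>)) = ee (of_int (int j * xN N r) / 24) * f z"
      unfolding f_def by (simp only: eta_quotient_translate[OF N Imz])
    then have "w l1 a1 b1 * w l2 a2 b2 * f (act (rep_mat l2 (a2, b2)) (act (rep_mat l1 (a1, b1)) \<tau>)) =
       w (l1 * l2) a b * f z * (ee (- of_int (int j * xN N r) / 24) * ee (of_int (int j * xN N r) / 24))"
      unfolding W by (simp only: mult_ac)
    also have "\<dots> = w (l1 * l2) a b * f z" unfolding ee_add[symmetric] by (simp add: ee_def)
    finally have main: "w l1 a1 b1 * w l2 a2 b2 * f (act (rep_mat l2 (a2, b2)) (act (rep_mat l1 (a1, b1)) \<tau>)) = w (l1 * l2) a b * f z" .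
    have "rep_prod l1 l2 (\<alpha>1, \<alpha>2) = (a, b)" by (simp add: rep_prod_def 1(1,5) 2(1,5) a_def b_def B_def D_def)
    moreover have "real a powr k = real a1 powr k * real a2 powr k" unfolding a_def by (simp add: powr_mult)
    ultimately show ?thesis unfolding T_def 1(1) 2(1) using main z by (simp add: mult_ac)
  qed
  have op: "hecke_op N r l f \<tau> = of_real (real l powr (- k / 2)) * (\<Sum>\<alpha>\<in>hecke_reps N l. T l \<alpha> \<tau>)" if "Im \<tau> > 0" for l \<tau>
    using that by (simp add: hecke_op_def T_def w_def k_def f_def)
  have "hecke_op N r l1 (hecke_op N r l2 f) \<tau> = of_real (real l1 powr (- k / 2)) *
      (\<Sum>\<alpha>1\<in>hecke_reps N l1. w l1 (fst \<alpha>1) (snd \<alpha>1) * of_real (real (fst \<alpha>1) powr k) *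
        (of_real (real l2 powr (- k / 2)) * (\<Sum>\<alpha>2\<in>hecke_reps N l2. T l2 \<alpha>2 (act (rep_mat l1 \<alpha>1) \<tau>))))"
  proof -
    have "Im (act (rep_mat l1 \<alpha>1) \<tau>) > 0" if "\<alpha>1 \<in> hecke_reps N l1" for \<alpha>1
      using Im_act[OF \<tau>] rep_mat_det[OF that] pos by simp
    then show ?thesis using \<tau> op by (simp add: hecke_op_def[of N r l1] w_def k_def)
  qed
  also have "\<dots> = of_real (real l1 powr (- k / 2)) * of_real (real l2 powr (- k / 2)) *
      (\<Sum>\<alpha>1\<in>hecke_reps N l1. \<Sum>\<alpha>2\<in>hecke_reps N l2. T (l1 * l2) (rep_prod l1 l2 (\<alpha>1, \<alpha>2)) \<tau>)"
    by (simp add: T sum_distrib_left mult_ac)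
  also have "(\<Sum>\<alpha>1\<in>hecke_reps N l1. \<Sum>\<alpha>2\<in>hecke_reps N l2. T (l1 * l2) (rep_prod l1 l2 (\<alpha>1, \<alpha>2)) \<tau>) =
      (\<Sum>\<alpha>\<in>hecke_reps N (l1 * l2). T (l1 * l2) \<alpha> \<tau>)"
    using sum.reindex_bij_betw[OF bij_rep_prod[OF cop pos]] by (simp add: sum.cartesian_product case_prod_unfold)
  also have "of_real (real l1 powr (- k / 2)) * of_real (real l2 powr (- k / 2)) = complex_of_real (real (l1 * l2) powr (- k / 2))"
    by (simp add: powr_mult)
  also have "\<dots> * (\<Sum>\<alpha>\<in>hecke_reps N (l1 * l2). T (l1 * l2) \<alpha> \<tau>) = hecke_op N r (l1 * l2) f \<tau>"
    using op[OF \<tau>] by simp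
  finally show ?thesis unfolding f_def ..
qed

theorem theorem9p24:
  fixes N :: nat and r :: "nat \<Rightarrow> int" and l1 l2 :: nat
  assumes "N > 0"
    and "\<forall>n. r n \<noteq> 0 \<longrightarrow> n dvd N"
    and "N = Lcm {n. r n \<noteq> 0}"
    and "weakly_admissible N r"
    and "l1 \<in> L_f N r" and "l2 \<in> L_f N r"
    and "coprime l1 l2"
  shows "coeff_c N r (l1 * l2) = coeff_c N r l1 * coeff_c N r l2"
proof -
  let ?f = "eta_quotient N r"
  have pos: "l1 > 0" "l2 > 0" using assms(5,6) by (auto simp: L_f_def)
  obtain c1 c2 where c1: "\<And>\<tau>. hecke_op N r l1 ?f \<tau> = c1 * ?f \<tau>" and c2: "\<And>\<tau>. hecke_op N r l2 ?f \<tau> = c2 * ?f \<tau>"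
    using hecke_eigenform[OF assms(1,4,5)] hecke_eigenform[OF assms(1,4,6)] by blast
  have lin: "hecke_op N r l1 (\<lambda>\<tau>. c2 * ?f \<tau>) \<tau> = c2 * hecke_op N r l1 ?f \<tau>" for \<tau>
    by (simp add: hecke_op_def sum_distrib_left mult_ac)
  have "hecke_op N r l2 ?f = (\<lambda>\<tau>. c2 * ?f \<tau>)" using c2 by (rule ext)
  then have "hecke_op N r (l1 * l2) ?f \<tau> = c1 * c2 * ?f \<tau>" if "Im \<tau> > 0" for \<tau>
    using hecke_op_mult[OF assms(1,5-7) that] lin c1 by simp
  then have "coeff_c N r (l1 * l2) = c1 * c2"
    using pos by (intro eigenvalue_eq_coeff_c assms(1)) auto
  moreover have "coeff_c N r l1 = c1" "coeff_c N r l2 = c2"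
    using pos c1 c2 by (auto intro!: eigenvalue_eq_coeff_c assms(1))
  ultimately show ?thesis by simp
qed

end
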